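(* Let $p$ be a prime, $H$ a positive integer and $\mathcal I=\{1,2,\dots,H\}\pmod p\subset\mathbb F_p$ (so $|\mathcal I|=H$). Let $\mathcal G$ be either a subgroup of $\mathbb F_p^*$, or a set $\{1,g,g^2,\dots,g^{N-1}\}\pmod p$ with $|\mathcal G|=N$ elements, where $g$ is a primitive root modulo $p$. For any fixed $\varepsilon>0$ there is $\delta=\delta(\varepsilon)>0$ such that if $|\mathcal I|>p^{5/8+\varepsilon}$ and $|\mathcal G|>p^{3/8}$, then $$|\mathcal I\cdot\mathcal G|=p+O(p^{1-\delta}),$$ where the implied constant depends only on $\varepsilon$.
   Context: $\mathbb F_p$ is the field of residue classes modulo $p$ and $\mathcal A\cdot\mathcal B=\{ab:a\in\mathcal A,b\in\mathcal B\}$. *)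

theory Defs
  imports Complex_Main "HOL-Number_Theory.Number_Theory"
begin

text \<open>
  The field of residues modulo \<open>p\<close> is \<open>residue_ring (int p)\<close>, with carrier \<open>{0..int p - 1}\<close>; a type-indexed
  version would not allow quantification over \<open>p\<close> inside a formula.
\<close>

definition interval_mod :: "nat \<Rightarrow> nat \<Rightarrow> int set" where
  "interval_mod p H = (\<lambda>h. int h mod int p) ` {1..H}"

definition power_set_mod :: "nat \<Rightarrow> nat \<Rightarrow> nat \<Rightarrow> int set" where
  "power_set_mod p g N = (\<lambda>i. int g ^ i mod int p) ` {..<N}"

end

theory Submission
  imports Defs "HOL-Analysis.Analysis" "HOL-Algebra.Algebraic_Closure_Type" "HOL-Algebra.Sylow"
    "HOL-Computational_Algebra.Computational_Algebra" "Berlekamp_Zassenhaus.Finite_Field"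
begin

text \<open>
  The structure of \<open>G\<close> plays no role: any \<open>N\<close> nonzero residues will do. Let \<open>S\<^sub>D(\<phi>)\<close> be the sum of a
  character \<open>\<phi>\<close> modulo \<open>p\<close> over \<open>{1..D}\<close>. By orthogonality, the residues that are not of the form
  \<open>a * u\<^sub>1 * \<dots> * u\<^sub>j * g\<close> with \<open>a \<le> A\<close>, \<open>u\<^sub>i \<le> U\<close>, \<open>g \<in> G\<close> are few as soon as the second moment of
  \<open>S\<^sub>A(\<phi>) * S\<^sub>U(\<phi>) ^ j * S\<^sub>G(\<phi>)\<close> over the nonprincipal \<open>\<phi>\<close> is small. Here \<open>U\<close> is a small power of \<open>p\<close>, \<open>A = U ^ m\<close> is
  slightly larger than \<open>p powr (1/4)\<close>, and \<open>A * U ^ j\<close> is just below \<open>p powr (5/8 + \<epsilon>)\<close>.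

  Two ingredients control this moment. First, Burgess' bound gives a power saving in \<open>S\<^sub>A(\<phi>)\<close>; it rests on Weil's
  bound for complete sums, obtained by Stepanov's method applied to the prime polynomials over the prime field.
  Secondly, if \<open>N * D\<^sub>1 * \<dots> * D\<^sub>l \<le> p\<close>, the multiplicative energy of \<open>G\<close> and the box \<open>{1..D\<^sub>1} \<times> \<dots> \<times> {1..D\<^sub>l}\<close> is,
  up to \<open>p powr \<kappa>\<close>, only its diagonal \<open>N * D\<^sub>1 * \<dots> * D\<^sub>l\<close>. To see this, fix \<open>g\<close> and \<open>g'\<close>: the solutions of
  \<open>g * x = g' * y\<close> form a lattice, and either they are all multiples of one short vector, whose coordinates again
  factor along a box of volume \<open>O(N)\<close>, or they are equidistributed. This bounds all energies by those of boxes of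
  volume \<open>O(N)\<close>, and the log-convexity of the energy lets the inequality improve itself.

  If \<open>S\<^sub>U(\<phi>)\<close> is small, save on one factor \<open>S\<^sub>U\<close>; otherwise save on \<open>S\<^sub>A\<close> and replace it by \<open>m - 1\<close> further factors
  \<open>S\<^sub>U\<close>. In both cases a box of volume about \<open>p / N\<close> remains, for which the energy bound is sharp.
\<close>

hide_const (open) Divisibility.prime Divisibility.irreducible Polynomials.lead_coeff Polynomials.degree
  UnivPoly.coeff UnivPoly.monom Module.smult Ring_Divisibility.mult_of


section \<open>Finite fields and prime polynomials\<close>

lemma prime_dvd_CARD_imp_eq_CHAR:
  assumes r: "prime r" "r dvd CARD('a::finite_field)"
  shows "r = CHAR('a)"
proof -
  define A :: "'a monoid" where "A = \<lparr>carrier = UNIV, mult = (+), one = 0\<rparr>"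
  interpret A: group A
    by (rule groupI) (auto simp: A_def add.assoc intro: exI[of _ "- x" for x])
  have pow_A: "x [^]\<^bsub>A\<^esub> n = of_nat n * x" for x and n :: nat
    by (induction n) (simp_all add: A_def nat_pow_def algebra_simps)
  define a where "a = multiplicity r CARD('a)"
  have "r ^ a dvd CARD('a)" by (simp add: a_def multiplicity_dvd)
  then obtain m where "CARD('a) = r ^ a * m" by (rule dvdE)
  then obtain H where H: "subgroup H A" "card H = r ^ a"
    using sylow_thm[OF r(1) A.group_axioms, of a m] by (auto simp: A_def Coset.order_def)
  have "a > 0" using r by (simp add: a_def prime_multiplicity_gt_zero_iff)
  then have "card H > 1" using H(2) one_less_power[OF prime_gt_1_nat[OF r(1)]] by simp
  then have "\<not> H \<subseteq> {0}" using card_mono[of "{0}" H] by auto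
  then obtain x where x: "x \<in> H" "x \<noteq> 0" by blast
  interpret H: group "A\<lparr>carrier := H\<rparr>"
    using H(1) A.group_axioms by (rule subgroup.subgroup_is_group)
  have "x [^]\<^bsub>A\<lparr>carrier := H\<rparr>\<^esub> card H = \<one>\<^bsub>A\<lparr>carrier := H\<rparr>\<^esub>"
    using H.pow_order_eq_1[of x] x by (simp add: Coset.order_def)
  then have "of_nat (card H) * x = 0"
    using pow_A[of x "card H"] by (simp add: A_def nat_pow_def)
  then have "of_nat (r ^ a) * x = 0" unfolding H(2) .
  then have "CHAR('a) dvd r ^ a" using x by (simp only: mult_eq_0_iff of_nat_eq_0_iff_char_dvd) simp
  then show ?thesis using r(1) by (metis CHAR_prime prime_dvd_power primes_dvd_imp_eq)
qed

lemma one_less_CARD_finite_field: "1 < CARD('a::finite_field)"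
  using card_mono[of UNIV "{0, 1 :: 'a}"] by simp

lemma ex_CARD_eq_CHAR_power: "\<exists>k. CARD('a::finite_field) = CHAR('a) ^ k"
proof -
  have "prime_factors CARD('a) \<subseteq> {CHAR('a)}"
    using prime_dvd_CARD_imp_eq_CHAR[where ?'a = 'a] by auto
  then have "(\<Prod>r\<in>prime_factors CARD('a). r ^ multiplicity r CARD('a)) =
      (\<Prod>r\<in>{CHAR('a)}. r ^ multiplicity r CARD('a))"
    by (intro prod.mono_neutral_left) (auto simp: prime_factors_multiplicity)
  then have "CARD('a) = CHAR('a) ^ multiplicity CHAR('a) CARD('a)"
    using prod_prime_factors[of "CARD('a)"] by simp
  then show ?thesis by blast
qed

lemma CARD_power_add:
  fixes x y :: "'b::comm_semiring_1"
  assumes "CHAR('b) = CHAR('a::finite_field)" and "q = CARD('a) ^ n"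
  shows "(x + y) ^ q = x ^ q + y ^ q"
proof -
  obtain k where "CARD('a) = CHAR('a) ^ k" using ex_CARD_eq_CHAR_power by blast
  then show ?thesis
    using assms by (intro freshmans_dream'[where n = "k * n"]) (simp_all add: power_mult)
qed

lemma CARD_power_diff:
  fixes x y :: "'b::comm_ring_1"
  assumes "CHAR('b) = CHAR('a::finite_field)" and "q = CARD('a) ^ n"
  shows "(x - y) ^ q = x ^ q - y ^ q"
  using CARD_power_add[OF assms, of "x - y" y] by simp

definition prime_monics :: "'a::field_gcd poly set" where
  "prime_monics = {P. prime_elem P \<and> lead_coeff P = 1}"

lemma prime_monics_prime_elem: "P \<in> prime_monics \<Longrightarrow> prime_elem P"
  by (simp add: prime_monics_def)

lemma prime_monics_degree_pos: "P \<in> prime_monics \<Longrightarrow> degree P > 0"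
  unfolding prime_monics_def
  by (metis (mono_tags, lifting) gr0I is_unit_iff_degree mem_Collect_eq prime_elem_not_unit prime_elem_not_zeroI)

lemma prime_monics_coprime:
  assumes "P \<in> prime_monics" "Q \<in> prime_monics" "P \<noteq> Q"
  shows "coprime P Q"
  using assms
  by (intro primes_coprime)
     (simp_all add: prime_monics_def normalization_semidom_class.prime_def normalize_monic)

lemma not_dvd_pderiv_if_dvd_monom_diff:
  fixes P :: "'a::field_gcd poly"
  assumes P: "prime_elem P" "[monom 1 q = monom 1 1] (mod P)" and q: "of_nat q = (0 :: 'a)"
  shows "\<not> P dvd pderiv P"
proof
  assume dvd: "P dvd pderiv P"
  obtain Q where Q: "monom 1 q - monom 1 1 = P * Q"
    using P(2) unfolding cong_iff_dvd_diff by (rule dvdE)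
  have "pderiv (monom 1 q - monom 1 1 :: 'a poly) = P * pderiv Q + Q * pderiv P"
    unfolding Q by (simp add: pderiv_mult)
  moreover have "pderiv (monom 1 q - monom 1 1 :: 'a poly) = - 1"
    using q by (simp add: pderiv_diff pderiv_monom)
  ultimately have "- 1 = P * pderiv Q + Q * pderiv P" by simp
  then have "P dvd 1" using dvd by (metis dvd_add dvd_minus_iff dvd_mult dvd_triv_left)
  then show False using P(1) prime_elem_not_unit by blast
qed

lemma const_poly_prod: "[:\<Prod>c\<in>A. u c:] = (\<Prod>c\<in>A. [:u c:])" for u :: "'b \<Rightarrow> 'a::comm_ring_1"
proof (induction A rule: infinite_finite_induct)
  case (insert x A)
  then show ?case by (simp flip: insert.IH)
qed (auto simp: one_pCons)

definition root_prod :: "'a::comm_ring_1 set \<Rightarrow> ('a \<Rightarrow> nat) \<Rightarrow> 'a poly" where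
  "root_prod S m = (\<Prod>c\<in>S. [:- c, 1:] ^ m c)"

lemma root_prod_mult: "root_prod S m * root_prod S m' = root_prod S (\<lambda>c. m c + m' c)"
  by (simp add: root_prod_def power_add prod.distrib)

lemma root_prod_power: "root_prod S m ^ k = root_prod S (\<lambda>c. k * m c)"
  by (simp add: root_prod_def prod_power_distrib mult.commute flip: power_mult)

lemma degree_root_prod:
  fixes S :: "'a::idom set"
  shows "degree (root_prod S m) = (\<Sum>c\<in>S. m c)"
  unfolding root_prod_def by (subst degree_prod_sum_eq) (simp_all add: degree_linear_power)

lemma root_prod_nonzero:
  fixes S :: "'a::idom set"
  shows "root_prod S m \<noteq> 0"
  by (cases "finite S") (simp_all add: root_prod_def)

section \<open>Stepanov's method\<close>

text \<open>\<open>R (X + Y)\<close> as a polynomial in \<open>Y\<close>; its coefficients are the Hasse derivatives of \<open>R\<close>.\<close>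

definition taylor_poly :: "'a::comm_ring_1 poly \<Rightarrow> 'a poly poly" where
  "taylor_poly R = pcompose (map_poly (\<lambda>c. [:c:]) R) [:[:0, 1:], 1:]"

lemma taylor_poly_0 [simp]: "taylor_poly 0 = 0"
  by (simp add: taylor_poly_def)

lemma taylor_poly_pCons:
  "taylor_poly (pCons a R) = [:[:a:]:] + [:[:0, 1:], 1:] * taylor_poly R"
  by (cases "pCons a R = 0") (simp_all add: taylor_poly_def map_poly_pCons pcompose_pCons)

lemma taylor_poly_const [simp]: "taylor_poly [:a:] = [:[:a:]:]"
  by (simp add: taylor_poly_pCons)

lemma taylor_poly_1 [simp]: "taylor_poly 1 = 1"
  using taylor_poly_const[of 1] by (simp add: one_pCons)

lemma taylor_poly_add: "taylor_poly (R + Q) = taylor_poly R + taylor_poly Q"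
proof (induction R Q rule: poly_induct2)
  case (pCons a R b Q)
  have "[:[:a + b:]:] = [:[:a:]:] + [:[:b:]:]" by simp
  then have "[:[:a + b:]:] + [:[:0, 1:], 1:] * (taylor_poly R + taylor_poly Q) =
      ([:[:a:]:] + [:[:0, 1:], 1:] * taylor_poly R) + ([:[:b:]:] + [:[:0, 1:], 1:] * taylor_poly Q)"
    by (simp only: distrib_left add_ac)
  then show ?case
    by (simp only: taylor_poly_pCons pCons.IH add_pCons[of a R b Q])
qed simp

lemma taylor_poly_smult: "taylor_poly (smult a R) = [:[:a:]:] * taylor_poly R"
  by (induction R) (simp_all add: taylor_poly_pCons algebra_simps)

lemma taylor_poly_diff: "taylor_poly (R - Q) = taylor_poly R - taylor_poly Q"
  using taylor_poly_add[of "R - Q" Q] by simp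

lemma taylor_poly_mult: "taylor_poly (R * Q) = taylor_poly R * taylor_poly Q"
  by (induction R) (simp_all add: taylor_poly_pCons taylor_poly_add taylor_poly_smult algebra_simps)

lemma taylor_poly_power: "taylor_poly (R ^ n) = taylor_poly R ^ n"
  by (induction n) (simp_all add: taylor_poly_mult)

lemma taylor_poly_sum: "taylor_poly (\<Sum>i\<in>A. f i) = (\<Sum>i\<in>A. taylor_poly (f i))"
  by (induction A rule: infinite_finite_induct) (simp_all add: taylor_poly_add)

lemma taylor_poly_prod: "taylor_poly (\<Prod>i\<in>A. f i) = (\<Prod>i\<in>A. taylor_poly (f i))"
  by (induction A rule: infinite_finite_induct) (simp_all add: taylor_poly_mult)

lemma taylor_poly_linear: "taylor_poly [:a, 1:] = [:[:a, 1:], 1:]"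
  by (simp add: taylor_poly_pCons)

lemma coeff_taylor_poly_0: "coeff (taylor_poly R) 0 = R"
  by (induction R) (simp_all add: taylor_poly_pCons)

lemma coeff_taylor_poly_1: "coeff (taylor_poly R) (Suc 0) = pderiv R"
proof (induction R)
  case (pCons a R)
  show ?case
    using pCons.IH
    by (simp add: taylor_poly_pCons coeff_pCons pderiv_pCons coeff_taylor_poly_0)
qed simp

definition polys_below :: "nat \<Rightarrow> 'a::zero poly set" where
  "polys_below n = {h. \<forall>i\<ge>n. coeff h i = 0}"

lemma polys_below_0 [simp]: "polys_below 0 = {0}"
  by (auto simp: polys_below_def poly_eq_iff)

lemma zero_in_polys_below [simp]: "0 \<in> polys_below n"
  by (simp add: polys_below_def)

lemma polys_below_mono: "m \<le> n \<Longrightarrow> polys_below m \<subseteq> polys_below n"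
  by (auto simp: polys_below_def)

lemma polys_below_add: "f \<in> polys_below n \<Longrightarrow> g \<in> polys_below n \<Longrightarrow> f + g \<in> polys_below n"
  by (auto simp: polys_below_def)

lemma polys_below_diff:
  fixes f g :: "'a::ab_group_add poly"
  shows "f \<in> polys_below n \<Longrightarrow> g \<in> polys_below n \<Longrightarrow> f - g \<in> polys_below n"
  by (auto simp: polys_below_def)

lemma polys_below_sum:
  "(\<And>i. i \<in> A \<Longrightarrow> f i \<in> polys_below n) \<Longrightarrow> (\<Sum>i\<in>A. f i) \<in> polys_below n"
  by (induction A rule: infinite_finite_induct) (auto intro: polys_below_add)

lemma polys_below_iff_degree: "h \<in> polys_below n \<longleftrightarrow> h = 0 \<or> degree h < n"
proof
  assume h: "h \<in> polys_below n"
  show "h = 0 \<or> degree h < n"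
  proof (rule ccontr)
    assume "\<not> ?thesis"
    then have "coeff h (degree h) = 0" "h \<noteq> 0" using h by (auto simp: polys_below_def)
    then show False by simp
  qed
qed (auto simp: polys_below_def intro: coeff_eq_0)

lemma polys_below_mult:
  fixes f g :: "'a::comm_ring_1 poly"
  assumes "f \<in> polys_below (Suc m)" "g \<in> polys_below n"
  shows "f * g \<in> polys_below (m + n)"
proof (cases "f = 0 \<or> g = 0")
  case False
  then have "degree f \<le> m" "degree g < n" using assms by (auto simp: polys_below_iff_degree)
  then have "degree (f * g) < m + n" using degree_mult_le[of f g] by linarith
  then show ?thesis by (simp add: polys_below_iff_degree)
qed auto

lemma polys_below_Suc: "polys_below (Suc n) = (\<lambda>(a, h). pCons a h) ` (UNIV \<times> polys_below n)"
proof (intro equalityI subsetI)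
  fix h :: "'a poly" assume h: "h \<in> polys_below (Suc n)"
  obtain a g where g: "h = pCons a g" by (cases h)
  have "g \<in> polys_below n"
    unfolding polys_below_def
  proof safe
    fix i assume "n \<le> i"
    then have "coeff h (Suc i) = 0" using h by (simp add: polys_below_def)
    then show "coeff g i = 0" by (simp add: g)
  qed
  then show "h \<in> (\<lambda>(a, h). pCons a h) ` (UNIV \<times> polys_below n)" using g by auto
qed (auto simp: polys_below_def coeff_pCons split: nat.splits)

lemma finite_polys_below [simp]: "finite (polys_below n :: 'a::{finite, zero} poly set)"
  by (induction n) (simp_all add: polys_below_Suc)

lemma card_polys_below: "card (polys_below n :: 'a::{finite, zero} poly set) = CARD('a) ^ n"
proof (induction n)
  case (Suc n)
  have "inj_on (\<lambda>(a, h). pCons a h) (UNIV \<times> (polys_below n :: 'a poly set))"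
    by (auto simp: inj_on_def)
  then show ?case
    by (simp add: polys_below_Suc card_image card_cartesian_product Suc)
qed simp

lemma linear_power_in_polys_below: "[:a, 1 :: 'a::comm_ring_1:] ^ k \<in> polys_below (Suc k)"
  unfolding polys_below_def
  using degree_power_le[of "[:a, 1:]" k] by (auto intro!: coeff_eq_0)

lemma coeff_taylor_poly_in_polys_below: "h \<in> polys_below n \<Longrightarrow> coeff (taylor_poly h) k \<in> polys_below n"
proof (induction n arbitrary: h k)
  case (Suc n)
  then obtain a g where h: "h = pCons a g" and g: "g \<in> polys_below n" by (auto simp: polys_below_Suc)
  have shifted: "[:0, 1:] * coeff (taylor_poly g) i \<in> polys_below (Suc n)" for i
    using polys_below_mult[of "[:0, 1:]" 1 "coeff (taylor_poly g) i" n] Suc.IH[OF g, of i]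
    by (simp add: polys_below_def coeff_pCons split: nat.splits)
  show ?case
  proof (cases k)
    case 0
    have "[:a:] \<in> polys_below (Suc n)" by (simp add: polys_below_def coeff_pCons split: nat.splits)
    then have "[:a:] + [:0, 1:] * coeff (taylor_poly g) 0 \<in> polys_below (Suc n)"
      by (rule polys_below_add[OF _ shifted])
    then show ?thesis using 0 by (simp add: h taylor_poly_pCons)
  next
    case (Suc k')
    have "coeff (taylor_poly g) k' \<in> polys_below (Suc n)"
      using Suc.IH[OF g, of k'] polys_below_mono[of n "Suc n"] by auto
    then show ?thesis using Suc polys_below_add[OF shifted[of k]]
      by (simp add: h taylor_poly_pCons coeff_pCons)
  qed
qed simp

definition trunc_eq :: "nat \<Rightarrow> 'a::comm_ring_1 poly \<Rightarrow> 'a poly \<Rightarrow> bool" where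
  "trunc_eq M f g \<longleftrightarrow> (\<forall>k<M. coeff f k = coeff g k)"

lemma trunc_eq_refl [simp]: "trunc_eq M f f"
  by (simp add: trunc_eq_def)

lemma trunc_eq_mult: "trunc_eq M f f' \<Longrightarrow> trunc_eq M g g' \<Longrightarrow> trunc_eq M (f * g) (f' * g')"
  by (auto simp: trunc_eq_def coeff_mult intro!: sum.cong)

lemma trunc_eq_sum: "(\<And>i. i \<in> A \<Longrightarrow> trunc_eq M (f i) (g i)) \<Longrightarrow> trunc_eq M (sum f A) (sum g A)"
  by (auto simp: trunc_eq_def coeff_sum intro!: sum.cong)

lemma trunc_eq_prod: "(\<And>i. i \<in> A \<Longrightarrow> trunc_eq M (f i) (g i)) \<Longrightarrow> trunc_eq M (prod f A) (prod g A)"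
  by (induction A rule: infinite_finite_induct) (auto intro: trunc_eq_mult)

lemma trunc_eq_power: "trunc_eq M f g \<Longrightarrow> trunc_eq M (f ^ n) (g ^ n)"
  by (induction n) (auto intro: trunc_eq_mult)


lemma coeff_taylor_poly_power_mult_cong:
  fixes P Q :: "'a::field poly"
  shows "[coeff (taylor_poly (P ^ j * Q)) j = pderiv P ^ j * Q] (mod P)"
proof -
  obtain Z where Z: "taylor_poly P = pCons P Z"
    using coeff_taylor_poly_0[of P] by (cases "taylor_poly P") auto
  have Z_0: "coeff Z 0 = pderiv P" using coeff_taylor_poly_1[of P] Z by simp
  define Y where "Y = [:0, 1 :: 'a poly:]"
  have "([:P:] + Y * Z) - Y * Z dvd ([:P:] + Y * Z) ^ j - (Y * Z) ^ j"
    by (metis dvd_triv_left power_diff_sumr2)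
  then have "[:P:] dvd ([:P:] + Y * Z) ^ j - (Y * Z) ^ j" by simp
  then obtain W where "([:P:] + Y * Z) ^ j = [:P:] * W + (Y * Z) ^ j"
    by (metis dvd_def diff_add_cancel)
  moreover have "taylor_poly P = [:P:] + Y * Z" by (simp add: Z Y_def)
  moreover have "Y ^ j = monom 1 j" by (simp add: Y_def monom_altdef)
  ultimately have "taylor_poly (P ^ j * Q) =
      [:P:] * (W * taylor_poly Q) + monom 1 j * (Z ^ j * taylor_poly Q)"
    by (simp add: taylor_poly_mult taylor_poly_power power_mult_distrib algebra_simps)
  then have "coeff (taylor_poly (P ^ j * Q)) j =
      P * coeff (W * taylor_poly Q) j + coeff (Z ^ j * taylor_poly Q) 0"
    by (simp add: coeff_monom_mult)
  also have "coeff (Z ^ j * taylor_poly Q) 0 = pderiv P ^ j * Q"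
    by (simp add: coeff_mult_0 coeff_0_power Z_0 coeff_taylor_poly_0)
  finally show ?thesis by (simp add: cong_iff_dvd_diff)
qed

lemma taylor_vanishing_imp_power_dvd:
  fixes P R :: "'a::field_gcd poly"
  assumes P: "prime_elem P" "\<not> P dvd pderiv P"
    and vanishing: "\<And>k. k < M \<Longrightarrow> P dvd coeff (taylor_poly R) k"
  shows "P ^ M dvd R"
proof -
  have "P ^ j dvd R" if "j \<le> M" for j
    using that
  proof (induction j)
    case (Suc j)
    then have "P ^ j dvd R" by simp
    then obtain Q where Q: "R = P ^ j * Q" by (rule dvdE)
    have "P dvd coeff (taylor_poly R) j" using vanishing[of j] Suc.prems by simp
    then have "P dvd pderiv P ^ j * Q"
      using coeff_taylor_poly_power_mult_cong[of P j Q] unfolding Q by (simp add: cong_dvd_iff)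
    then have "P dvd Q" using P prime_elem_dvd_mult_iff prime_elem_dvd_power by blast
    then show ?case unfolding Q power_Suc2 by (rule mult_dvd_mono[OF dvd_refl])
  qed simp
  then show ?thesis by simp
qed

lemma coeffs_in_polys_below_mult:
  fixes f g :: "'a::comm_ring_1 poly poly"
  assumes "\<And>k. coeff f k \<in> polys_below (Suc a)" "\<And>k. coeff g k \<in> polys_below b"
  shows "coeff (f * g) k \<in> polys_below (a + b)"
  unfolding coeff_mult by (intro polys_below_sum polys_below_mult assms)

lemma coeffs_in_polys_below_prod:
  fixes f :: "'b \<Rightarrow> 'a::comm_ring_1 poly poly"
  assumes "finite A" "\<And>c k. c \<in> A \<Longrightarrow> coeff (f c) k \<in> polys_below (Suc a)"
  shows "coeff (\<Prod>c\<in>A. f c) k \<in> polys_below (Suc (card A * a))"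
  using assms
proof (induction A arbitrary: k rule: finite_induct)
  case empty
  then show ?case by (cases k) (auto simp: polys_below_def coeff_pCons one_pCons split: nat.splits)
next
  case (insert x A)
  have "coeff (f x * (\<Prod>c\<in>A. f c)) k \<in> polys_below (a + Suc (card A * a))"
    using insert by (intro coeffs_in_polys_below_mult) auto
  then show ?case using insert by simp
qed

lemma sum_separated_powers_nonzero:
  fixes \<pi> :: "'a::idom"
  assumes N: "finite N" "N \<noteq> {}" and \<pi>: "\<pi> \<noteq> 0"
    and separated: "\<And>i i'. i \<in> N \<Longrightarrow> i' \<in> N \<Longrightarrow> i \<noteq> i' \<Longrightarrow> w i \<le> w i' \<Longrightarrow> w i + e \<le> w i'"
    and not_dvd: "\<And>i. i \<in> N \<Longrightarrow> \<not> \<pi> ^ e dvd b i"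
  shows "(\<Sum>i\<in>N. \<pi> ^ w i * b i) \<noteq> 0"
proof
  assume zero: "(\<Sum>i\<in>N. \<pi> ^ w i * b i) = 0"
  obtain i0 where i0: "i0 \<in> N" "\<And>i. i \<in> N \<Longrightarrow> w i0 \<le> w i"
    using arg_min_if_finite[OF N, of w] by (metis leI)
  have "\<pi> ^ (w i0 + e) dvd (\<Sum>i\<in>N - {i0}. \<pi> ^ w i * b i)"
  proof (rule dvd_sum)
    fix i assume "i \<in> N - {i0}"
    then have "w i0 + e \<le> w i" using i0 by (intro separated) auto
    then show "\<pi> ^ (w i0 + e) dvd \<pi> ^ w i * b i" by (intro dvd_mult2 le_imp_power_dvd)
  qed
  moreover have "\<pi> ^ w i0 * b i0 = - (\<Sum>i\<in>N - {i0}. \<pi> ^ w i * b i)"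
    using zero N(1) i0(1) by (simp add: sum.remove eq_neg_iff_add_eq_0)
  ultimately have "\<pi> ^ w i0 * \<pi> ^ e dvd \<pi> ^ w i0 * b i0" by (simp add: power_add)
  then show False using \<pi> not_dvd[OF i0(1)] by simp
qed

lemma base_weights_separated:
  fixes d e q j j' k k' :: nat
  assumes "j < d" "j' < d" "d * e < q" "(j, k) \<noteq> (j', k')" "j * e + q * k \<le> j' * e + q * k'"
  shows "j * e + q * k + e \<le> j' * e + q * k'"
proof -
  have block: "j * e + e \<le> d * e" "j' * e + e \<le> d * e"
    using assms(1,2) mult_le_mono1[of "Suc j" d e] mult_le_mono1[of "Suc j'" d e] by auto
  consider "k = k'" | "k < k'" | "k' < k" by linarith
  then show ?thesis
  proof cases
    assume "k = k'"
    then have "j * e \<le> j' * e" "j \<noteq> j'" using assms by auto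
    then have "e = 0 \<or> Suc j \<le> j'" by auto
    then show ?thesis using \<open>k = k'\<close> mult_le_mono1[of "Suc j" j' e] by auto
  next
    assume "k < k'"
    then have "q * k + q \<le> q * k'" using mult_le_mono2[of "Suc k" k' q] by simp
    then show ?thesis using block assms(3) by linarith
  next
    assume "k' < k"
    then have "q * k' + q \<le> q * k" using mult_le_mono2[of "Suc k'" k q] by simp
    then show ?thesis using block assms(3,5) by linarith
  qed
qed

text \<open>If the polynomial family \<open>h\<close> is chosen such that all \<open>reduced_coeff h k\<close> vanish, \<open>auxiliary h\<close> vanishes to
  order \<open>M\<close> at every root of a polynomial modulo which \<open>X ^ q \<equiv> X\<close> and \<open>f ^ e \<equiv> \<alpha>\<close>. Taylor coefficients
  replace derivatives, as the order of vanishing exceeds the characteristic.\<close>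

locale stepanov =
  fixes S :: "'a::{finite_field, field_gcd} set" and m :: "'a \<Rightarrow> nat" and c0 :: 'a
    and n d e q M K :: nat and \<alpha> :: 'a
  assumes simple_root: "c0 \<in> S" "m c0 = 1"
    and q: "q = CARD('a) ^ n" and de: "d * e = q - 1" and M_le_q: "M \<le> q"
    and more_unknowns: "M * (K + card S * M + e) < K * d * e"
begin

definition f where "f = root_prod S m"
definition \<pi> where "\<pi> = [:- c0, 1:]"
definition index_set where "index_set = {..<d} \<times> {..<K}"
definition reduced_taylor :: "'a \<Rightarrow> nat \<Rightarrow> 'a poly poly" where
  "reduced_taylor c E = (\<Sum>k<M. monom (of_nat ((M + E) choose k) * [:- c, 1:] ^ (M - k)) k)"
definition reduced_taylor_prod :: "nat \<Rightarrow> 'a poly poly" where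
  "reduced_taylor_prod j = (\<Prod>c\<in>S. reduced_taylor c (e * j * m c))"
definition reduced_coeff where
  "reduced_coeff h k = (\<Sum>(j, k')\<in>index_set.
     smult (\<alpha> ^ j) (\<pi> ^ k' * coeff (taylor_poly (h (j, k')) * reduced_taylor_prod j) k))"
definition auxiliary where
  "auxiliary h = root_prod S (\<lambda>_. M) * (\<Sum>(j, k)\<in>index_set. h (j, k) * f ^ (e * j) * \<pi> ^ (q * k))"

lemma finite_index_set [simp]: "finite index_set"
  by (simp add: index_set_def)

lemma q_pos: "q > 0"
  by (simp add: q)

lemma n_pos: "n > 0"
proof (rule ccontr)
  assume "\<not> n > 0"
  then have "d * e = 0" using q de by simp
  then show False using more_unknowns by auto
qed

lemma coeff_reduced_taylor: "coeff (reduced_taylor c E) k \<in> polys_below (Suc M)"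
proof -
  have "coeff (reduced_taylor c E) k =
      (\<Sum>i<M. if i = k then of_nat ((M + E) choose i) * [:- c, 1:] ^ (M - i) else 0)"
    by (simp add: reduced_taylor_def coeff_sum)
  also have "\<dots> \<in> polys_below (Suc M)"
  proof (intro polys_below_sum)
    fix i
    have "[:- c, 1:] ^ (M - i) \<in> polys_below (Suc M)"
      using linear_power_in_polys_below[of "- c" "M - i"] polys_below_mono[of "Suc (M - i)" "Suc M"] by auto
    then show "(if i = k then of_nat ((M + E) choose i) * [:- c, 1:] ^ (M - i) else 0) \<in> polys_below (Suc M)"
      by (auto simp: polys_below_def of_nat_poly)
  qed
  finally show ?thesis .
qed

lemma taylor_linear_power:
  "trunc_eq M (taylor_poly ([:- c, 1:] ^ (M + E))) ([:[:- c, 1:] ^ E:] * reduced_taylor c E)"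
proof -
  have "coeff (taylor_poly ([:- c, 1:] ^ (M + E))) k = coeff ([:[:- c, 1:] ^ E:] * reduced_taylor c E) k"
    if k: "k < M" for k
  proof -
    have "coeff (taylor_poly ([:- c, 1:] ^ (M + E))) k = of_nat ((M + E) choose k) * [:- c, 1:] ^ (M + E - k)"
      using k by (simp add: taylor_poly_power taylor_poly_linear coeff_linear_poly_power)
    also have "[:- c, 1:] ^ (M + E - k) = [:- c, 1:] ^ E * [:- c, 1:] ^ (M - k)"
      using k by (simp flip: power_add) (simp add: add.commute)
    also have "coeff (reduced_taylor c E) k = of_nat ((M + E) choose k) * [:- c, 1:] ^ (M - k)"
      using k by (simp add: reduced_taylor_def coeff_sum)
    ultimately show ?thesis by simp
  qed
  then show ?thesis by (simp add: trunc_eq_def)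
qed

lemma taylor_root_prod_power:
  "trunc_eq M (taylor_poly (root_prod S (\<lambda>_. M) * f ^ (e * j))) ([:f ^ (e * j):] * reduced_taylor_prod j)"
proof -
  have "root_prod S (\<lambda>_. M) * f ^ (e * j) = (\<Prod>c\<in>S. [:- c, 1:] ^ (M + e * j * m c))"
    by (simp add: f_def root_prod_power root_prod_mult) (simp add: root_prod_def)
  moreover have "[:f ^ (e * j):] = (\<Prod>c\<in>S. [:[:- c, 1:] ^ (e * j * m c):])"
    by (simp add: f_def root_prod_power) (simp add: root_prod_def const_poly_prod)
  ultimately show ?thesis
    unfolding reduced_taylor_prod_def
    by (simp only: taylor_poly_prod prod.distrib[symmetric]) (intro trunc_eq_prod taylor_linear_power)
qed

lemma taylor_\<pi>_power_q: "trunc_eq M (taylor_poly (\<pi> ^ q)) [:\<pi> ^ q:]"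
proof -
  have "[:\<pi>, 1:] = [:\<pi>:] + monom 1 1" by (simp add: monom_altdef)
  then have "taylor_poly (\<pi> ^ q) = ([:\<pi>:] + monom 1 1) ^ q"
    by (simp add: taylor_poly_power \<pi>_def taylor_poly_linear)
  also have "\<dots> = [:\<pi>:] ^ q + monom 1 1 ^ q" by (rule CARD_power_add[OF _ q]) simp
  also have "\<dots> = [:\<pi> ^ q:] + monom 1 q" by (simp add: poly_const_pow monom_power)
  finally show ?thesis using M_le_q by (simp add: trunc_eq_def)
qed

lemma coeff_taylor_auxiliary:
  assumes "k < M"
  shows "coeff (taylor_poly (auxiliary h)) k =
    (\<Sum>(j, k')\<in>index_set. f ^ (e * j) * \<pi> ^ (q * k') * coeff (taylor_poly (h (j, k')) * reduced_taylor_prod j) k)"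
proof -
  have "taylor_poly (auxiliary h) = (\<Sum>(j, k')\<in>index_set.
      taylor_poly (h (j, k')) * taylor_poly (root_prod S (\<lambda>_. M) * f ^ (e * j)) * taylor_poly (\<pi> ^ q) ^ k')"
    by (simp add: auxiliary_def sum_distrib_left taylor_poly_sum taylor_poly_mult taylor_poly_power
        power_mult split_def mult_ac flip: power_mult)
  moreover have "trunc_eq M \<dots> (\<Sum>(j, k')\<in>index_set.
      taylor_poly (h (j, k')) * ([:f ^ (e * j):] * reduced_taylor_prod j) * [:\<pi> ^ q:] ^ k')"
    unfolding split_def
    by (intro trunc_eq_sum trunc_eq_mult trunc_eq_refl taylor_root_prod_power trunc_eq_power taylor_\<pi>_power_q)
  ultimately have "coeff (taylor_poly (auxiliary h)) k = coeff (\<Sum>(j, k')\<in>index_set.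
      taylor_poly (h (j, k')) * ([:f ^ (e * j):] * reduced_taylor_prod j) * [:\<pi> ^ q:] ^ k') k"
    using assms by (simp only: trunc_eq_def)
  moreover have "taylor_poly (h (j, k')) * ([:f ^ (e * j):] * reduced_taylor_prod j) * [:\<pi> ^ q:] ^ k' =
      smult (f ^ (e * j) * \<pi> ^ (q * k')) (taylor_poly (h (j, k')) * reduced_taylor_prod j)" for j k'
    by (simp add: poly_const_pow mult_ac flip: power_mult)
  ultimately show ?thesis by (simp only: coeff_sum split_def coeff_smult)
qed

lemma \<pi>_power_q: "\<pi> ^ q = monom 1 q - [:c0:]"
proof -
  have "\<pi> ^ q = (monom 1 1 - [:c0:]) ^ q" by (simp add: \<pi>_def monom_altdef)
  also have "\<dots> = monom 1 1 ^ q - [:c0:] ^ q" by (rule CARD_power_diff[OF _ q]) simp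
  finally show ?thesis
    by (simp add: monom_power poly_const_pow q finite_field_power_card_power_eq_same)
qed

lemma coeff_taylor_auxiliary_cong:
  assumes "[monom 1 q = monom 1 1] (mod P)" and f: "[f ^ e = [:\<alpha>:]] (mod P)" and "k < M"
  shows "[coeff (taylor_poly (auxiliary h)) k = reduced_coeff h k] (mod P)"
proof -
  have "[monom 1 q - [:c0:] = monom 1 1 - [:c0:]] (mod P)" by (intro cong_diff assms cong_refl)
  then have "[\<pi> ^ q = \<pi>] (mod P)" by (simp add: \<pi>_power_q) (simp add: \<pi>_def monom_altdef)
  then have "[(f ^ e) ^ j * (\<pi> ^ q) ^ k' = [:\<alpha>:] ^ j * \<pi> ^ k'] (mod P)" for j k'
    by (intro cong_mult cong_pow f)
  then show ?thesis
    unfolding coeff_taylor_auxiliary[OF \<open>k < M\<close>] reduced_coeff_def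
    by (intro cong_sum) (auto simp: split_def poly_const_pow power_mult simp flip: mult_smult_left mult.assoc
        intro!: cong_scalar_right)
qed

lemma reduced_coeff_in_polys_below:
  assumes "\<And>i. i \<in> index_set \<Longrightarrow> h i \<in> polys_below e"
  shows "reduced_coeff h k \<in> polys_below (K + card S * M + e)"
  unfolding reduced_coeff_def
proof (intro polys_below_sum, clarify)
  fix j k' assume jk: "(j, k') \<in> index_set"
  have "coeff (reduced_taylor_prod j * taylor_poly (h (j, k'))) k \<in> polys_below (card S * M + e)"
    unfolding reduced_taylor_prod_def
    by (intro coeffs_in_polys_below_mult coeffs_in_polys_below_prod coeff_reduced_taylor
        coeff_taylor_poly_in_polys_below assms jk finite)
  moreover have "\<pi> ^ k' \<in> polys_below (Suc K)"
    using jk linear_power_in_polys_below[of "- c0" k'] polys_below_mono[of "Suc k'" "Suc K"]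
    unfolding \<pi>_def index_set_def by auto
  ultimately have "\<pi> ^ k' * coeff (reduced_taylor_prod j * taylor_poly (h (j, k'))) k
      \<in> polys_below (K + (card S * M + e))"
    by (intro polys_below_mult)
  then show "smult (\<alpha> ^ j) (\<pi> ^ k' * coeff (taylor_poly (h (j, k')) * reduced_taylor_prod j) k)
      \<in> polys_below (K + card S * M + e)"
    by (auto simp: polys_below_def mult.commute add.assoc)
qed

lemma reduced_coeff_diff:
  "reduced_coeff (\<lambda>i. h i - h' i) k = reduced_coeff h k - reduced_coeff h' k"
proof -
  have "taylor_poly (h i - h' i) * b = taylor_poly (h i) * b - taylor_poly (h' i) * b" for i b
    by (simp add: taylor_poly_diff left_diff_distrib)
  then show ?thesis
    by (simp add: reduced_coeff_def sum_subtractf[symmetric] split_def right_diff_distrib smult_diff_right)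
qed

lemma ex_vanishing_family:
  "\<exists>h. (\<forall>i\<in>index_set. h i \<in> polys_below e) \<and> (\<exists>i\<in>index_set. h i \<noteq> 0) \<and> (\<forall>k<M. reduced_coeff h k = 0)"
proof -
  define families where "families = PiE index_set (\<lambda>_. polys_below e :: 'a poly set)"
  define conditions where "conditions = PiE {..<M} (\<lambda>_. polys_below (K + card S * M + e) :: 'a poly set)"
  define \<Phi> where "\<Phi> h = restrict (reduced_coeff h) {..<M}" for h
  have "card conditions = CARD('a) ^ (M * (K + card S * M + e))"
    by (simp add: conditions_def card_PiE card_polys_below power_mult[symmetric] mult_ac)
  also have "\<dots> < CARD('a) ^ (K * d * e)"
    using more_unknowns one_less_CARD_finite_field[where ?'a = 'a] by (rule power_strict_increasing)
  also have "\<dots> = card families"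
    by (simp add: families_def card_PiE index_set_def card_polys_below power_mult[symmetric] mult_ac)
  finally have "card conditions < card families" .
  moreover have "finite conditions" by (simp add: conditions_def finite_PiE)
  moreover have "\<Phi> ` families \<subseteq> conditions"
    unfolding \<Phi>_def families_def conditions_def
    by (auto intro!: restrict_PiE_iff[THEN iffD2] reduced_coeff_in_polys_below)
  ultimately have "\<not> inj_on \<Phi> families" by (meson card_inj_on_le leD)
  then obtain h h' where h: "h \<in> families" "h' \<in> families" "h \<noteq> h'" "\<Phi> h = \<Phi> h'" by (auto simp: inj_on_def)
  have "\<exists>i\<in>index_set. h i \<noteq> h' i" using h unfolding families_def by (meson PiE_ext)
  moreover have "reduced_coeff h k = reduced_coeff h' k" if "k < M" for k
    using fun_cong[OF h(4), of k] that by (simp add: \<Phi>_def)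
  ultimately show ?thesis
    using h by (intro exI[of _ "\<lambda>i. h i - h' i"])
      (auto simp: reduced_coeff_diff families_def PiE_iff intro!: polys_below_diff)
qed

text \<open>As \<open>\<pi>\<close> divides \<open>f\<close> exactly once, the terms of \<open>auxiliary h\<close> are divisible by powers of \<open>\<pi>\<close> whose
  exponents \<open>j * e + q * k\<close> differ by at least \<open>e\<close>, while \<open>\<pi> ^ e\<close> does not divide \<open>h (j, k)\<close>.\<close>

lemma auxiliary_nonzero:
  assumes below: "\<And>i. i \<in> index_set \<Longrightarrow> h i \<in> polys_below e" and nonzero: "\<exists>i\<in>index_set. h i \<noteq> 0"
  shows "auxiliary h \<noteq> 0"
proof -
  define N where "N = {i\<in>index_set. h i \<noteq> 0}"
  define f' where "f' = root_prod (S - {c0}) m"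
  have f: "f = \<pi> * f'"
    unfolding f_def f'_def root_prod_def using simple_root
    by (subst prod.remove[of _ c0]) (auto simp: \<pi>_def)
  have coprime: "coprime (\<pi> ^ e) (f' ^ E)" for E
  proof -
    have "coprime \<pi> f'"
    proof (rule prime_elem_imp_coprime)
      show "prime_elem \<pi>" unfolding \<pi>_def by (rule prime_elem_linear_field_poly) simp
      show "\<not> \<pi> dvd f'" by (auto simp: \<pi>_def f'_def root_prod_def dvd_iff_poly_eq_0 poly_prod)
    qed
    then show ?thesis by simp
  qed
  have "(\<Sum>i\<in>N. \<pi> ^ (fst i * e + q * snd i) * (h i * f' ^ (fst i * e))) \<noteq> 0"
  proof (rule sum_separated_powers_nonzero[where e = e])
    show "finite N" "N \<noteq> {}" using nonzero by (auto simp: N_def)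
    show "\<pi> \<noteq> 0" by (simp add: \<pi>_def)
    show "fst i * e + q * snd i + e \<le> fst i' * e + q * snd i'"
      if "i \<in> N" "i' \<in> N" "i \<noteq> i'" "fst i * e + q * snd i \<le> fst i' * e + q * snd i'" for i i'
      using that de q_pos
      by (intro base_weights_separated[of _ d]) (auto simp: N_def index_set_def prod_eq_iff)
    show "\<not> \<pi> ^ e dvd h i * f' ^ (fst i * e)" if "i \<in> N" for i
    proof
      assume "\<pi> ^ e dvd h i * f' ^ (fst i * e)"
      then have "\<pi> ^ e dvd h i" using coprime by (metis coprime_dvd_mult_left_iff)
      then have "degree (\<pi> ^ e) \<le> degree (h i)" using that by (intro dvd_imp_degree_le) (auto simp: N_def)
      then have "e \<le> degree (h i)" by (simp add: \<pi>_def degree_linear_power)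
      then show False using that below[of i] by (auto simp: N_def polys_below_iff_degree)
    qed
  qed
  moreover have "(\<Sum>i\<in>N. \<pi> ^ (fst i * e + q * snd i) * (h i * f' ^ (fst i * e))) =
      (\<Sum>(j, k)\<in>index_set. h (j, k) * f ^ (e * j) * \<pi> ^ (q * k))"
    by (rule sum.mono_neutral_cong_left)
       (auto simp: N_def f power_mult_distrib power_add mult_ac)
  ultimately show ?thesis by (simp add: auxiliary_def root_prod_nonzero)
qed

lemma degree_auxiliary_le:
  assumes below: "\<And>i. i \<in> index_set \<Longrightarrow> h i \<in> polys_below e"
  shows "degree (auxiliary h) \<le> card S * M + (e + q * (\<Sum>c\<in>S. m c) + q * K)"
proof -
  have "degree (\<Sum>(j, k)\<in>index_set. h (j, k) * f ^ (e * j) * \<pi> ^ (q * k)) \<le> e + q * (\<Sum>c\<in>S. m c) + q * K"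
  proof (intro degree_sum_le finite_index_set, clarify)
    fix j k assume jk: "(j, k) \<in> index_set"
    have "j * e \<le> d * e" using jk by (simp add: index_set_def)
    then have "e * j \<le> q" using de by (simp add: mult.commute)
    then have "degree (f ^ (e * j)) \<le> q * (\<Sum>c\<in>S. m c)"
      by (simp add: f_def root_prod_power degree_root_prod mult_le_mono1 flip: sum_distrib_left)
    moreover have "degree (\<pi> ^ (q * k)) \<le> q * K"
      using jk by (simp add: \<pi>_def degree_linear_power index_set_def)
    moreover have "degree (h (j, k)) \<le> e" using below[OF jk] by (auto simp: polys_below_iff_degree)
    moreover have "degree (h (j, k) * f ^ (e * j) * \<pi> ^ (q * k)) \<le>
        degree (h (j, k)) + degree (f ^ (e * j)) + degree (\<pi> ^ (q * k))"
      by (meson add_le_mono1 degree_mult_le le_trans)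
    ultimately show "degree (h (j, k) * f ^ (e * j) * \<pi> ^ (q * k)) \<le> e + q * (\<Sum>c\<in>S. m c) + q * K"
      by simp
  qed
  moreover have "degree (root_prod S (\<lambda>_. M)) = card S * M" by (simp add: degree_root_prod)
  ultimately show ?thesis
    unfolding auxiliary_def by (metis (no_types, lifting) add_left_mono degree_mult_le le_trans)
qed

theorem stepanov_degree_bound:
  assumes "finite A" and A: "A \<subseteq> prime_monics"
    and X: "\<And>P. P \<in> A \<Longrightarrow> [monom 1 q = monom 1 1] (mod P)"
    and f: "\<And>P. P \<in> A \<Longrightarrow> [f ^ e = [:\<alpha>:]] (mod P)"
  shows "M * (\<Sum>P\<in>A. degree P) \<le> card S * M + (e + q * (\<Sum>c\<in>S. m c) + q * K)"
proof -
  obtain h where below: "\<And>i. i \<in> index_set \<Longrightarrow> h i \<in> polys_below e"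
    and nonzero: "\<exists>i\<in>index_set. h i \<noteq> 0" and zero: "\<And>k. k < M \<Longrightarrow> reduced_coeff h k = 0"
    using ex_vanishing_family by metis
  have "[auxiliary h = 0] (mod P ^ M)" if P: "P \<in> A" for P
    unfolding cong_0_iff
  proof (rule taylor_vanishing_imp_power_dvd)
    show "prime_elem P" using A P prime_monics_prime_elem by blast
    moreover have "of_nat q = (0 :: 'a)"
      using n_pos CHAR_dvd_CARD[where ?'a = 'a] by (simp add: q of_nat_eq_0_iff_char_dvd dvd_power_iff_le)
    ultimately show "\<not> P dvd pderiv P" using X[OF P] by (intro not_dvd_pderiv_if_dvd_monom_diff)
    show "P dvd coeff (taylor_poly (auxiliary h)) k" if "k < M" for k
      using coeff_taylor_auxiliary_cong[OF X[OF P] f[OF P] that, of h] zero[OF that] by (simp add: cong_0_iff)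
  qed
  moreover have "coprime (P ^ M) (Q ^ M)" if "P \<in> A" "Q \<in> A" "P \<noteq> Q" for P Q
    using prime_monics_coprime[of P Q] A that by (simp add: subset_iff)
  ultimately have "[auxiliary h = 0] (mod (\<Prod>P\<in>A. P ^ M))" by (intro cong_cong_prod_coprime) auto
  then have "degree (\<Prod>P\<in>A. P ^ M) \<le> degree (auxiliary h)"
    using auxiliary_nonzero[OF below nonzero] by (simp add: cong_0_iff dvd_imp_degree_le)
  moreover have "degree (\<Prod>P\<in>A. P ^ M) = M * (\<Sum>P\<in>A. degree P)"
  proof -
    have "P \<noteq> 0" if "P \<in> A" for P using that A by (auto simp: prime_monics_def)
    then show ?thesis by (subst degree_prod_sum_eq) (simp_all add: degree_power_eq sum_distrib_left mult.commute)
  qed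
  ultimately show ?thesis using le_trans[OF _ degree_auxiliary_le[of h, OF below]] by simp
qed

end

section \<open>Conjugates and norms over a finite field\<close>

lemma power_fixed_points:
  fixes N :: nat
  assumes "N > 1"
  shows "finite {y :: 'a::idom. y ^ N = y}" "card {y :: 'a. y ^ N = y} \<le> N"
proof -
  define p :: "'a poly" where "p = monom 1 N - monom 1 1"
  have "coeff p N = 1" using assms by (simp add: p_def)
  then have p: "p \<noteq> 0" by auto
  have "{y. y ^ N = y} = {y. poly p y = 0}" by (simp add: p_def poly_monom)
  moreover have "degree p \<le> N"
    unfolding p_def using assms by (intro degree_diff_le) (auto simp: degree_monom_eq)
  ultimately show "finite {y :: 'a. y ^ N = y}" "card {y :: 'a. y ^ N = y} \<le> N"
    using poly_roots_finite[OF p] card_poly_roots_bound[OF p] by simp_all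
qed

lemma poly_to_ac_power_CARD:
  fixes R :: "'a::finite_field poly"
  shows "poly (map_poly to_ac R) \<zeta> ^ (CARD('a) ^ n) = poly (map_poly to_ac R) (\<zeta> ^ (CARD('a) ^ n))"
proof (induction R)
  case (pCons a R)
  have "to_ac a ^ (CARD('a) ^ n) = to_ac a"
    by (simp add: finite_field_power_card_power_eq_same flip: to_ac_power)
  moreover have "(to_ac a + \<zeta> * poly (map_poly to_ac R) \<zeta>) ^ (CARD('a) ^ n) =
      to_ac a ^ (CARD('a) ^ n) + (\<zeta> * poly (map_poly to_ac R) \<zeta>) ^ (CARD('a) ^ n)"
    by (rule CARD_power_add[where ?'a = 'a]) simp_all
  ultimately show ?case
    using pCons.hyps by (simp add: map_poly_pCons power_mult_distrib pCons.IH)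
qed (simp add: zero_power)

context
  fixes P :: "'a::{finite_field, field_gcd} poly" and \<xi> :: "'a alg_closure"
  assumes P: "P \<in> prime_monics" and root: "poly (map_poly to_ac P) \<xi> = 0"
begin

interpretation to_ac: map_poly_comm_ring_hom "to_ac :: 'a \<Rightarrow> _"
  by unfold_locales auto

definition conjugate :: "nat \<Rightarrow> 'a alg_closure" where
  "conjugate i = \<xi> ^ (CARD('a) ^ i)"

lemma dvd_if_root:
  assumes "poly (map_poly to_ac R) \<xi> = 0"
  shows "P dvd R"
proof (rule ccontr)
  assume "\<not> P dvd R"
  then have "coprime P R" using prime_monics_prime_elem[OF P] by (simp add: prime_elem_imp_coprime)
  then obtain a b where "a * P + b * R = 1"
    using bezout_coefficients_fst_snd[of P R] by auto
  then have "poly (map_poly to_ac (a * P + b * R)) \<xi> = 1" by simp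
  then show False using assms root by (simp add: hom_distribs)
qed

lemma conjugate_root: "poly (map_poly to_ac P) (conjugate i) = 0"
  using poly_to_ac_power_CARD[of P \<xi> i] root by (simp add: conjugate_def zero_power)

lemma degree_le_if_conjugate_eq:
  assumes l: "0 < l" "conjugate l = \<xi>"
  shows "degree P \<le> l"
proof -
  have N: "1 < CARD('a) ^ l" using one_less_CARD_finite_field l(1) by (rule one_less_power)
  have "inj_on (\<lambda>h. poly (map_poly to_ac h) \<xi>) (polys_below (degree P))"
  proof (rule inj_onI)
    fix g h assume gh: "g \<in> polys_below (degree P)" "h \<in> polys_below (degree P)"
      "poly (map_poly to_ac g) \<xi> = poly (map_poly to_ac h) \<xi>"
    then have "poly (map_poly to_ac (g - h)) \<xi> = 0" by (simp add: hom_distribs)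
    then have "P dvd g - h" by (rule dvd_if_root)
    moreover have "g - h \<in> polys_below (degree P)" using gh by (intro polys_below_diff)
    ultimately show "g = h"
      by (metis dvd_imp_degree_le eq_iff_diff_eq_0 leD polys_below_iff_degree)
  qed
  moreover have "(\<lambda>h. poly (map_poly to_ac h) \<xi>) ` polys_below (degree P) \<subseteq> {y. y ^ (CARD('a) ^ l) = y}"
    using l(2) by (auto simp: poly_to_ac_power_CARD conjugate_def)
  ultimately have "card (polys_below (degree P) :: 'a poly set) \<le> card {y :: 'a alg_closure. y ^ (CARD('a) ^ l) = y}"
    using power_fixed_points(1)[OF N] by (rule card_inj_on_le)
  also have "\<dots> \<le> CARD('a) ^ l" by (rule power_fixed_points(2)[OF N])
  finally show ?thesis
    by (simp only: card_polys_below power_increasing_iff[OF one_less_CARD_finite_field])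
qed

lemma conjugate_cancel:
  assumes "i < j" "conjugate i = conjugate j"
  shows "conjugate (j - i) = \<xi>"
proof -
  have "(conjugate (j - i) - \<xi>) ^ (CARD('a) ^ i) = conjugate (j - i) ^ (CARD('a) ^ i) - \<xi> ^ (CARD('a) ^ i)"
    by (rule CARD_power_diff[where ?'a = 'a]) simp_all
  also have "\<dots> = conjugate j - conjugate i"
    using assms(1) by (simp add: conjugate_def flip: power_mult power_add)
  finally show ?thesis using assms(2) by simp
qed

lemma inj_on_conjugate: "inj_on conjugate {..<degree P}"
proof (rule linorder_inj_onI)
  fix i j assume ij: "i < j" "i \<in> {..<degree P}" "j \<in> {..<degree P}"
  show "conjugate i \<noteq> conjugate j"
  proof
    assume "conjugate i = conjugate j"
    then have "degree P \<le> j - i" using conjugate_cancel[of i j] degree_le_if_conjugate_eq[of "j - i"] ij by simp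
    then show False using ij by simp
  qed
qed auto

lemma map_poly_to_ac_eq_prod_conjugates: "map_poly to_ac P = (\<Prod>i<degree P. [:- conjugate i, 1:])"
proof (rule poly_eqI_degree_lead_coeff)
  let ?Q = "\<Prod>i<degree P. [:- conjugate i, 1:]"
  have degree_Q: "degree ?Q = degree P" by (simp add: degree_prod_sum_eq)
  moreover have "lead_coeff ?Q = 1" by (simp only: lead_coeff_prod) simp
  ultimately show "coeff (map_poly to_ac P) (degree P) = coeff ?Q (degree P)"
    using P by (simp add: coeff_map_poly prime_monics_def)
  show "degree (map_poly to_ac P) \<le> degree P" "degree ?Q \<le> degree P"
    using degree_Q by (simp_all add: degree_map_poly)
  show "degree P \<le> card (conjugate ` {..<degree P})" by (simp add: card_image inj_on_conjugate)
  show "poly (map_poly to_ac P) z = poly ?Q z" if "z \<in> conjugate ` {..<degree P}" for z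
    using that by (auto simp: conjugate_root poly_prod)
qed

lemma conjugate_degree: "conjugate (degree P) = \<xi>"
proof -
  have "poly (map_poly to_ac P) (conjugate (degree P)) = 0" by (rule conjugate_root)
  then obtain i where i: "i < degree P" "conjugate (degree P) = conjugate i"
    by (subst (asm) map_poly_to_ac_eq_prod_conjugates) (auto simp: poly_prod)
  show ?thesis
  proof (cases "i = 0")
    case False
    then have "degree P \<le> degree P - i"
      using conjugate_cancel[of i "degree P"] i by (intro degree_le_if_conjugate_eq) auto
    then show ?thesis using False i by simp
  qed (use i in \<open>simp add: conjugate_def\<close>)
qed

lemma conjugate_add_mult_degree: "conjugate (i + k * degree P) = conjugate i"
proof (induction k)
  case (Suc k)
  have "conjugate (i + Suc k * degree P) = conjugate (degree P) ^ (CARD('a) ^ (i + k * degree P))"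
    by (simp add: conjugate_def power_add mult_ac flip: power_mult)
  also have "\<dots> = conjugate (i + k * degree P)"
    unfolding conjugate_degree by (simp add: conjugate_def)
  finally show ?case using Suc.IH by simp
qed simp

lemma prod_conjugates_diff:
  "(\<Prod>i<degree P. conjugate i - to_ac c) = (- 1) ^ degree P * to_ac (poly P c)"
proof -
  have "to_ac (poly P c) = poly (map_poly to_ac P) (to_ac c)" by simp
  also have "\<dots> = (\<Prod>i<degree P. to_ac c - conjugate i)"
    by (simp only: map_poly_to_ac_eq_prod_conjugates poly_prod) simp
  also have "\<dots> = (\<Prod>i<degree P. (- 1) * (conjugate i - to_ac c))" by simp
  also have "\<dots> = (- 1) ^ degree P * (\<Prod>i<degree P. conjugate i - to_ac c)"
    by (simp only: prod.distrib prod_constant card_lessThan)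
  finally show ?thesis by (simp flip: power_mult_distrib mult.assoc)
qed

lemma norm_linear:
  "(\<xi> - to_ac c) ^ (\<Sum>i<degree P * k. CARD('a) ^ i) = (- 1) ^ (degree P * k) * to_ac (poly P c) ^ k"
proof -
  have "(\<xi> - to_ac c) ^ (CARD('a) ^ i) = \<xi> ^ (CARD('a) ^ i) - to_ac c ^ (CARD('a) ^ i)" for i
    by (rule CARD_power_diff[where ?'a = 'a]) simp_all
  then have "(\<xi> - to_ac c) ^ (CARD('a) ^ i) = conjugate i - to_ac c" for i
    by (simp add: conjugate_def finite_field_power_card_power_eq_same flip: to_ac_power)
  then have "(\<xi> - to_ac c) ^ (\<Sum>i<degree P * k. CARD('a) ^ i) = (\<Prod>i<degree P * k. conjugate i - to_ac c)"
    by (simp add: power_sum)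
  also have "\<dots> = (\<Prod>m<k. \<Prod>i=m * degree P..<m * degree P + degree P. conjugate i - to_ac c)"
    by (simp add: prod.nat_group mult.commute)
  also have "\<dots> = (\<Prod>m<k. \<Prod>i<degree P. conjugate i - to_ac c)"
  proof (rule prod.cong[OF refl])
    fix m
    show "(\<Prod>i=m * degree P..<m * degree P + degree P. conjugate i - to_ac c) =
        (\<Prod>i<degree P. conjugate i - to_ac c)"
      using prod.shift_bounds_nat_ivl[of "\<lambda>i. conjugate i - to_ac c" 0 "m * degree P" "degree P"]
      by (simp add: conjugate_add_mult_degree add.commute lessThan_atLeast0)
  qed
  also have "\<dots> = ((- 1) ^ degree P * to_ac (poly P c)) ^ k" by (simp add: prod_conjugates_diff)
  finally show ?thesis by (simp add: power_mult_distrib power_mult)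
qed

lemma monom_CARD_power_cong: "[monom 1 (CARD('a) ^ (degree P * k)) = monom 1 1] (mod P)"
  using conjugate_add_mult_degree[of 0 k] mult.commute[of k]
  by (simp add: cong_iff_dvd_diff) (intro dvd_if_root, simp add: hom_distribs map_poly_monom poly_monom conjugate_def)

lemma linear_power_norm_cong:
  "[[:- c, 1:] ^ (\<Sum>i<degree P * k. CARD('a) ^ i) = [:(- 1) ^ (degree P * k) * poly P c ^ k:]] (mod P)"
proof -
  have "poly (map_poly to_ac [:- c, 1:]) \<xi> = \<xi> - to_ac c" by (simp add: map_poly_pCons)
  then show ?thesis
    unfolding cong_iff_dvd_diff by (intro dvd_if_root) (simp add: hom_distribs norm_linear)
qed

end

lemma prime_monics_ex_root:
  fixes P :: "'a::field_gcd poly"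
  assumes "P \<in> prime_monics"
  shows "\<exists>\<xi>. poly (map_poly to_ac P) \<xi> = 0"
  using alg_closed_imp_poly_has_root[of "map_poly to_ac P"] prime_monics_degree_pos[OF assms]
  by (simp add: degree_map_poly)

lemma prime_monics_monom_cong:
  fixes P :: "'a::{finite_field, field_gcd} poly"
  assumes "P \<in> prime_monics" "degree P dvd n"
  shows "[monom 1 (CARD('a) ^ n) = monom 1 1] (mod P)"
proof -
  obtain \<xi> where "poly (map_poly to_ac P) \<xi> = 0" using prime_monics_ex_root[OF assms(1)] by blast
  then show ?thesis using monom_CARD_power_cong[OF assms(1), of \<xi> "n div degree P"] assms(2) by simp
qed

lemma prime_monics_norm_cong:
  fixes P :: "'a::{finite_field, field_gcd} poly"
  assumes "P \<in> prime_monics" "degree P dvd n"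
  shows "[[:- c, 1:] ^ (\<Sum>i<n. CARD('a) ^ i) = [:(- 1) ^ n * poly P c ^ (n div degree P):]] (mod P)"
proof -
  obtain \<xi> where "poly (map_poly to_ac P) \<xi> = 0" using prime_monics_ex_root[OF assms(1)] by blast
  then show ?thesis using linear_power_norm_cong[OF assms(1), of \<xi> c "n div degree P"] assms(2) by simp
qed

section \<open>L-functions of completely multiplicative functions on polynomials\<close>

definition monics :: "nat \<Rightarrow> 'a::comm_ring_1 poly set" where
  "monics n = {g. lead_coeff g = 1 \<and> degree g = n}"

lemma monics_eq_image: "monics n = (\<lambda>h. monom 1 n + h) ` (polys_below n :: 'a::comm_ring_1 poly set)"
proof (intro equalityI subsetI)
  fix g :: "'a poly" assume g: "g \<in> monics n"
  have "g - monom 1 n \<in> polys_below n"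
    using g by (auto simp: polys_below_def monics_def coeff_eq_0)
  then show "g \<in> (\<lambda>h. monom 1 n + h) ` polys_below n" by (intro image_eqI[of _ _ "g - monom 1 n"]) auto
next
  fix g :: "'a poly" assume "g \<in> (\<lambda>h. monom 1 n + h) ` polys_below n"
  then obtain h where h: "g = monom 1 n + h" "h \<in> polys_below n" by auto
  have coeff_n: "coeff g n = 1" using h by (simp add: polys_below_def)
  have "degree g \<le> n" using h by (intro degree_le) (auto simp: polys_below_def)
  moreover have "n \<le> degree g" using coeff_n by (intro le_degree) auto
  ultimately show "g \<in> monics n" using coeff_n by (auto simp: monics_def)
qed

lemma finite_monics [simp]: "finite (monics n :: 'a::{finite, comm_ring_1} poly set)"
  by (simp add: monics_eq_image)

lemma card_monics: "card (monics n :: 'a::{finite, comm_ring_1} poly set) = CARD('a) ^ n"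
  unfolding monics_eq_image by (subst card_image) (auto simp: inj_on_def card_polys_below)

lemma monics_0: "monics 0 = {1 :: 'a::comm_ring_1 poly}"
  by (auto simp: monics_eq_image monom_0 one_pCons)

lemma monics_1: "monics 1 = range (\<lambda>x. [:x, 1 :: 'a::comm_ring_1:])"
proof (intro equalityI subsetI)
  fix g :: "'a poly" assume g: "g \<in> monics 1"
  then have "coeff g 1 = 1" "degree g = 1" by (auto simp: monics_def)
  then have "g = [:coeff g 0, 1:]" by (auto simp: poly_eq_iff coeff_pCons coeff_eq_0 split: nat.splits)
  then show "g \<in> range (\<lambda>x. [:x, 1:])" by blast
qed (auto simp: monics_def)

lemma monics_mult_iff:
  fixes f g :: "'a::idom poly"
  assumes f: "f \<in> monics m" and "m \<le> n"
  shows "f * g \<in> monics n \<longleftrightarrow> g \<in> monics (n - m)"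
proof (cases "g = 0")
  case False
  have "f \<noteq> 0" using f by (auto simp: monics_def)
  then have "degree (f * g) = m + degree g" using f False by (auto simp: monics_def degree_mult_eq)
  moreover have "lead_coeff (f * g) = lead_coeff g"
    using f by (simp only: lead_coeff_mult) (auto simp: monics_def)
  ultimately show ?thesis using \<open>m \<le> n\<close> by (auto simp: monics_def)
qed (auto simp: monics_def)

lemma monics_mult:
  fixes f g :: "'a::idom poly"
  shows "f \<in> monics m \<Longrightarrow> g \<in> monics n \<Longrightarrow> f * g \<in> monics (m + n)"
  by (simp add: monics_mult_iff)

lemma monics_power:
  fixes f :: "'a::idom poly"
  shows "f \<in> monics m \<Longrightarrow> f ^ k \<in> monics (k * m)"
  by (induction k) (auto simp: monics_0 intro: monics_mult)

lemma monics_add: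
  assumes "g \<in> monics n" "degree l < n"
  shows "g + l \<in> monics n"
  using assms by (auto simp: monics_def degree_add_eq_left coeff_eq_0)

lemma sum_monics_add:
  assumes "degree l < n"
  shows "(\<Sum>g\<in>monics n. u (g + l)) = (\<Sum>g\<in>monics n. u g)"
  by (rule sum.reindex_bij_witness[of _ "\<lambda>g. g - l" "\<lambda>g. g + l"])
     (use assms monics_add[of _ n "- l"] in \<open>auto intro: monics_add\<close>)

lemma sum_monics_multiples:
  fixes f :: "'a::idom poly"
  assumes f: "f \<in> monics m" and "m \<le> n"
  shows "(\<Sum>g | g \<in> monics n \<and> f dvd g. u g) = (\<Sum>g\<in>monics (n - m). u (f * g))"
proof (rule sum.reindex_cong)
  have "f \<noteq> 0" using f by (auto simp: monics_def)
  then show "inj_on (\<lambda>g. f * g) (monics (n - m))" by (auto simp: inj_on_def)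
  show "{g. g \<in> monics n \<and> f dvd g} = (\<lambda>g. f * g) ` monics (n - m)"
    using monics_mult_iff[OF assms] by (auto elim!: dvdE)
qed simp

lemma prime_monics_in_monics: "P \<in> prime_monics \<Longrightarrow> P \<in> monics (degree P)"
  by (simp add: prime_monics_def monics_def)

lemma finite_prime_monics_degree_dvd:
  assumes "n > 0"
  shows "finite {P :: 'a::{finite, field_gcd} poly. P \<in> prime_monics \<and> degree P dvd n}"
proof (rule finite_subset)
  show "{P :: 'a poly. P \<in> prime_monics \<and> degree P dvd n} \<subseteq> (\<Union>i\<le>n. monics i)"
    using assms prime_monics_in_monics by (auto dest: dvd_imp_le)
qed simp

lemma prime_factors_monic:
  fixes g :: "'a::field_gcd poly"
  assumes "g \<noteq> 0"
  shows "prime_factors g = {P \<in> prime_monics. P dvd g}"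
proof (intro equalityI subsetI)
  fix P assume "P \<in> prime_factors g"
  then have P: "prime P" "P dvd g" by (auto simp: prime_factors_dvd assms)
  then have "normalize P = P" "P \<noteq> 0" by auto
  then have "unit_factor P = 1" by (metis unit_factor_normalize)
  then have "unit_factor (lead_coeff P) = 1" by (simp add: unit_factor_poly_def one_pCons)
  moreover have "normalize (lead_coeff P) = 1"
    using \<open>P \<noteq> 0\<close> by (intro is_unit_normalize) (simp add: dvd_field_iff)
  ultimately have "lead_coeff P = 1" by (metis mult_1 unit_factor_mult_normalize)
  then show "P \<in> {P \<in> prime_monics. P dvd g}" using P by (auto simp: prime_monics_def)
next
  fix P assume "P \<in> {P \<in> prime_monics. P dvd g}"
  then show "P \<in> prime_factors g"
    by (auto simp: prime_monics_def prime_factors_dvd assms normalization_semidom_class.prime_def normalize_monic)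
qed

definition prime_power_pairs :: "nat \<Rightarrow> ('a::field_gcd poly \<times> nat) set" where
  "prime_power_pairs n = {(P, k). P \<in> prime_monics \<and> k > 0 \<and> k * degree P \<le> n}"

lemma finite_prime_power_pairs [simp]:
  "finite (prime_power_pairs n :: ('a::{finite, field_gcd} poly \<times> nat) set)"
proof (rule finite_subset)
  show "(prime_power_pairs n :: ('a poly \<times> nat) set) \<subseteq> (\<Union>i\<le>n. monics i) \<times> {..n}"
  proof clarify
    fix P :: "'a poly" and k assume "(P, k) \<in> prime_power_pairs n"
    then have P: "P \<in> prime_monics" "k > 0" "k * degree P \<le> n" by (auto simp: prime_power_pairs_def)
    then have "1 * degree P \<le> k * degree P" "k * 1 \<le> k * degree P"
      using prime_monics_degree_pos[of P] by (auto intro: mult_le_mono)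
    then have "degree P \<le> n" "k \<le> n" using P(3) by linarith+
    then show "P \<in> (\<Union>i\<le>n. monics i) \<and> k \<in> {..n}" using prime_monics_in_monics[OF P(1)] by auto
  qed
qed simp

lemma prime_power_divisors_eq_Sigma:
  fixes g :: "'a::field_gcd poly"
  assumes g: "g \<in> monics n"
  shows "{(P, k) \<in> prime_power_pairs n. P ^ k dvd g} = Sigma (prime_factors g) (\<lambda>P. {1..multiplicity P g})"
proof -
  have nonzero: "g \<noteq> 0" and degree_g: "degree g = n" using g by (auto simp: monics_def)
  have "(P, k) \<in> prime_power_pairs n \<and> P ^ k dvd g \<longleftrightarrow>
      P \<in> prime_monics \<and> P dvd g \<and> 1 \<le> k \<and> k \<le> multiplicity P g" for P k
  proof (intro iffI; elim conjE)
    assume "(P, k) \<in> prime_power_pairs n" "P ^ k dvd g"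
    then have P: "P \<in> prime_monics" "k > 0" "P ^ k dvd g" by (auto simp: prime_power_pairs_def)
    have "\<not> is_unit P" using prime_monics_prime_elem[OF P(1)] prime_elem_not_unit by blast
    then have "k \<le> multiplicity P g" using P nonzero by (intro multiplicity_geI) auto
    moreover have "P dvd g" using P by (metis dvd_power dvd_trans)
    ultimately show "P \<in> prime_monics \<and> P dvd g \<and> 1 \<le> k \<and> k \<le> multiplicity P g" using P by simp
  next
    assume P: "P \<in> prime_monics" and k: "1 \<le> k" "k \<le> multiplicity P g"
    then have dvd: "P ^ k dvd g" by (simp add: multiplicity_dvd')
    then have "degree (P ^ k) \<le> n" using nonzero degree_g dvd_imp_degree_le by blast
    then have "k * degree P \<le> n"
      using P by (subst (asm) degree_power_eq) (auto simp: prime_monics_def mult.commute)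
    then show "(P, k) \<in> prime_power_pairs n \<and> P ^ k dvd g"
      using P k dvd by (simp add: prime_power_pairs_def)
  qed
  then show ?thesis by (auto simp: prime_factors_monic[OF nonzero])
qed

lemma sum_degree_prime_power_divisors:
  fixes g :: "'a::field_gcd poly"
  assumes g: "g \<in> monics n"
  shows "(\<Sum>(P, k) | (P, k) \<in> prime_power_pairs n \<and> P ^ k dvd g. degree P) = n"
proof -
  have nonzero: "g \<noteq> 0" and monic: "lead_coeff g = 1" "degree g = n" using g by (auto simp: monics_def)
  have "(\<Sum>(P, k) | (P, k) \<in> prime_power_pairs n \<and> P ^ k dvd g. degree P) =
      (\<Sum>(P, k)\<in>Sigma (prime_factors g) (\<lambda>P. {1..multiplicity P g}). degree P)"
    using prime_power_divisors_eq_Sigma[OF g] by (intro sum.cong) auto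
  also have "\<dots> = (\<Sum>P\<in>prime_factors g. multiplicity P g * degree P)"
    by (subst sum.Sigma[symmetric]) auto
  also have "\<dots> = (\<Sum>P\<in>prime_factors g. degree (P ^ multiplicity P g))"
    by (intro sum.cong refl) (subst degree_power_eq, auto)
  also have "\<dots> = degree (\<Prod>P\<in>prime_factors g. P ^ multiplicity P g)"
    by (subst degree_prod_sum_eq) auto
  also have "\<dots> = n"
    using prod_prime_factors[OF nonzero] monic by (simp add: normalize_monic)
  finally show ?thesis .
qed

lemma sum_prime_power_pairs:
  fixes u :: "'a::{finite, field_gcd} poly \<Rightarrow> nat \<Rightarrow> 'b::comm_monoid_add"
  shows "(\<Sum>(P, k)\<in>prime_power_pairs n. u P k) =
    (\<Sum>i=1..n. \<Sum>P | P \<in> prime_monics \<and> degree P dvd i. u P (i div degree P))"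
proof -
  have "(\<Sum>(P, k)\<in>prime_power_pairs n. u P k) =
      (\<Sum>i=1..n. \<Sum>(P, k)\<in>{x \<in> prime_power_pairs n. snd x * degree (fst x) = i}. u P k)"
  proof (rule sum.group[symmetric])
    show "(\<lambda>x. snd x * degree (fst x)) ` (prime_power_pairs n :: ('a poly \<times> nat) set) \<subseteq> {1..n}"
      using prime_monics_degree_pos by (force simp: prime_power_pairs_def)
  qed auto
  also have "\<dots> = (\<Sum>i=1..n. \<Sum>P | P \<in> prime_monics \<and> degree P dvd i. u P (i div degree P))"
  proof (rule sum.cong[OF refl])
    fix i assume i: "i \<in> {1..n}"
    show "(\<Sum>(P, k)\<in>{x \<in> prime_power_pairs n. snd x * degree (fst x) = i}. u P k) =
        (\<Sum>P | P \<in> prime_monics \<and> degree P dvd i. u P (i div degree P))"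
    proof (rule sum.reindex_bij_witness[of _ "\<lambda>P. (P, i div degree P)" fst])
      fix P :: "'a poly" assume P: "P \<in> {P. P \<in> prime_monics \<and> degree P dvd i}"
      then have "i div degree P * degree P = i" "i div degree P > 0"
        using i by (auto simp: div_greater_zero_iff prime_monics_degree_pos dvd_imp_le)
      then show "(P, i div degree P) \<in> {x \<in> prime_power_pairs n. snd x * degree (fst x) = i}"
        using P i by (simp add: prime_power_pairs_def)
    qed (auto simp: prime_power_pairs_def prime_monics_degree_pos)
  qed
  finally show ?thesis .
qed

text \<open>Coefficients of the L-function of a completely multiplicative function on monic polynomials, and of its
  logarithmic derivative.\<close>

definition coeff_sum_L :: "('a::{finite, field_gcd} poly \<Rightarrow> complex) \<Rightarrow> nat \<Rightarrow> complex" where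
  "coeff_sum_L \<psi> n = (\<Sum>g\<in>monics n. \<psi> g)"

definition power_sum_L :: "('a::{finite, field_gcd} poly \<Rightarrow> complex) \<Rightarrow> nat \<Rightarrow> complex" where
  "power_sum_L \<psi> n = (\<Sum>P | P \<in> prime_monics \<and> degree P dvd n. of_nat (degree P) * \<psi> P ^ (n div degree P))"

theorem newton_identity_L:
  fixes \<psi> :: "'a::{finite, field_gcd} poly \<Rightarrow> complex"
  assumes mult: "\<And>f g. \<psi> (f * g) = \<psi> f * \<psi> g" and one: "\<psi> 1 = 1"
  shows "of_nat n * coeff_sum_L \<psi> n = (\<Sum>i=1..n. power_sum_L \<psi> i * coeff_sum_L \<psi> (n - i))"
proof -
  have \<psi>_power: "\<psi> (P ^ k) = \<psi> P ^ k" for P k by (induction k) (simp_all add: mult one)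
  have multiples: "(\<Sum>g | g \<in> monics n \<and> P ^ k dvd g. \<psi> g) = \<psi> P ^ k * coeff_sum_L \<psi> (n - k * degree P)"
    if "(P, k) \<in> prime_power_pairs n" for P k
  proof -
    have "P ^ k \<in> monics (k * degree P)" "k * degree P \<le> n"
      using that by (auto simp: prime_power_pairs_def intro: monics_power prime_monics_in_monics)
    then show ?thesis
      by (simp add: sum_monics_multiples mult \<psi>_power coeff_sum_L_def sum_distrib_left)
  qed
  have "of_nat n * coeff_sum_L \<psi> n = (\<Sum>g\<in>monics n. of_nat n * \<psi> g)"
    by (simp add: coeff_sum_L_def sum_distrib_left)
  also have "\<dots> = (\<Sum>g\<in>monics n. \<Sum>(P, k) | (P, k) \<in> prime_power_pairs n \<and> P ^ k dvd g. of_nat (degree P) * \<psi> g)"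
  proof (rule sum.cong[OF refl])
    fix g :: "'a poly" assume g: "g \<in> monics n"
    have "of_nat n * \<psi> g =
        of_nat (\<Sum>(P, k) | (P, k) \<in> prime_power_pairs n \<and> P ^ k dvd g. degree P) * \<psi> g"
      by (simp only: sum_degree_prime_power_divisors[OF g])
    then show "of_nat n * \<psi> g =
        (\<Sum>(P, k) | (P, k) \<in> prime_power_pairs n \<and> P ^ k dvd g. of_nat (degree P) * \<psi> g)"
      by (simp add: sum_distrib_right split_def)
  qed
  also have "\<dots> = (\<Sum>(P, k)\<in>prime_power_pairs n. \<Sum>g | g \<in> monics n \<and> P ^ k dvd g. of_nat (degree P) * \<psi> g)"
    using sum.swap_restrict[OF finite_monics finite_prime_power_pairs,
        where g = "\<lambda>g x. of_nat (degree (fst x)) * \<psi> g" and R = "\<lambda>g x. fst x ^ snd x dvd g"]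
    by (simp add: split_def conj_commute)
  also have "\<dots> = (\<Sum>(P, k)\<in>prime_power_pairs n.
      of_nat (degree P) * \<psi> P ^ k * coeff_sum_L \<psi> (n - k * degree P))"
    using multiples by (intro sum.cong refl) (auto simp flip: sum_distrib_left)
  also have "\<dots> = (\<Sum>i=1..n. \<Sum>P | P \<in> prime_monics \<and> degree P dvd i.
      of_nat (degree P) * \<psi> P ^ (i div degree P) * coeff_sum_L \<psi> (n - i div degree P * degree P))"
    by (rule sum_prime_power_pairs)
  also have "\<dots> = (\<Sum>i=1..n. power_sum_L \<psi> i * coeff_sum_L \<psi> (n - i))"
    unfolding power_sum_L_def sum_distrib_right by (intro sum.cong refl) auto
  finally show ?thesis .
qed

lemma sum_degree_prime_monics:
  assumes "n > 0"
  shows "(\<Sum>P | (P :: 'a::{finite, field_gcd} poly) \<in> prime_monics \<and> degree P dvd n. degree P) = CARD('a) ^ n"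
proof -
  define q where "q = CARD('a)"
  define p where "p i = power_sum_L (\<lambda>_ :: 'a poly. 1) i" for i
  have "p n = of_nat (q ^ n)"
    using assms
  proof (induction n rule: less_induct)
    case (less n)
    have "of_nat n * (of_nat (q ^ n) :: complex) = (\<Sum>i=1..n. p i * of_nat (q ^ (n - i)))"
      using newton_identity_L[of "\<lambda>_ :: 'a poly. 1" n] by (simp add: p_def q_def coeff_sum_L_def card_monics)
    also have "\<dots> = p n + (\<Sum>i\<in>{1..n} - {n}. p i * of_nat (q ^ (n - i)))"
      using less.prems by (subst sum.remove[of _ n]) auto
    also have "(\<Sum>i\<in>{1..n} - {n}. p i * of_nat (q ^ (n - i))) = (\<Sum>i\<in>{1..n} - {n}. (of_nat (q ^ n) :: complex))"
      using less.IH by (intro sum.cong refl) (auto simp flip: power_add)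
    also have "\<dots> = of_nat (n - 1) * of_nat (q ^ n)" using less.prems by simp
    finally show ?case using less.prems by (simp add: of_nat_diff algebra_simps)
  qed
  moreover have "p n = of_nat (\<Sum>P | (P :: 'a poly) \<in> prime_monics \<and> degree P dvd n. degree P)"
    by (simp add: p_def power_sum_L_def)
  ultimately show ?thesis unfolding q_def by (metis of_nat_eq_iff)
qed

section \<open>Power sums and zeros\<close>

lemma no_zero_if_logarithmic_derivative_continuous:
  fixes L :: "complex poly"
  assumes L: "L \<noteq> 0" and G: "isCont G z"
    and deriv: "\<forall>\<^sub>F t in at z. poly (pderiv L) t = poly L t * G t"
  shows "poly L z \<noteq> 0"
proof
  assume zero: "poly L z = 0"
  define l where "l = [:- z, 1:]"
  have l: "poly l t = t - z" "pderiv l = 1" for t by (simp_all add: l_def pderiv_pCons)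
  obtain Q where Q: "L = l ^ order z L * Q" "\<not> l dvd Q"
    unfolding l_def using order_decomp[OF L] by blast
  moreover have "order z L \<noteq> 0" using zero L order_root by blast
  ultimately obtain k where L_eq: "L = l ^ Suc k * Q" by (metis not0_implies_Suc)
  have pderiv_L: "pderiv L = l ^ k * (of_nat (Suc k) * Q + l * pderiv Q)"
    unfolding L_eq pderiv_mult pderiv_power_Suc l(2) by (simp add: of_nat_poly algebra_simps)
  let ?g = "\<lambda>t. (t - z) * (poly Q t * G t) - (of_nat (Suc k) * poly Q t + (t - z) * poly (pderiv Q) t)"
  have "\<forall>\<^sub>F t in at z. ?g t = 0"
    using deriv eventually_neq_at_within[of z z UNIV]
  proof eventually_elim
    case (elim t)
    have "(t - z) ^ k * (of_nat (Suc k) * poly Q t + (t - z) * poly (pderiv Q) t) =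
        (t - z) ^ k * ((t - z) * (poly Q t * G t))"
      using elim(1) unfolding pderiv_L by (simp add: L_eq l mult_ac)
    then show ?case using elim(2) by simp
  qed
  then have "(?g \<longlongrightarrow> 0) (at z)" by (rule tendsto_eventually)
  moreover have "isCont ?g z" by (intro continuous_intros G)
  then have "(?g \<longlongrightarrow> ?g z) (at z)" by (simp only: isCont_def)
  ultimately have "?g z = 0" using tendsto_unique[OF trivial_limit_at] by blast
  moreover have "?g z = - (of_nat (Suc k) * poly Q z)" by simp
  ultimately have "poly Q z = 0" by (simp only: neg_equal_0_iff_equal mult_eq_0_iff of_nat_neq_0) simp
  then show False using Q(2) by (simp add: l_def poly_eq_0_iff_dvd)
qed

lemma coeff_1_le_of_roots_ge:
  fixes p :: "complex poly"
  assumes "\<rho> > 0" "\<And>z. poly p z = 0 \<Longrightarrow> \<rho> \<le> cmod z"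
  shows "cmod (coeff p 1) \<le> real (degree p) / \<rho> * cmod (coeff p 0)"
  using assms(2)
proof (induction "degree p" arbitrary: p)
  case 0
  then show ?case by (simp add: coeff_eq_0)
next
  case (Suc n)
  have "\<not> constant (poly p)" using Suc.hyps(2) by (simp add: constant_degree)
  then obtain z where z: "poly p z = 0" using fundamental_theorem_of_algebra by blast
  then obtain q where q: "p = [:- z, 1:] * q" by (auto simp: poly_eq_0_iff_dvd elim: dvdE)
  have "q \<noteq> 0" using q Suc.hyps(2) by auto
  then have degree_p: "degree p = Suc (degree q)" unfolding q by (subst degree_mult_eq) auto
  have "\<rho> \<le> cmod w" if "poly q w = 0" for w using Suc.prems[of w] that q by simp
  then have IH: "cmod (coeff q 1) \<le> real (degree q) / \<rho> * cmod (coeff q 0)"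
    using Suc.hyps degree_p by auto
  have coeffs: "coeff p 0 = - z * coeff q 0" "coeff p 1 = - z * coeff q 1 + coeff q 0"
    by (simp_all add: q coeff_pCons)
  have "cmod (coeff p 1) \<le> cmod z * cmod (coeff q 1) + cmod (coeff q 0)"
    unfolding coeffs by (metis norm_minus_cancel norm_mult norm_triangle_ineq)
  also have "\<dots> \<le> cmod z * (real (degree q) / \<rho> * cmod (coeff q 0)) + (cmod z / \<rho>) * cmod (coeff q 0)"
  proof (intro add_mono mult_left_mono IH)
    have "\<rho> \<le> cmod z" using Suc.prems z by blast
    then show "cmod (coeff q 0) \<le> (cmod z / \<rho>) * cmod (coeff q 0)"
      using assms(1) by (intro mult_le_cancel_right1[THEN iffD2]) (auto simp: divide_simps)
  qed auto
  also have "\<dots> = real (degree p) / \<rho> * cmod (coeff p 0)"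
    unfolding degree_p coeffs using assms(1) by (simp add: norm_mult add_divide_distrib algebra_simps)
  finally show ?case .
qed

text \<open>Newton's identities say that \<open>L' = L * G\<close> for the polynomial \<open>L\<close> with coefficients \<open>c\<close> and the power series \<open>G\<close>
  with coefficients \<open>s\<close>.\<close>

lemma newton_imp_pderiv_eq:
  fixes c s :: "nat \<Rightarrow> complex"
  assumes c: "\<And>n. n \<ge> m \<Longrightarrow> c n = 0"
    and newton: "\<And>n. of_nat n * c n = (\<Sum>i=1..n. s i * c (n - i))"
    and summable: "summable (\<lambda>n. norm (s (Suc n) * t ^ n))"
  shows "poly (pderiv (\<Sum>i<m. monom (c i) i)) t = poly (\<Sum>i<m. monom (c i) i) t * (\<Sum>n. s (Suc n) * t ^ n)"
proof -
  let ?L = "\<Sum>i<m. monom (c i) i"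
  have coeff_L: "coeff ?L i = c i" for i
    using c[of i] by (auto simp: coeff_sum if_distrib cong: if_cong)
  have newton': "(\<Sum>i\<le>n. (c i * t ^ i) * (s (Suc (n - i)) * t ^ (n - i))) = of_nat (Suc n) * c (Suc n) * t ^ n" for n
  proof -
    have "(\<Sum>i\<le>n. (c i * t ^ i) * (s (Suc (n - i)) * t ^ (n - i))) = (\<Sum>i\<le>n. c i * s (Suc n - i)) * t ^ n"
      unfolding sum_distrib_right
      by (intro sum.cong refl) (simp add: Suc_diff_le mult_ac flip: power_add)
    also have "(\<Sum>i\<le>n. c i * s (Suc n - i)) = (\<Sum>i=1..Suc n. s i * c (Suc n - i))"
      by (rule sum.reindex_bij_witness[of _ "\<lambda>i. Suc n - i" "\<lambda>i. Suc n - i"]) auto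
    finally show ?thesis using newton[of "Suc n"] by simp
  qed
  have "summable (\<lambda>n. norm (c n * t ^ n))"
    by (rule summable_finite[of "{..<m}"]) (auto simp: c)
  then have "(\<lambda>n. of_nat (Suc n) * c (Suc n) * t ^ n) sums ((\<Sum>n. c n * t ^ n) * (\<Sum>n. s (Suc n) * t ^ n))"
    unfolding newton'[symmetric] using summable by (rule Cauchy_product_sums)
  also have "(\<Sum>n. c n * t ^ n) = poly ?L t"
    by (subst suminf_finite[of "{..<m}"]) (auto simp: c poly_sum poly_monom)
  finally have product: "(\<lambda>n. of_nat (Suc n) * c (Suc n) * t ^ n) sums (poly ?L t * (\<Sum>n. s (Suc n) * t ^ n))" .
  have finite_sum: "(\<lambda>n. of_nat (Suc n) * c (Suc n) * t ^ n) sums (\<Sum>n<m. of_nat (Suc n) * c (Suc n) * t ^ n)"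
    by (rule sums_finite) (auto simp: c)
  have "pderiv ?L = (\<Sum>n<m. monom (of_nat (Suc n) * c (Suc n)) n)"
    by (rule poly_eqI) (auto simp: coeff_sum coeff_pderiv coeff_L c if_distrib cong: if_cong)
  then have "poly (pderiv ?L) t = (\<Sum>n<m. of_nat (Suc n) * c (Suc n) * t ^ n)"
    by (simp add: poly_sum poly_monom)
  then show ?thesis using sums_unique2[OF finite_sum product] by (simp only:)
qed

theorem newton_power_sum_bound:
  fixes c s :: "nat \<Rightarrow> complex"
  assumes c_0: "c 0 = 1" and c: "\<And>n. n \<ge> m \<Longrightarrow> c n = 0"
    and newton: "\<And>n. of_nat n * c n = (\<Sum>i=1..n. s i * c (n - i))"
    and s: "\<And>n. n > 0 \<Longrightarrow> cmod (s n) \<le> B * r ^ n" and r: "r > 0"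
  shows "cmod (c 1) \<le> real (m - 1) * r"
proof -
  define L where "L = (\<Sum>i<m. monom (c i) i)"
  define G where "G t = (\<Sum>n. s (Suc n) * t ^ n)" for t
  have coeff_L: "coeff L i = c i" for i
    using c[of i] by (auto simp: L_def coeff_sum if_distrib cong: if_cong)
  have summable: "summable (\<lambda>n. norm (s (Suc n) * t ^ n))" if t: "cmod t < 1 / r" for t
  proof (rule summable_comparison_test')
    have "cmod t * r < 1" using t r by (simp add: field_simps)
    then show "summable (\<lambda>n. B * r * (cmod t * r) ^ n)"
      using r by (intro summable_mult summable_geometric) auto
    show "norm (norm (s (Suc n) * t ^ n)) \<le> B * r * (cmod t * r) ^ n" for n
      using mult_right_mono[OF s[of "Suc n"], of "cmod t ^ n"]
      by (simp add: norm_mult norm_power power_mult_distrib mult_ac)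
  qed
  have "poly L z \<noteq> 0" if z: "cmod z < 1 / r" for z
  proof (rule no_zero_if_logarithmic_derivative_continuous)
    have "coeff L 0 = 1" by (simp add: coeff_L c_0)
    then show "L \<noteq> 0" by auto
    obtain K where K: "cmod z < K" "K < 1 / r" using z dense by blast
    moreover have "cmod (of_real K) = K" using K norm_ge_zero[of z] by (simp del: norm_ge_zero)
    ultimately show "isCont G z"
      unfolding G_def by (intro isCont_powser[of _ "of_real K"] summable_norm_cancel[OF summable]) simp_all
    have "\<forall>\<^sub>F t in at z. t \<in> ball 0 (1 / r)"
      using z by (intro eventually_at_in_open') auto
    then show "\<forall>\<^sub>F t in at z. poly (pderiv L) t = poly L t * G t"
      by eventually_elim (simp add: L_def G_def newton_imp_pderiv_eq[OF c newton summable])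
  qed
  then have "cmod (coeff L 1) \<le> real (degree L) / (1 / r) * cmod (coeff L 0)"
    using r by (intro coeff_1_le_of_roots_ge) (auto simp: not_less[symmetric])
  then have "cmod (c 1) \<le> real (degree L) * r" by (simp add: coeff_L c_0)
  moreover have "degree L \<le> m - 1" by (rule degree_le) (auto simp: coeff_L intro: c)
  ultimately show ?thesis using r by (meson less_imp_le mult_right_mono of_nat_le_iff order_trans)
qed

section \<open>Weil's bound for multiplicative characters\<close>

locale multiplicative_character =
  fixes chi :: "'a::{finite_field, field_gcd} \<Rightarrow> complex"
  assumes mult: "chi (x * y) = chi x * chi y" and one: "chi 1 = 1" and zero: "chi 0 = 0"
    and nontrivial: "\<exists>x. x \<noteq> 0 \<and> chi x \<noteq> 1"
begin

definition chi_kernel :: "'a set" where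
  "chi_kernel = {x. chi x = 1}"

definition chi_values :: "complex set" where
  "chi_values = chi ` (- {0})"

lemma finite_chi_values [simp]: "finite chi_values"
  by (simp add: chi_values_def)

lemma inverse_mult: "x \<noteq> 0 \<Longrightarrow> chi (inverse x) * chi x = 1"
  by (simp add: one flip: mult)

lemma eq_0_iff: "chi x = 0 \<longleftrightarrow> x = 0"
  using inverse_mult[of x] zero by (cases "x = 0") auto

lemma power: "chi (x ^ k) = chi x ^ k"
  by (induction k) (simp_all add: mult one)

lemma prod: "chi (\<Prod>i\<in>A. f i) = (\<Prod>i\<in>A. chi (f i))"
  by (induction A rule: infinite_finite_induct) (simp_all add: mult one)

lemma in_values_iff: "a \<in> chi_values \<longleftrightarrow> a \<noteq> 0 \<and> a \<in> range chi"
  using eq_0_iff zero by (auto simp: chi_values_def)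

lemma card_values_pos: "card chi_values > 0"
  using nontrivial by (auto simp: card_gt_0_iff chi_values_def)

lemma card_fibre:
  assumes "a \<in> chi_values"
  shows "card {x. chi x = a} = card chi_kernel"
proof -
  obtain y where y: "y \<noteq> 0" "a = chi y" using assms by (auto simp: chi_values_def)
  have "bij_betw (\<lambda>x. y * x) chi_kernel {x. chi x = a}"
  proof (rule bij_betw_byWitness[where f' = "\<lambda>x. inverse y * x"])
    show "(\<lambda>x. inverse y * x) ` {x. chi x = a} \<subseteq> chi_kernel" using y inverse_mult by (auto simp: chi_kernel_def mult)
  qed (use y in \<open>auto simp: chi_kernel_def mult\<close>)
  then show ?thesis by (simp add: bij_betw_same_card)
qed

lemma sum_over_values:
  fixes u :: "complex \<Rightarrow> 'b::comm_semiring_1"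
  shows "(\<Sum>x\<in>- {0}. u (chi x)) = of_nat (card chi_kernel) * (\<Sum>a\<in>chi_values. u a)"
proof -
  have "{x \<in> - {0}. chi x = a} = {x. chi x = a}" if "a \<in> chi_values" for a
    using that zero in_values_iff[of a] by blast
  then have "(\<Sum>x | x \<in> - {0} \<and> chi x = a. u (chi x)) = of_nat (card chi_kernel) * u a" if "a \<in> chi_values" for a
    using that by (simp add: card_fibre)
  then show ?thesis
    using sum.group[of "- {0 :: 'a}" chi_values chi "\<lambda>x. u (chi x)"] by (simp add: chi_values_def sum_distrib_left)
qed

lemma card_values_mult_kernel: "card chi_values * card chi_kernel = CARD('a) - 1"
  using sum_over_values[of "\<lambda>_. 1 :: nat"] by (simp add: Compl_eq_Diff_UNIV card_Diff_singleton mult.commute)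

lemma norm_value:
  assumes "x \<noteq> 0"
  shows "cmod (chi x) = 1"
proof -
  let ?n = "CARD('a) - 1"
  have n: "?n > 0" using one_less_CARD_finite_field[where ?'a = 'a] by simp
  have "x ^ ?n * x = x"
    using finite_field_power_card_eq_same[of x] by (simp flip: power_Suc2)
  then have "x ^ ?n = 1" using assms by simp
  then have "cmod (chi x) ^ ?n = 1 ^ ?n" using power[of x ?n] by (simp add: one flip: norm_power)
  then show ?thesis using n by (intro power_eq_imp_eq_base[of "cmod (chi x)" _ 1]) auto
qed

lemma sum_eq_0: "(\<Sum>x\<in>UNIV. chi x) = 0"
proof -
  obtain y where y: "y \<noteq> 0" "chi y \<noteq> 1" using nontrivial by auto
  have "(\<Sum>x\<in>UNIV. chi x) = (\<Sum>x\<in>UNIV. chi (y * x))"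
    by (rule sum.reindex_bij_witness[of _ "\<lambda>x. y * x" "\<lambda>x. x / y"]) (use y in auto)
  also have "\<dots> = chi y * (\<Sum>x\<in>UNIV. chi x)" by (simp add: mult sum_distrib_left)
  finally have "(1 - chi y) * (\<Sum>x\<in>UNIV. chi x) = 0" by (simp add: algebra_simps)
  then show ?thesis using y by simp
qed

lemma sum_affine_eq_0:
  assumes "b \<noteq> 0"
  shows "(\<Sum>y\<in>UNIV. chi (a + y * b)) = 0"
proof -
  have "(\<Sum>y\<in>UNIV. chi (a + y * b)) = (\<Sum>y\<in>UNIV. chi y)"
    by (rule sum.reindex_bij_witness[of _ "\<lambda>z. (z - a) / b" "\<lambda>y. a + y * b"]) (use assms in auto)
  then show ?thesis by (simp add: sum_eq_0)
qed

lemma sum_values_eq_0: "(\<Sum>a\<in>chi_values. a) = 0"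
proof -
  have "(\<Sum>x\<in>- {0}. chi x) = 0"
    using sum_eq_0 by (simp add: Compl_eq_Diff_UNIV sum_diff1 zero)
  moreover have "chi_kernel \<noteq> {}" using one by (auto simp: chi_kernel_def)
  ultimately show ?thesis using sum_over_values[of "\<lambda>a. a"] by simp
qed

lemma power_card_kernel:
  assumes "x \<in> chi_kernel"
  shows "x ^ card chi_kernel = 1"
proof -
  have x: "x \<noteq> 0" using assms zero by (auto simp: chi_kernel_def)
  have "(\<Prod>y\<in>chi_kernel. y) = (\<Prod>y\<in>chi_kernel. x * y)"
  proof (rule prod.reindex_bij_witness[of _ "\<lambda>y. x * y" "\<lambda>y. inverse x * y"])
    fix y assume "y \<in> chi_kernel"
    then show "inverse x * y \<in> chi_kernel" "x * y \<in> chi_kernel"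
      using assms inverse_mult[OF x] by (auto simp: chi_kernel_def mult)
  qed (use x in auto)
  also have "\<dots> = x ^ card chi_kernel * (\<Prod>y\<in>chi_kernel. y)" by (simp add: prod.distrib)
  finally have "(\<Prod>y\<in>chi_kernel. y) = x ^ card chi_kernel * (\<Prod>y\<in>chi_kernel. y)" .
  moreover have "(\<Prod>y\<in>chi_kernel. y) \<noteq> 0" using zero by (auto simp: chi_kernel_def)
  ultimately show ?thesis by simp
qed

lemma power_card_kernel_cong:
  assumes "chi x = chi y" "y \<noteq> 0"
  shows "x ^ card chi_kernel = y ^ card chi_kernel"
proof -
  have "x / y \<in> chi_kernel"
    using assms inverse_mult[of y] by (simp add: chi_kernel_def divide_inverse mult mult.commute)
  then have "(x / y) ^ card chi_kernel = 1" by (rule power_card_kernel)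
  then show ?thesis using assms by (simp add: power_divide)
qed

end

lemma power_minus_1_eq_mult_sum_nat:
  fixes a :: nat
  assumes "a > 0"
  shows "a ^ n - 1 = (a - 1) * (\<Sum>i<n. a ^ i)"
proof -
  obtain b where a: "a = Suc b" using assms by (cases a) auto
  have "1 + b * (\<Sum>i<n. Suc b ^ i) = Suc b ^ n" by (induction n) (simp_all add: algebra_simps)
  then have "Suc b ^ n - 1 = b * (\<Sum>i<n. Suc b ^ i)" by linarith
  then show ?thesis by (simp add: a)
qed

lemma stepanov_parameters:
  fixes d m s q e k :: nat
  assumes d: "d \<ge> 1" and s: "s \<ge> 4 * d" "s\<^sup>2 \<le> q" and de: "d * e = q - 1" and k: "k = 2 * d * (m * d + 2)"
  shows "d * s * ((s + k) + m * (d * s) + e) < (s + k) * d * e"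
proof -
  have "s * 4 * d \<le> s * s" using s(1) by (simp add: mult.commute)
  then have ds: "4 * (d * s) \<le> s\<^sup>2" by (simp add: power2_eq_square mult_ac)
  have "4 * 4 \<le> s * s" using d s(1) by (intro mult_le_mono) auto
  then have sq_ge_16: "16 \<le> s\<^sup>2" by (simp add: power2_eq_square)
  have "0 < s" using d s(1) by linarith
  then have "0 < d * s\<^sup>2" using d by simp
  moreover have "k * s\<^sup>2 = 2 * (d * s\<^sup>2 * (1 + m * d)) + 2 * (d * s\<^sup>2)"
    by (simp add: k algebra_simps)
  moreover have "4 * (d * s * k) \<le> k * s\<^sup>2"
    using mult_le_mono2[OF ds, of k] by (simp add: mult_ac)
  moreover have "16 * k \<le> k * s\<^sup>2" using mult_le_mono2[OF sq_ge_16, of k] by simp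
  ultimately have "d * s\<^sup>2 * (1 + m * d) + d * s * k + k < k * s\<^sup>2" by linarith
  also have "\<dots> \<le> k * q" using s(2) by simp
  also have "k * q = k * (d * e) + k"
  proof -
    have "q = d * e + 1" using de s(2) sq_ge_16 by simp
    then show ?thesis by (simp add: algebra_simps)
  qed
  finally have "d * s\<^sup>2 * (1 + m * d) + d * s * k < k * (d * e)" by simp
  then show ?thesis by (simp add: power2_eq_square algebra_simps)
qed

lemma norm_sum_le_if_one_sided:
  fixes f :: "'b \<Rightarrow> 'a::real_normed_algebra_1" and x :: "'b \<Rightarrow> real"
  assumes f: "\<And>a. a \<in> A \<Longrightarrow> norm (f a) \<le> 1" and upper: "\<And>a. a \<in> A \<Longrightarrow> x a \<le> E" "0 \<le> E"
    and total: "- s \<le> (\<Sum>a\<in>A. x a)"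
  shows "norm (\<Sum>a\<in>A. f a * of_real (x a)) \<le> 2 * real (card A) * E + s"
proof -
  have "norm (f a * of_real (x a)) \<le> 2 * E - x a" if "a \<in> A" for a
  proof -
    have "norm (f a * of_real (x a)) \<le> norm (f a) * \<bar>x a\<bar>"
      using norm_mult_ineq[of "f a" "of_real (x a)"] by simp
    also have "\<dots> \<le> \<bar>x a\<bar>" using f[OF that] by (simp add: mult_left_le_one_le)
    also have "\<dots> \<le> 2 * E - x a" using upper(1)[OF that] upper(2) by simp
    finally show ?thesis .
  qed
  then have "norm (\<Sum>a\<in>A. f a * of_real (x a)) \<le> (\<Sum>a\<in>A. 2 * E - x a)" by (rule sum_norm_le)
  then show ?thesis using total by (simp add: sum_subtractf)
qed

locale character_of_root_product = multiplicative_character chi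
  for chi :: "'a::{finite_field, field_gcd} \<Rightarrow> complex" +
  fixes S :: "'a set" and m :: "'a \<Rightarrow> nat" and c0 :: 'a
  assumes simple_root: "c0 \<in> S" "m c0 = 1"
begin

definition \<psi> :: "'a poly \<Rightarrow> complex" where
  "\<psi> g = (\<Prod>c\<in>S. chi (poly g c) ^ m c)"

lemma \<psi>_mult: "\<psi> (f * g) = \<psi> f * \<psi> g"
  by (simp add: \<psi>_def mult power_mult_distrib prod.distrib)

lemma \<psi>_1: "\<psi> 1 = 1"
  by (simp add: \<psi>_def one)

lemma \<psi>_power_in_values:
  assumes "\<psi> P \<noteq> 0"
  shows "\<psi> P ^ k \<in> chi_values"
proof -
  have "chi ((\<Prod>c\<in>S. poly P c ^ m c) ^ k) = \<psi> P ^ k" by (simp add: \<psi>_def power prod)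
  then show ?thesis using assms by (metis in_values_iff power_not_zero rangeI)
qed

text \<open>Averaging over the translates of the monic polynomials by multiples of a polynomial that vanishes on \<open>S\<close> except
  at the simple root \<open>c0\<close> leaves a complete character sum.\<close>

lemma coeff_sum_\<psi>_eq_0:
  assumes n: "n \<ge> card S"
  shows "coeff_sum_L \<psi> n = 0"
proof -
  define l where "l = root_prod (S - {c0}) (\<lambda>_. 1)"
  have poly_l: "poly l c = (\<Prod>c'\<in>S - {c0}. c - c')" for c by (simp add: l_def root_prod_def poly_prod)
  have l_c0: "poly l c0 \<noteq> 0" by (simp add: poly_l)
  have l_S: "poly l c = 0" if "c \<in> S" "c \<noteq> c0" for c using that by (auto simp: poly_l)
  have "degree (smult y l) < n" for y
  proof -
    have "degree (smult y l) \<le> card (S - {c0})"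
      using degree_smult_le[of y l] by (simp add: l_def degree_root_prod)
    also have "\<dots> < n" using simple_root n by (metis card_Diff1_less finite less_le_trans)
    finally show ?thesis .
  qed
  then have "of_nat CARD('a) * coeff_sum_L \<psi> n = (\<Sum>y\<in>UNIV. \<Sum>g\<in>monics n. \<psi> (g + smult y l))"
    by (simp add: sum_monics_add coeff_sum_L_def)
  also have "\<dots> = (\<Sum>g\<in>monics n. \<Sum>y\<in>UNIV. \<psi> (g + smult y l))" by (rule sum.swap)
  also have "\<dots> = 0"
  proof (rule sum.neutral, rule ballI)
    fix g :: "'a poly"
    have "\<psi> (g + smult y l) = chi (poly g c0 + y * poly l c0) * (\<Prod>c\<in>S - {c0}. chi (poly g c) ^ m c)" for y
      unfolding \<psi>_def using simple_root l_S by (subst prod.remove[of _ c0]) auto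
    then have "(\<Sum>y\<in>UNIV. \<psi> (g + smult y l)) =
        (\<Sum>y\<in>UNIV. chi (poly g c0 + y * poly l c0)) * (\<Prod>c\<in>S - {c0}. chi (poly g c) ^ m c)"
      by (simp add: sum_distrib_right)
    then show "(\<Sum>y\<in>UNIV. \<psi> (g + smult y l)) = 0" by (simp add: sum_affine_eq_0[OF l_c0])
  qed
  finally show ?thesis by simp
qed

definition primes_over :: "complex \<Rightarrow> nat \<Rightarrow> 'a poly set" where
  "primes_over a n = {P. P \<in> prime_monics \<and> degree P dvd n \<and> \<psi> P ^ (n div degree P) = a}"

definition mass :: "complex \<Rightarrow> nat \<Rightarrow> nat" where
  "mass a n = (\<Sum>P\<in>primes_over a n. degree P)"

lemma finite_primes_over: "n > 0 \<Longrightarrow> finite (primes_over a n)"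
  by (rule finite_subset[OF _ finite_prime_monics_degree_dvd]) (auto simp: primes_over_def)

lemma mass_le_CARD_power:
  assumes "n > 0"
  shows "mass a n \<le> CARD('a) ^ n"
proof -
  have "mass a n \<le> (\<Sum>P | P \<in> (prime_monics :: 'a poly set) \<and> degree P dvd n. degree P)"
    unfolding mass_def using assms
    by (intro sum_mono2 finite_prime_monics_degree_dvd) (auto simp: primes_over_def)
  then show ?thesis using sum_degree_prime_monics[OF assms, where ?'a = 'a] by simp
qed

definition norm_root_prod :: "'a poly \<Rightarrow> nat \<Rightarrow> 'a" where
  "norm_root_prod P n = (\<Prod>c\<in>S. ((- 1) ^ n * poly P c ^ (n div degree P)) ^ m c)"

lemma chi_norm_root_prod:
  "chi (norm_root_prod P n) = (\<Prod>c\<in>S. chi ((- 1) ^ n) ^ m c) * \<psi> P ^ (n div degree P)"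
  by (simp add: norm_root_prod_def prod power mult \<psi>_def power_mult_distrib prod.distrib prod_power_distrib
      flip: power_mult) (simp add: mult.commute)

lemma root_prod_norm_cong:
  assumes "P \<in> prime_monics" "degree P dvd n"
  shows "[root_prod S m ^ (\<Sum>i<n. CARD('a) ^ i) = [:norm_root_prod P n:]] (mod P)"
proof -
  have "[(\<Prod>c\<in>S. ([:- c, 1:] ^ (\<Sum>i<n. CARD('a) ^ i)) ^ m c) =
      (\<Prod>c\<in>S. [:(- 1) ^ n * poly P c ^ (n div degree P):] ^ m c)] (mod P)"
    by (intro cong_prod cong_pow prime_monics_norm_cong assms)
  moreover have "(\<Prod>c\<in>S. ([:- c, 1:] ^ N) ^ m c) = root_prod S m ^ N" for N
    by (simp add: root_prod_def prod_power_distrib mult.commute flip: power_mult)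
  ultimately show ?thesis by (simp add: norm_root_prod_def const_poly_prod poly_const_pow)
qed

lemma primes_over_cong:
  assumes P: "P \<in> primes_over a n" and P0: "P0 \<in> primes_over a n" and a: "a \<in> chi_values"
  shows "[root_prod S m ^ ((\<Sum>i<n. CARD('a) ^ i) * card chi_kernel) = [:norm_root_prod P0 n ^ card chi_kernel:]] (mod P)"
proof -
  have "norm_root_prod P n ^ card chi_kernel = norm_root_prod P0 n ^ card chi_kernel"
  proof (rule power_card_kernel_cong)
    show "chi (norm_root_prod P n) = chi (norm_root_prod P0 n)"
      using P P0 by (simp add: chi_norm_root_prod primes_over_def)
    have "\<psi> P0 ^ (n div degree P0) \<noteq> 0" using P0 a by (simp add: primes_over_def in_values_iff)
    then have "chi (norm_root_prod P0 n) \<noteq> 0" by (simp add: chi_norm_root_prod eq_0_iff)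
    then show "norm_root_prod P0 n \<noteq> 0" by (simp add: eq_0_iff)
  qed
  moreover have "[(root_prod S m ^ (\<Sum>i<n. CARD('a) ^ i)) ^ card chi_kernel = [:norm_root_prod P n:] ^ card chi_kernel] (mod P)"
    using P by (intro cong_pow root_prod_norm_cong) (auto simp: primes_over_def)
  ultimately show ?thesis by (simp add: power_mult poly_const_pow)
qed

definition threshold :: nat where
  "threshold = 2 * card chi_values * (card S * card chi_values + 2)"

lemma mass_stepanov:
  assumes n: "n > 0" and a: "a \<in> chi_values" and s: "4 * card chi_values \<le> s" "s\<^sup>2 \<le> CARD('a) ^ n"
  shows "card chi_values * s * mass a n \<le> card S * (card chi_values * s) +
    CARD('a) ^ n * (1 + (\<Sum>c\<in>S. m c) + (s + threshold))"
proof (cases "primes_over a n = {}")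
  case False
  then obtain P0 where P0: "P0 \<in> primes_over a n" by blast
  define d q e where "d = card chi_values" and "q = CARD('a) ^ n" and "e = (\<Sum>i<n. CARD('a) ^ i) * card chi_kernel"
  have "(CARD('a) - 1) * (\<Sum>i<n. CARD('a) ^ i) = CARD('a) ^ n - 1"
    using power_minus_1_eq_mult_sum_nat[of "CARD('a)" n] by simp
  moreover have "d * e = (card chi_values * card chi_kernel) * (\<Sum>i<n. CARD('a) ^ i)"
    by (simp add: d_def e_def mult_ac)
  ultimately have de: "d * e = q - 1" by (simp only: card_values_mult_kernel q_def)
  have "d * s \<le> s * s" using s(1) by (intro mult_le_mono1) (simp add: d_def)
  then have ds: "d * s \<le> q" using s(2) unfolding q_def power2_eq_square by (rule le_trans)
  interpret stepanov S m c0 n d e q "d * s" "s + threshold" "norm_root_prod P0 n ^ card chi_kernel"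
  proof
    show "d * s * (s + threshold + card S * (d * s) + e) < (s + threshold) * d * e"
      using s card_values_pos by (intro stepanov_parameters[OF _ _ _ de]) (auto simp: d_def q_def threshold_def)
  qed (use simple_root ds de in \<open>auto simp: q_def\<close>)
  have "d * s * (\<Sum>P\<in>primes_over a n. degree P) \<le> card S * (d * s) + (e + q * (\<Sum>c\<in>S. m c) + q * (s + threshold))"
  proof (rule stepanov_degree_bound)
    show "finite (primes_over a n)" using n by (rule finite_primes_over)
    show "primes_over a n \<subseteq> prime_monics" by (auto simp: primes_over_def)
    fix P assume P: "P \<in> primes_over a n"
    then show "[monom 1 q = monom 1 1] (mod P)"
      unfolding q_def by (intro prime_monics_monom_cong) (auto simp: primes_over_def)
    show "[f ^ e = [:norm_root_prod P0 n ^ card chi_kernel:]] (mod P)"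
      unfolding f_def e_def by (rule primes_over_cong[OF P P0 a])
  qed
  moreover have "e \<le> q"
  proof -
    have "e \<le> d * e" using card_values_pos by (simp add: d_def)
    then show ?thesis using de by simp
  qed
  ultimately show ?thesis by (simp add: d_def q_def mass_def algebra_simps)
qed (simp add: mass_def)

definition mass_excess :: nat where
  "mass_excess = CARD('a) * (1 + (\<Sum>c\<in>S. m c) + threshold) + card S + 4 * card chi_values * CARD('a)"

lemma card_values_mult_mass_le:
  assumes n: "n > 0" and a: "a \<in> chi_values" and s: "s > 0" "s\<^sup>2 \<le> CARD('a) ^ n" "CARD('a) ^ n \<le> CARD('a) * s\<^sup>2"
  shows "card chi_values * mass a n \<le> CARD('a) ^ n + card chi_values * (mass_excess * s)"
proof -
  define d p q B where "d = card chi_values" and "p = CARD('a)" and "q = CARD('a) ^ n"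
    and "B = 1 + (\<Sum>c\<in>S. m c) + threshold"
  have d: "d > 0" using card_values_pos by (simp add: d_def)
  have q_le: "q \<le> p * s\<^sup>2" using s(3) by (simp add: q_def p_def)
  have excess: "mass_excess = p * B + card S + 4 * d * p"
    by (simp add: mass_excess_def p_def B_def d_def)
  have "d * mass a n \<le> q + d * (mass_excess * s)"
  proof (cases "4 * d \<le> s")
    case True
    have "q * B \<le> p * s\<^sup>2 * B" using q_le by (rule mult_le_mono1)
    also have "\<dots> \<le> s * (d * (p * B * s))" using d by (simp add: power2_eq_square)
    finally have "q * B \<le> s * (d * (p * B * s))" .
    moreover have "d * s * mass a n \<le> card S * (d * s) + q * B + q * s"
      using mass_stepanov[OF n a _ s(2)] True by (simp add: d_def q_def B_def algebra_simps)
    ultimately have "d * s * mass a n \<le> card S * (d * s) + s * (d * (p * B * s)) + q * s" by linarith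
    then have "s * (d * mass a n) \<le> s * (q + d * (card S + p * B * s))" by (simp add: algebra_simps)
    then have "d * mass a n \<le> q + d * (card S + p * B * s)" using s(1) by simp
    also have "card S + p * B * s \<le> mass_excess * s"
      using s(1) by (simp add: excess algebra_simps add_mono trans_le_add1)
    finally show ?thesis by simp
  next
    case False
    have "mass a n \<le> q" using mass_le_CARD_power[OF n, of a] by (simp add: q_def)
    also have "\<dots> \<le> p * (s * s)" using q_le by (simp add: power2_eq_square)
    also have "\<dots> \<le> p * (4 * d * s)" using False by (intro mult_le_mono) auto
    also have "\<dots> \<le> mass_excess * s" by (simp add: excess algebra_simps)
    finally show ?thesis by (simp add: trans_le_add2)
  qed
  then show ?thesis by (simp add: d_def q_def)
qed

lemma mass_bound:
  assumes n: "n > 0" and a: "a \<in> chi_values"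
  shows "real (mass a n) \<le> real (CARD('a) ^ n) / real (card chi_values) + real mass_excess * sqrt (real CARD('a)) ^ n"
proof -
  define p s where "p = CARD('a)" and "s = p ^ (n div 2)"
  have p: "p > 1" unfolding p_def by (rule one_less_CARD_finite_field)
  have s_sq: "s\<^sup>2 = p ^ (2 * (n div 2))" by (simp add: s_def mult.commute flip: power_mult)
  have s_le: "s\<^sup>2 \<le> p ^ n" unfolding s_sq using p by (intro power_increasing) auto
  have "p ^ n \<le> p ^ Suc (2 * (n div 2))" using p by (intro power_increasing) linarith+
  then have "p ^ n \<le> p * s\<^sup>2" by (simp add: s_sq)
  then have "card chi_values * mass a n \<le> p ^ n + card chi_values * (mass_excess * s)"
    using card_values_mult_mass_le[OF n a, of s] s_le p by (simp add: p_def s_def)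
  then have "real (card chi_values) * real (mass a n) \<le>
      real (p ^ n) + real (card chi_values) * (real mass_excess * real s)"
    by (metis of_nat_add of_nat_le_iff of_nat_mult)
  then have "real (mass a n) \<le>
      (real (p ^ n) + real (card chi_values) * (real mass_excess * real s)) / real (card chi_values)"
    using card_values_pos by (subst pos_le_divide_eq) (simp_all add: mult.commute)
  also have "\<dots> = real (p ^ n) / real (card chi_values) + real mass_excess * real s"
    using card_values_pos by (auto simp: add_divide_distrib card_gt_0_iff)
  finally have "real (mass a n) \<le> real (p ^ n) / real (card chi_values) + real mass_excess * real s" .
  moreover have "real s \<le> sqrt (real p) ^ n"
    using s_le by (simp add: real_le_rsqrt flip: real_sqrt_power of_nat_power)
  then have "real mass_excess * real s \<le> real mass_excess * sqrt (real p) ^ n"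
    by (intro mult_left_mono) auto
  ultimately show ?thesis by (simp add: p_def)
qed

lemma prime_monics_\<psi>_eq_0: "{P \<in> prime_monics. \<psi> P = 0} \<subseteq> (\<lambda>c. [:- c, 1:]) ` S"
proof clarify
  fix P assume P: "P \<in> prime_monics" and "\<psi> P = 0"
  then obtain c where c: "c \<in> S" "poly P c = 0" by (auto simp: \<psi>_def eq_0_iff)
  then have dvd: "[:- c, 1:] dvd P" by (simp add: poly_eq_0_iff_dvd)
  moreover have "irreducible P" using prime_monics_prime_elem[OF P] by (rule prime_elem_imp_irreducible)
  moreover have "\<not> is_unit [:- c, 1:]" by (simp add: is_unit_pCons_iff)
  ultimately have "P dvd [:- c, 1:]" using irreducibleD' by blast
  then have "P = [:- c, 1:]" using dvd P by (intro poly_dvd_antisym) (auto simp: prime_monics_def)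
  then show "P \<in> (\<lambda>c. [:- c, 1:]) ` S" using c by auto
qed

lemma sum_primes_over:
  fixes u :: "'a poly \<Rightarrow> 'b::comm_monoid_add"
  assumes n: "n > 0"
  shows "(\<Sum>P | P \<in> prime_monics \<and> degree P dvd n \<and> \<psi> P \<noteq> 0. u P) = (\<Sum>a\<in>chi_values. \<Sum>P\<in>primes_over a n. u P)"
proof -
  let ?A = "{P. P \<in> prime_monics \<and> degree P dvd n \<and> \<psi> P \<noteq> 0}"
  have fin: "finite ?A" by (rule finite_subset[OF _ finite_prime_monics_degree_dvd[OF n]]) auto
  have fibre: "{P \<in> ?A. \<psi> P ^ (n div degree P) = a} = primes_over a n" if "a \<in> chi_values" for a
  proof -
    have "\<psi> P \<noteq> 0" if "P \<in> primes_over a n" for P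
    proof -
      have "n div degree P > 0"
        using that n by (auto simp: primes_over_def div_greater_zero_iff prime_monics_degree_pos dvd_imp_le)
      moreover have "\<psi> P ^ (n div degree P) \<noteq> 0"
        using that \<open>a \<in> chi_values\<close> by (simp add: primes_over_def in_values_iff)
      ultimately show ?thesis by (metis zero_power)
    qed
    then show ?thesis by (auto simp: primes_over_def)
  qed
  have "(\<Sum>P\<in>?A. u P) = (\<Sum>a\<in>chi_values. \<Sum>P\<in>{P \<in> ?A. \<psi> P ^ (n div degree P) = a}. u P)"
    using fin \<psi>_power_in_values by (intro sum.group[symmetric]) auto
  then show ?thesis using fibre by simp
qed

lemma CARD_power_le_sum_mass:
  assumes n: "n > 0"
  shows "CARD('a) ^ n \<le> (\<Sum>a\<in>chi_values. mass a n) + card S"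
proof -
  let ?A = "{P :: 'a poly. P \<in> prime_monics \<and> degree P dvd n}"
  have "CARD('a) ^ n = (\<Sum>P\<in>?A. degree P)"
    using sum_degree_prime_monics[OF n, where ?'a = 'a] by simp
  also have "\<dots> = (\<Sum>P\<in>?A - {P. \<psi> P = 0}. degree P) + (\<Sum>P\<in>?A \<inter> {P. \<psi> P = 0}. degree P)"
    using sum.Int_Diff[OF finite_prime_monics_degree_dvd[OF n], of degree "{P. \<psi> P = 0}"] by simp
  also have "?A - {P. \<psi> P = 0} = {P. P \<in> prime_monics \<and> degree P dvd n \<and> \<psi> P \<noteq> 0}" by auto
  also have "(\<Sum>P\<in>?A \<inter> {P. \<psi> P = 0}. degree P) \<le> (\<Sum>P\<in>(\<lambda>c. [:- c, 1:]) ` S. degree P)"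
    using prime_monics_\<psi>_eq_0 by (intro sum_mono2) auto
  also have "\<dots> = card ((\<lambda>c. [:- c, 1:]) ` S)" by (simp add: sum.reindex inj_on_def card_image)
  also have "\<dots> \<le> card S" by (simp add: card_image_le)
  finally show ?thesis by (simp add: sum_primes_over[OF n] mass_def)
qed

lemma power_sum_eq_sum_mass:
  assumes n: "n > 0"
  shows "power_sum_L \<psi> n = (\<Sum>a\<in>chi_values. a * of_nat (mass a n))"
proof -
  have "power_sum_L \<psi> n =
      (\<Sum>P | P \<in> prime_monics \<and> degree P dvd n \<and> \<psi> P \<noteq> 0. of_nat (degree P) * \<psi> P ^ (n div degree P))"
    unfolding power_sum_L_def
  proof (intro sum.mono_neutral_right ballI finite_prime_monics_degree_dvd n)
    fix P :: "'a poly"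
    assume "P \<in> {P. P \<in> prime_monics \<and> degree P dvd n} - {P. P \<in> prime_monics \<and> degree P dvd n \<and> \<psi> P \<noteq> 0}"
    moreover from this have "n div degree P > 0"
      using n by (auto simp: div_greater_zero_iff prime_monics_degree_pos dvd_imp_le)
    ultimately show "of_nat (degree P) * \<psi> P ^ (n div degree P) = 0" by (simp add: zero_power)
  qed auto
  also have "\<dots> = (\<Sum>a\<in>chi_values. \<Sum>P\<in>primes_over a n. of_nat (degree P) * \<psi> P ^ (n div degree P))"
    by (rule sum_primes_over[OF n])
  also have "\<dots> = (\<Sum>a\<in>chi_values. \<Sum>P\<in>primes_over a n. of_nat (degree P) * a)"
    by (intro sum.cong refl) (simp add: primes_over_def)
  finally show ?thesis by (simp add: mass_def mult.commute sum_distrib_left)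
qed

lemma norm_power_sum_le:
  assumes n: "n > 0"
  shows "cmod (power_sum_L \<psi> n) \<le>
    (2 * real (card chi_values) * real mass_excess + real (card S)) * sqrt (real CARD('a)) ^ n"
proof -
  define average where "average = real (CARD('a) ^ n) / real (card chi_values)"
  define x where "x a = real (mass a n) - average" for a
  define E where "E = real mass_excess * sqrt (real CARD('a)) ^ n"
  have "a * of_nat (mass a n) = a * of_real (x a) + of_real average * a" for a
    by (simp add: x_def algebra_simps)
  then have "power_sum_L \<psi> n = (\<Sum>a\<in>chi_values. a * of_real (x a))"
    by (simp add: power_sum_eq_sum_mass[OF n] sum.distrib sum_values_eq_0 flip: sum_distrib_left)
  also have "cmod \<dots> \<le> 2 * real (card chi_values) * E + real (card S)"
  proof (rule norm_sum_le_if_one_sided)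
    show "cmod a \<le> 1" if "a \<in> chi_values" for a using that norm_value eq_refl by (fastforce simp: chi_values_def)
    show "x a \<le> E" if "a \<in> chi_values" for a
      using mass_bound[OF n that] by (simp add: x_def E_def average_def)
    show "0 \<le> E" by (simp add: E_def)
    have "(\<Sum>a\<in>chi_values. x a) = real (\<Sum>a\<in>chi_values. mass a n) - real (CARD('a) ^ n)"
      using card_values_pos by (auto simp: x_def average_def sum_subtractf card_gt_0_iff)
    then show "- real (card S) \<le> (\<Sum>a\<in>chi_values. x a)"
      using CARD_power_le_sum_mass[OF n] by linarith
  qed
  also have "real (card S) \<le> real (card S) * sqrt (real CARD('a)) ^ n"
  proof -
    have "1 \<le> sqrt (real CARD('a)) ^ n"
      using one_less_CARD_finite_field[where ?'a = 'a] by (intro one_le_power) simp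
    then show ?thesis by (simp add: mult_le_cancel_left1)
  qed
  finally show ?thesis by (simp add: E_def algebra_simps)
qed

theorem weil_bound:
  "cmod (\<Sum>x\<in>UNIV. \<Prod>c\<in>S. chi (x + c) ^ m c) \<le> real (card S - 1) * sqrt (real CARD('a))"
proof -
  have "cmod (coeff_sum_L \<psi> 1) \<le> real (card S - 1) * sqrt (real CARD('a))"
  proof (rule newton_power_sum_bound[where s = "power_sum_L \<psi>"])
    show "coeff_sum_L \<psi> 0 = 1" by (simp add: coeff_sum_L_def monics_0 \<psi>_1)
    show "of_nat n * coeff_sum_L \<psi> n = (\<Sum>i=1..n. power_sum_L \<psi> i * coeff_sum_L \<psi> (n - i))" for n
      using \<psi>_mult \<psi>_1 by (rule newton_identity_L)
  qed (use coeff_sum_\<psi>_eq_0 norm_power_sum_le in auto)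
  moreover have "coeff_sum_L \<psi> 1 = (\<Sum>x\<in>UNIV. \<Prod>c\<in>S. chi (x + c) ^ m c)"
    by (simp only: coeff_sum_L_def monics_1) (simp add: sum.reindex inj_def \<psi>_def)
  ultimately show ?thesis by simp
qed

end

section \<open>Weil's bound for Dirichlet characters\<close>

definition dirichlet_char :: "nat \<Rightarrow> (int \<Rightarrow> complex) \<Rightarrow> bool" where
  "dirichlet_char p \<phi> \<longleftrightarrow> (\<forall>a b. \<phi> (a * b) = \<phi> a * \<phi> b) \<and> \<phi> 1 = 1 \<and>
     (\<forall>a. \<phi> (a mod int p) = \<phi> a) \<and> (\<forall>a. \<phi> a = 0 \<longleftrightarrow> int p dvd a)"

lemma
  assumes "dirichlet_char p \<phi>"
  shows dirichlet_char_mult: "\<phi> (a * b) = \<phi> a * \<phi> b"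
    and dirichlet_char_1: "\<phi> 1 = 1"
    and dirichlet_char_mod: "\<phi> (a mod int p) = \<phi> a"
    and dirichlet_char_eq_0_iff: "\<phi> a = 0 \<longleftrightarrow> int p dvd a"
  using assms by (auto simp: dirichlet_char_def)

lemma dirichlet_char_cong:
  assumes "dirichlet_char p \<phi>" "[a = b] (mod int p)"
  shows "\<phi> a = \<phi> b"
  using assms dirichlet_char_mod[OF assms(1)] unfolding unique_euclidean_semiring_class.cong_def by metis

definition weil_holds :: "nat \<Rightarrow> bool" where
  "weil_holds p \<longleftrightarrow> (\<forall>\<phi> S m. dirichlet_char p \<phi> \<and> (\<exists>a. \<phi> a \<noteq> 0 \<and> \<phi> a \<noteq> 1) \<and> S \<subseteq> {0..<int p} \<and>
     (\<exists>c\<in>S. m c = (1::nat)) \<longrightarrow>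
     cmod (\<Sum>x=0..<int p. \<Prod>c\<in>S. \<phi> (x + c) ^ m c) \<le> real (card S - 1) * sqrt (real p))"

lemma to_int_mod_ring_of_int:
  fixes x :: int
  assumes "x \<in> {0..<int CARD('a::prime_card)}"
  shows "to_int_mod_ring (of_int_mod_ring x :: 'a mod_ring) = x"
  using assms by simp

lemma bij_betw_to_int_mod_ring:
  "bij_betw (to_int_mod_ring :: 'a::prime_card mod_ring \<Rightarrow> int) UNIV {0..<int CARD('a)}"
  using range_to_int_mod_ring[where ?'a = 'a]
  by (intro bij_betw_byWitness[where f' = of_int_mod_ring]) auto

lemma multiplicative_character_dirichlet_char:
  fixes \<phi> :: "int \<Rightarrow> complex"
  assumes \<phi>: "dirichlet_char CARD('a::prime_card) \<phi>" and nontrivial: "\<phi> a \<noteq> 0" "\<phi> a \<noteq> 1"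
  shows "multiplicative_character (\<lambda>x :: 'a mod_ring. \<phi> (to_int_mod_ring x))"
proof
  show "\<phi> (to_int_mod_ring (x * y)) = \<phi> (to_int_mod_ring x) * \<phi> (to_int_mod_ring y)" for x y :: "'a mod_ring"
    by (simp add: to_int_mod_ring_mult dirichlet_char_mod[OF \<phi>] dirichlet_char_mult[OF \<phi>])
  show "\<phi> (to_int_mod_ring (1 :: 'a mod_ring)) = 1" by (simp add: dirichlet_char_1[OF \<phi>])
  have zero: "\<phi> 0 = 0" by (simp add: dirichlet_char_eq_0_iff[OF \<phi>])
  then show "\<phi> (to_int_mod_ring (0 :: 'a mod_ring)) = 0" by simp
  let ?x = "of_int_mod_ring (a mod int CARD('a)) :: 'a mod_ring"
  have value_x: "\<phi> (to_int_mod_ring ?x) = \<phi> a"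
    by (subst to_int_mod_ring_of_int) (auto simp: dirichlet_char_mod[OF \<phi>])
  have "?x \<noteq> 0"
  proof
    assume "?x = 0"
    then have "\<phi> (to_int_mod_ring (0 :: 'a mod_ring)) = \<phi> a" using value_x by (simp only:)
    then show False using nontrivial(1) zero by simp
  qed
  then show "\<exists>x :: 'a mod_ring. x \<noteq> 0 \<and> \<phi> (to_int_mod_ring x) \<noteq> 1"
    using value_x nontrivial(2) by (intro exI[of _ ?x]) (simp only: not_False_eq_True simp_thms)
qed

lemma weil_holds_CARD: "weil_holds CARD('a::prime_card)"
  unfolding weil_holds_def
proof (intro allI impI, elim conjE exE bexE)
  fix \<phi> :: "int \<Rightarrow> complex" and S :: "int set" and m :: "int \<Rightarrow> nat" and a c
  assume \<phi>: "dirichlet_char CARD('a) \<phi>" and nontrivial: "\<phi> a \<noteq> 0" "\<phi> a \<noteq> 1"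
    and S: "S \<subseteq> {0..<int CARD('a)}" and c: "c \<in> S" "m c = 1"
  let ?to_int = "to_int_mod_ring :: 'a mod_ring \<Rightarrow> int" and ?of_int = "of_int_mod_ring :: int \<Rightarrow> 'a mod_ring"
  have to_of_int: "?to_int (?of_int x) = x" if "x \<in> S" for x
    using that S by (intro to_int_mod_ring_of_int) auto
  then have inj: "inj_on ?of_int S" by (intro inj_on_inverseI[of _ ?to_int]) auto
  interpret multiplicative_character "\<lambda>x. \<phi> (?to_int x)"
    using \<phi> nontrivial by (rule multiplicative_character_dirichlet_char)
  interpret character_of_root_product "\<lambda>x. \<phi> (?to_int x)" "?of_int ` S" "\<lambda>x. m (?to_int x)" "?of_int c"
    by standard (use c to_of_int in auto)
  have "\<phi> (?to_int (x + ?of_int c)) ^ m (?to_int (?of_int c)) = \<phi> (?to_int x + c) ^ m c" if "c \<in> S" for c x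
    using to_of_int[OF that] by (simp add: to_int_mod_ring_add dirichlet_char_mod[OF \<phi>])
  then have "(\<Sum>x\<in>UNIV. \<Prod>c\<in>?of_int ` S. \<phi> (?to_int (x + c)) ^ m (?to_int c)) =
      (\<Sum>x\<in>UNIV. \<Prod>c\<in>S. \<phi> (?to_int x + c) ^ m c)"
    using inj by (simp add: prod.reindex)
  also have "\<dots> = (\<Sum>x=0..<int CARD('a). \<Prod>c\<in>S. \<phi> (x + c) ^ m c)"
    by (rule sum.reindex_bij_betw[OF bij_betw_to_int_mod_ring])
  finally show "cmod (\<Sum>x=0..<int CARD('a). \<Prod>c\<in>S. \<phi> (x + c) ^ m c) \<le> real (card S - 1) * sqrt (real CARD('a))"
    using weil_bound inj by (simp add: card_image)
qed

text \<open>The type \<open>'a mod_ring\<close> cannot be instantiated at a variable prime. A single type whose cardinality is a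
  counterexample, if there is one, suffices to transfer Weil's bound to all primes.\<close>

definition critical_prime :: nat where
  "critical_prime = (SOME p. prime p \<and> ((\<exists>q. prime q \<and> \<not> weil_holds q) \<longrightarrow> \<not> weil_holds p))"

lemma critical_prime:
  "prime critical_prime" "prime q \<Longrightarrow> \<not> weil_holds q \<Longrightarrow> \<not> weil_holds critical_prime"
proof -
  have "\<exists>p. prime p \<and> ((\<exists>q. prime q \<and> \<not> weil_holds q) \<longrightarrow> \<not> weil_holds p)"
    using two_is_prime_nat by blast
  then have "prime critical_prime \<and> ((\<exists>q. prime q \<and> \<not> weil_holds q) \<longrightarrow> \<not> weil_holds critical_prime)"
    unfolding critical_prime_def by (rule someI_ex)
  then show "prime critical_prime" "prime q \<Longrightarrow> \<not> weil_holds q \<Longrightarrow> \<not> weil_holds critical_prime" by blast+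
qed

typedef critical = "{..<critical_prime}"
  using critical_prime(1) prime_gt_0_nat by blast

lemma CARD_critical: "CARD(critical) = critical_prime"
  using type_definition.card[OF type_definition_critical] by simp

instance critical :: prime_card
  by standard (simp add: CARD_critical critical_prime(1))

theorem weil_character_sum:
  assumes "prime p" "dirichlet_char p \<phi>" "\<phi> a \<noteq> 0" "\<phi> a \<noteq> 1" "S \<subseteq> {0..<int p}" "c \<in> S" "m c = 1"
  shows "cmod (\<Sum>x=0..<int p. \<Prod>c\<in>S. \<phi> (x + c) ^ m c) \<le> real (card S - 1) * sqrt (real p)"
proof -
  have "weil_holds p"
    using critical_prime(2)[OF assms(1)] weil_holds_CARD[where ?'a = critical] by (auto simp: CARD_critical)
  then show ?thesis using assms unfolding weil_holds_def by blast
qed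

section \<open>The divisor bound\<close>

definition num_divisors :: "nat \<Rightarrow> nat" where
  "num_divisors n = card {d. d dvd n}"

lemma num_divisors_1 [simp]: "num_divisors (Suc 0) = 1"
  by (simp add: num_divisors_def)

lemma num_divisors_mult_le:
  assumes "a > 0" "b > 0"
  shows "num_divisors (a * b) \<le> num_divisors a * num_divisors b"
proof -
  have "{d. d dvd a * b} \<subseteq> (\<lambda>(x, y). x * y) ` ({d. d dvd a} \<times> {d. d dvd b})"
  proof
    fix d assume "d \<in> {d. d dvd a * b}"
    then have "d dvd a * b" by simp
    then obtain x y where "d = x * y" "x dvd a" "y dvd b" by (rule division_decomp[THEN exE]) blast
    then show "d \<in> (\<lambda>(x, y). x * y) ` ({d. d dvd a} \<times> {d. d dvd b})" by auto
  qed
  then have "card {d. d dvd a * b} \<le> card ({d. d dvd a} \<times> {d. d dvd b})"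
    using assms by (intro surj_card_le) auto
  then show ?thesis by (simp add: num_divisors_def card_cartesian_product)
qed

lemma num_divisors_prod_le:
  assumes "\<And>i. i \<in> A \<Longrightarrow> f i > 0"
  shows "num_divisors (\<Prod>i\<in>A. f i) \<le> (\<Prod>i\<in>A. num_divisors (f i))"
  using assms
proof (induction A rule: infinite_finite_induct)
  case (insert x A)
  have "num_divisors (f x * (\<Prod>i\<in>A. f i)) \<le> num_divisors (f x) * num_divisors (\<Prod>i\<in>A. f i)"
    using insert.prems by (intro num_divisors_mult_le) (auto intro!: prod_pos)
  also have "\<dots> \<le> num_divisors (f x) * (\<Prod>i\<in>A. num_divisors (f i))"
    using insert by (intro mult_le_mono2) auto
  finally show ?case using insert.hyps by simp
qed auto

lemma num_divisors_prime_power: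
  fixes q :: nat
  assumes q: "prime q"
  shows "num_divisors (q ^ e) = e + 1"
proof -
  have "{d. d dvd q ^ e} = (\<lambda>i. q ^ i) ` {..e}"
    using q by (auto simp: divides_primepow_nat)
  moreover have "inj_on (\<lambda>i. q ^ i) {..e}"
    using prime_gt_1_nat[OF q] by (auto simp: inj_on_def)
  ultimately show ?thesis by (simp add: num_divisors_def card_image)
qed

lemma num_divisors_le_prod_multiplicity:
  assumes "n > 0"
  shows "num_divisors n \<le> (\<Prod>q\<in>prime_factors n. multiplicity q n + 1)"
proof -
  have "num_divisors n = num_divisors (\<Prod>q\<in>prime_factors n. q ^ multiplicity q n)"
    using prod_prime_factors[of n] assms by simp
  also have "\<dots> \<le> (\<Prod>q\<in>prime_factors n. num_divisors (q ^ multiplicity q n))"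
    by (intro num_divisors_prod_le) (auto intro: prime_gt_0_nat)
  also have "\<dots> = (\<Prod>q\<in>prime_factors n. multiplicity q n + 1)"
    by (intro prod.cong refl num_divisors_prime_power) auto
  finally show ?thesis .
qed

lemma Suc_le_mult_powr_power:
  fixes q \<kappa> :: real
  assumes q: "q \<ge> 2" and \<kappa>: "\<kappa> > 0"
  shows "real e + 1 \<le> (1 + 1 / (\<kappa> * ln 2)) * (q powr \<kappa>) ^ e"
proof -
  let ?c = "1 + 1 / (\<kappa> * ln 2)"
  have c: "?c \<ge> 1" using \<kappa> by simp
  have "?c * (1 + real e * \<kappa> * ln 2) = ?c + real e + real e * (\<kappa> * ln 2)"
    using \<kappa> by (simp add: field_simps)
  moreover have "0 \<le> real e * (\<kappa> * ln 2)" using \<kappa> by simp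
  ultimately have "real e + 1 \<le> ?c * (1 + real e * \<kappa> * ln 2)" using c by linarith
  also have "1 + real e * \<kappa> * ln 2 \<le> exp (real e * \<kappa> * ln 2)" by (rule exp_ge_add_one_self)
  also have "\<dots> = (2 powr \<kappa>) ^ e" by (simp add: powr_def mult_ac flip: exp_of_nat_mult)
  also have "\<dots> \<le> (q powr \<kappa>) ^ e" using q \<kappa> by (intro power_mono powr_mono2) auto
  finally show ?thesis using c by simp
qed

lemma Suc_le_powr_power:
  fixes q \<kappa> :: real
  assumes q: "2 powr (1 / \<kappa>) \<le> q" and \<kappa>: "\<kappa> > 0"
  shows "real e + 1 \<le> (q powr \<kappa>) ^ e"
proof -
  have "real e + 1 \<le> 2 ^ e" by (induction e) auto
  also have "(2 powr (1 / \<kappa>)) powr \<kappa> \<le> q powr \<kappa>" using q \<kappa> by (intro powr_mono2) auto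
  then have "2 ^ e \<le> (q powr \<kappa>) ^ e" using \<kappa> by (intro power_mono) (simp_all add: powr_powr)
  finally show ?thesis .
qed

theorem divisor_bound:
  fixes \<kappa> :: real
  assumes \<kappa>: "\<kappa> > 0"
  shows "\<exists>C\<ge>1. \<forall>n>0. real (num_divisors n) \<le> C * real n powr \<kappa>"
proof (intro exI conjI allI impI)
  define B where "B = nat \<lceil>2 powr (1 / \<kappa>)\<rceil>"
  define c where "c = 1 + 1 / (\<kappa> * ln 2)"
  have c: "c \<ge> 1" using \<kappa> by (simp add: c_def)
  then show "c ^ B \<ge> 1" by simp
  fix n :: nat assume n: "n > 0"
  have prime_power: "real (e + 1) \<le> (if q < B then c else 1) * real (q ^ e) powr \<kappa>" if q: "prime q" for q e :: nat
  proof -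
    have "real (q ^ e) powr \<kappa> = (real q powr \<kappa>) ^ e"
      using prime_gt_0_nat[OF q] by (simp add: powr_realpow[symmetric] powr_powr mult.commute)
    moreover have "2 powr (1 / \<kappa>) \<le> real B" unfolding B_def by linarith
    ultimately show ?thesis
      using Suc_le_mult_powr_power[of "real q" \<kappa> e] Suc_le_powr_power[of \<kappa> "real q" e] prime_ge_2_nat[OF q] \<kappa>
      by (auto simp: c_def add.commute)
  qed
  have "real (num_divisors n) \<le> (\<Prod>q\<in>prime_factors n. real (multiplicity q n + 1))"
    using num_divisors_le_prod_multiplicity[OF n] by (simp only: of_nat_le_iff flip: of_nat_prod)
  also have "\<dots> \<le> (\<Prod>q\<in>prime_factors n. (if q < B then c else 1) * real (q ^ multiplicity q n) powr \<kappa>)"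
    by (intro prod_mono conjI prime_power) auto
  also have "\<dots> = (\<Prod>q\<in>prime_factors n. if q < B then c else 1) * real (\<Prod>q\<in>prime_factors n. q ^ multiplicity q n) powr \<kappa>"
    by (simp add: prod.distrib prod_powr_distrib)
  also have "(\<Prod>q\<in>prime_factors n. q ^ multiplicity q n) = n"
    using prod_prime_factors[of n] n by simp
  also have "(\<Prod>q\<in>prime_factors n. if q < B then c else 1) = c ^ card {q \<in> prime_factors n. q < B}"
    by (simp flip: prod.inter_filter)
  also have "card {q \<in> prime_factors n. q < B} \<le> card {..<B}" by (intro card_mono) auto
  then have "c ^ card {q \<in> prime_factors n. q < B} \<le> c ^ B" using c by (intro power_increasing) auto
  finally show "real (num_divisors n) \<le> c ^ B * real n powr \<kappa>" by (simp add: mult_right_mono)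
qed

section \<open>Characters modulo a prime\<close>

lemma cis_2pi_eq_1_iff:
  assumes "\<bar>t\<bar> < 1"
  shows "cis (2 * pi * t) = 1 \<longleftrightarrow> t = 0"
proof
  assume "cis (2 * pi * t) = 1"
  then have "cos (2 * pi * t) = 1" by (metis cis.sel(1) one_complex.sel(1))
  then obtain n :: int where "2 * pi * t = of_int n * 2 * pi" by (auto simp: cos_one_2pi_int)
  then have "t = of_int n" by simp
  then show "t = 0" using assms by simp
qed simp

lemma fermat_theorem_int:
  fixes a :: int
  assumes p: "prime p" and a: "\<not> int p dvd a"
  shows "[a ^ (p - 1) = 1] (mod int p)"
proof -
  define m where "m = nat (a mod int p)"
  have m: "int m = a mod int p" using prime_gt_0_nat[OF p] by (simp add: m_def)
  have "\<not> p dvd m" using a m by (metis dvd_mod_iff dvd_refl of_nat_dvd_iff)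
  then have "[m ^ (p - 1) = 1] (mod p)" by (rule fermat_theorem[OF p])
  then have "[int m ^ (p - 1) = 1] (mod int p)" by (metis cong_int_iff of_nat_1 of_nat_power)
  then show ?thesis by (simp add: m unique_euclidean_semiring_class.cong_def power_mod)
qed

definition prim_root :: "nat \<Rightarrow> nat" where
  "prim_root p = (SOME g. residue_primroot p g)"

definition dlog :: "nat \<Rightarrow> int \<Rightarrow> nat" where
  "dlog p n = (SOME i. i < p - 1 \<and> [int (prim_root p) ^ i = n] (mod int p))"

definition dchar :: "nat \<Rightarrow> nat \<Rightarrow> int \<Rightarrow> complex" where
  "dchar p k n = (if int p dvd n then 0 else cis (2 * pi * real (k * dlog p n) / real (p - 1)))"

locale prime_mod =
  fixes p :: nat
  assumes prime_p: "prime p"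
begin

lemma p_ge_2: "p \<ge> 2"
  using prime_p by (rule prime_ge_2_nat)

lemma prime_int_p: "prime (int p)"
  using prime_p by simp

lemma residue_primroot_prim_root: "residue_primroot p (prim_root p)"
  unfolding prim_root_def
  using prime_primitive_root_exists[OF prime_gt_1_nat[OF prime_p] prime_p] by (rule someI_ex)

lemma bij_betw_prim_root_power: "bij_betw (\<lambda>i. prim_root p ^ i mod p) {..<p - 1} (totatives p)"
  using residue_primroot_is_generator[OF _ residue_primroot_prim_root] p_ge_2 prime_p
  by (simp add: totient_prime)

lemma ex_dlog:
  assumes "\<not> int p dvd n"
  shows "\<exists>i<p - 1. [int (prim_root p) ^ i = n] (mod int p)"
proof -
  have p_pos: "int p > 0" using p_ge_2 by simp
  define m where "m = nat (n mod int p)"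
  have m: "int m = n mod int p" using p_pos by (simp add: m_def)
  have "0 < m" using assms m by (metis dvd_eq_mod_eq_0 gr0I of_nat_0)
  moreover have "m < p" using m p_pos by (metis of_nat_less_iff pos_mod_bound)
  ultimately have "m \<in> (\<lambda>i. prim_root p ^ i mod p) ` {..<p - 1}"
    using prime_p bij_betw_prim_root_power by (simp add: totatives_prime bij_betw_def)
  then obtain i where i: "i < p - 1" "prim_root p ^ i mod p = m" by blast
  then have "int (prim_root p) ^ i mod int p = n mod int p" using m by (metis of_nat_mod of_nat_power)
  then show ?thesis using i by (auto simp: unique_euclidean_semiring_class.cong_def)
qed

lemma
  assumes "\<not> int p dvd n"
  shows dlog_less: "dlog p n < p - 1"
    and prim_root_power_dlog: "[int (prim_root p) ^ dlog p n = n] (mod int p)"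
  using someI_ex[OF ex_dlog[OF assms]] by (auto simp: dlog_def)

lemma prim_root_power_eq_iff:
  assumes "i < p - 1" "j < p - 1"
  shows "[int (prim_root p) ^ i = int (prim_root p) ^ j] (mod int p) \<longleftrightarrow> i = j"
proof
  assume "[int (prim_root p) ^ i = int (prim_root p) ^ j] (mod int p)"
  then have "prim_root p ^ i mod p = prim_root p ^ j mod p"
    unfolding unique_euclidean_semiring_class.cong_def by (metis of_nat_eq_iff of_nat_mod of_nat_power)
  then show "i = j" using bij_betw_prim_root_power assms by (auto simp: bij_betw_def inj_on_def)
qed simp

lemma not_dvd_prim_root: "\<not> int p dvd int (prim_root p)"
  using residue_primroot_prim_root prime_p
  by (auto simp: residue_primroot_def dest: coprime_common_divisor)

lemma dlog_eqI:
  assumes i: "[int (prim_root p) ^ i = n] (mod int p)" and n: "\<not> int p dvd n"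
  shows "dlog p n = i mod (p - 1)"
proof -
  have "int (prim_root p) ^ i = (int (prim_root p) ^ (p - 1)) ^ (i div (p - 1)) * int (prim_root p) ^ (i mod (p - 1))"
    by (simp flip: power_mult power_add)
  then have "[int (prim_root p) ^ i = 1 ^ (i div (p - 1)) * int (prim_root p) ^ (i mod (p - 1))] (mod int p)"
    using fermat_theorem_int[OF prime_p not_dvd_prim_root] by (metis cong_mult cong_pow cong_refl)
  then have "[int (prim_root p) ^ dlog p n = int (prim_root p) ^ (i mod (p - 1))] (mod int p)"
    using prim_root_power_dlog[OF n] i by (simp add: unique_euclidean_semiring_class.cong_def)
  then show ?thesis using p_ge_2 dlog_less[OF n] by (subst (asm) prim_root_power_eq_iff) auto
qed

lemma dlog_eq_iff:
  assumes "\<not> int p dvd m" "\<not> int p dvd n"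
  shows "dlog p m = dlog p n \<longleftrightarrow> [m = n] (mod int p)"
proof
  assume "dlog p m = dlog p n"
  then show "[m = n] (mod int p)"
    using prim_root_power_dlog[OF assms(1)] prim_root_power_dlog[OF assms(2)] by (metis cong_sym cong_trans)
next
  assume "[m = n] (mod int p)"
  then have "dlog p n = dlog p m mod (p - 1)"
    using dlog_eqI[of "dlog p m" n] prim_root_power_dlog assms cong_trans by blast
  then show "dlog p m = dlog p n" using dlog_less[OF assms(1)] by simp
qed

lemma not_dvd_mult: "\<not> int p dvd a \<Longrightarrow> \<not> int p dvd b \<Longrightarrow> \<not> int p dvd a * b"
  using prime_int_p by (simp add: prime_dvd_mult_iff)

lemma dlog_mult:
  assumes "\<not> int p dvd a" "\<not> int p dvd b"
  shows "dlog p (a * b) = (dlog p a + dlog p b) mod (p - 1)"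
proof (rule dlog_eqI)
  show "[int (prim_root p) ^ (dlog p a + dlog p b) = a * b] (mod int p)"
    using assms by (auto simp: power_add intro: cong_mult prim_root_power_dlog)
qed (use assms not_dvd_mult in blast)

lemma cis_mult_mod:
  "cis (2 * pi * real (k * (i mod (p - 1))) / real (p - 1)) = cis (2 * pi * real (k * i) / real (p - 1))"
proof -
  have p_pos: "real (p - 1) > 0" using p_ge_2 by simp
  have "k * i = (p - 1) * (k * (i div (p - 1))) + k * (i mod (p - 1))"
    using mult_div_mod_eq[of "p - 1" i] by (metis distrib_left mult.left_commute)
  then have "real (k * i) = real (p - 1) * real (k * (i div (p - 1))) + real (k * (i mod (p - 1)))"
    by (metis of_nat_add of_nat_mult)
  moreover have "2 * pi * (x * a + b) / x = 2 * pi * a + 2 * pi * b / x" if "x > 0" for x a b :: real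
    using that by (simp add: field_simps)
  ultimately have "2 * pi * real (k * i) / real (p - 1) =
      2 * pi * real (k * (i div (p - 1))) + 2 * pi * real (k * (i mod (p - 1))) / real (p - 1)"
    using p_pos by metis
  moreover have "cis (2 * pi * real (k * (i div (p - 1)))) = 1"
    by (rule cis_multiple_2pi) auto
  ultimately show ?thesis by (simp flip: cis_mult)
qed

lemma dchar_mult: "dchar p k (a * b) = dchar p k a * dchar p k b"
proof (cases "int p dvd a \<or> int p dvd b")
  case False
  then show ?thesis
    using not_dvd_mult[of a b] cis_mult_mod[of k "dlog p a + dlog p b"]
    by (simp add: dchar_def dlog_mult cis_mult ring_distribs add_divide_distrib)
qed (auto simp: dchar_def)

lemma dchar_cong: "[m = n] (mod int p) \<Longrightarrow> dchar p k m = dchar p k n"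
  using dlog_eq_iff[of m n] by (auto simp: dchar_def cong_dvd_iff)

lemma dchar_1 [simp]: "dchar p k 1 = 1"
proof -
  have "\<not> int p dvd 1" using p_ge_2 by simp
  moreover from this have "dlog p 1 = 0" using dlog_eqI[of 0 1] by simp
  ultimately show ?thesis by (simp add: dchar_def)
qed

lemma dchar_eq_0_iff: "dchar p k n = 0 \<longleftrightarrow> int p dvd n"
  by (simp add: dchar_def)

lemma norm_dchar_le: "cmod (dchar p k n) \<le> 1"
  by (simp add: dchar_def)

lemma dirichlet_char_dchar: "dirichlet_char p (dchar p k)"
  unfolding dirichlet_char_def using dchar_mult dchar_eq_0_iff dchar_cong by (auto intro!: dchar_cong)

lemma dchar_principal: "dchar p 0 n = (if int p dvd n then 0 else 1)"
  by (simp add: dchar_def)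

lemma dchar_nontrivial:
  assumes k: "0 < k" "k < p - 1"
  shows "\<exists>a. dchar p k a \<noteq> 0 \<and> dchar p k a \<noteq> 1"
proof -
  have "dlog p (int (prim_root p)) = 1"
    using dlog_eqI[of 1 "int (prim_root p)"] not_dvd_prim_root k by simp
  then have "dchar p k (int (prim_root p)) = cis (2 * pi * (real k / real (p - 1)))"
    using not_dvd_prim_root by (simp add: dchar_def)
  also have "\<dots> \<noteq> 1" using k by (subst cis_2pi_eq_1_iff) auto
  finally show ?thesis using not_dvd_prim_root dchar_eq_0_iff by blast
qed

lemma dchar_orthogonal:
  assumes "\<not> int p dvd a" "\<not> int p dvd b"
  shows "(\<Sum>k<p - 1. dchar p k a * cnj (dchar p k b)) = (if [a = b] (mod int p) then of_nat (p - 1) else 0)"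
proof -
  define t where "t = (real (dlog p a) - real (dlog p b)) / real (p - 1)"
  have p_pos: "real (p - 1) > 0" using p_ge_2 by simp
  have powers: "dchar p k a * cnj (dchar p k b) = cis (2 * pi * t) ^ k" for k
    using assms by (simp add: dchar_def cis_cnj cis_mult Complex.DeMoivre t_def diff_divide_distrib algebra_simps)
  have "cis (2 * pi * t) ^ (p - 1) = cis (real (p - 1) * (2 * pi * t))" by (rule Complex.DeMoivre)
  also have "real (p - 1) * (2 * pi * t) = 2 * pi * of_int (int (dlog p a) - int (dlog p b))"
    using p_pos by (simp add: t_def del: of_nat_diff)
  finally have unity: "cis (2 * pi * t) ^ (p - 1) = 1" by (simp only: cis_multiple_2pi Ints_of_int)
  have "\<bar>t\<bar> < 1"
    using dlog_less[OF assms(1)] dlog_less[OF assms(2)] by (auto simp: t_def abs_if field_simps)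
  then have "cis (2 * pi * t) = 1 \<longleftrightarrow> t = 0" by (rule cis_2pi_eq_1_iff)
  also have "\<dots> \<longleftrightarrow> [a = b] (mod int p)" using p_pos by (simp add: t_def flip: dlog_eq_iff[OF assms])
  finally show ?thesis using unity by (cases "[a = b] (mod int p)") (simp_all add: powers geometric_sum)
qed

lemma bilinear_orthogonality:
  assumes fin: "finite A" "finite B"
    and A: "\<And>x. x \<in> A \<Longrightarrow> \<not> int p dvd f x" and B: "\<And>y. y \<in> B \<Longrightarrow> \<not> int p dvd g y"
  shows "(\<Sum>k<p - 1. (\<Sum>x\<in>A. dchar p k (f x)) * cnj (\<Sum>y\<in>B. dchar p k (g y))) =
    of_nat ((p - 1) * card {(x, y) \<in> A \<times> B. [f x = g y] (mod int p)})"
proof -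
  have "(\<Sum>k<p - 1. (\<Sum>x\<in>A. dchar p k (f x)) * cnj (\<Sum>y\<in>B. dchar p k (g y))) =
      (\<Sum>k<p - 1. \<Sum>(x, y)\<in>A \<times> B. dchar p k (f x) * cnj (dchar p k (g y)))"
    by (simp add: cnj_sum sum_product sum.cartesian_product)
  also have "\<dots> = (\<Sum>(x, y)\<in>A \<times> B. \<Sum>k<p - 1. dchar p k (f x) * cnj (dchar p k (g y)))"
    by (subst sum.swap) (simp add: split_def)
  also have "\<dots> = (\<Sum>(x, y)\<in>A \<times> B. if [f x = g y] (mod int p) then of_nat (p - 1) else 0)"
  proof (intro sum.cong refl, clarify)
    fix x y assume "x \<in> A" "y \<in> B"
    then show "(\<Sum>k<p - 1. dchar p k (f x) * cnj (dchar p k (g y))) =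
        (if [f x = g y] (mod int p) then of_nat (p - 1) else 0)"
      using A B by (intro dchar_orthogonal) auto
  qed
  also have "\<dots> = (\<Sum>z\<in>{(x, y) \<in> A \<times> B. [f x = g y] (mod int p)}. of_nat (p - 1))"
    using fin by (intro sum.mono_neutral_cong_right) (auto split: if_splits)
  finally show ?thesis by (simp add: mult.commute)
qed

lemma second_moment_eq:
  assumes "finite A" "\<And>x. x \<in> A \<Longrightarrow> \<not> int p dvd f x"
  shows "(\<Sum>k<p - 1. (cmod (\<Sum>x\<in>A. dchar p k (f x)))\<^sup>2) =
    real ((p - 1) * card {(x, y) \<in> A \<times> A. [f x = f y] (mod int p)})"
proof -
  have "complex_of_real (\<Sum>k<p - 1. (cmod (\<Sum>x\<in>A. dchar p k (f x)))\<^sup>2) =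
      of_nat ((p - 1) * card {(x, y) \<in> A \<times> A. [f x = f y] (mod int p)})"
    using bilinear_orthogonality[OF assms(1,1,2,2)] by (simp only: of_real_sum complex_norm_square)
  also have "\<dots> = complex_of_real (real ((p - 1) * card {(x, y) \<in> A \<times> A. [f x = f y] (mod int p)}))"
    unfolding of_real_of_nat_eq ..
  finally show ?thesis unfolding of_real_eq_iff .
qed

end

section \<open>Moments of short character sums\<close>

lemma dirichlet_char_power_p_minus_1:
  assumes p: "prime p" and \<phi>: "dirichlet_char p \<phi>" "\<phi> y \<noteq> 0"
  shows "\<phi> y ^ (p - 1) = 1"
proof -
  have power: "\<phi> (y ^ n) = \<phi> y ^ n" for n
    by (induction n) (simp_all add: dirichlet_char_1[OF \<phi>(1)] dirichlet_char_mult[OF \<phi>(1)])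
  have "\<not> int p dvd y" using \<phi> by (simp add: dirichlet_char_eq_0_iff)
  then have "[y ^ (p - 1) = 1] (mod int p)" by (rule fermat_theorem_int[OF p])
  then have "\<phi> (y ^ (p - 1)) = \<phi> 1" by (rule dirichlet_char_cong[OF \<phi>(1)])
  then show ?thesis by (simp only: power dirichlet_char_1[OF \<phi>(1)])
qed

lemma norm_dirichlet_char:
  assumes p: "prime p" and \<phi>: "dirichlet_char p \<phi>" "\<phi> y \<noteq> 0"
  shows "cmod (\<phi> y) = 1"
proof -
  have "cmod (\<phi> y) ^ (p - 1) = 1 ^ (p - 1)"
    using dirichlet_char_power_p_minus_1[OF assms] by (simp flip: norm_power)
  then show ?thesis using prime_gt_1_nat[OF p] by (intro power_eq_imp_eq_base[of "cmod (\<phi> y)" "p - 1" 1]) auto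
qed

lemma cnj_dirichlet_char:
  assumes p: "prime p" "p > 2" and \<phi>: "dirichlet_char p \<phi>"
  shows "cnj (\<phi> y) = \<phi> y ^ (p - 2)"
proof (cases "\<phi> y = 0")
  case False
  have "\<phi> y * cnj (\<phi> y) = 1" using norm_dirichlet_char[OF p(1) \<phi> False] by (simp flip: complex_norm_square)
  moreover have "Suc (p - 2) = p - 1" using p by simp
  then have "\<phi> y * \<phi> y ^ (p - 2) = 1" using dirichlet_char_power_p_minus_1[OF p(1) \<phi> False] by (metis power_Suc)
  ultimately show ?thesis using False by (metis mult_left_cancel)
qed (use p in \<open>simp add: power_0_left\<close>)

lemma dirichlet_char_nontrivial_imp_gt_2:
  assumes p: "prime p" and \<phi>: "dirichlet_char p \<phi>" "\<phi> a \<noteq> 0" "\<phi> a \<noteq> 1"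
  shows "p > 2"
proof (rule ccontr)
  assume "\<not> p > 2"
  then have p_eq_2: "p = 2" using prime_ge_2_nat[OF p] by simp
  have "\<phi> (a mod 2) = \<phi> a" using dirichlet_char_mod[OF \<phi>(1)] p_eq_2 by simp
  moreover have "a mod 2 = 0 \<or> a mod 2 = 1" by presburger
  ultimately show False
    using \<phi> dirichlet_char_1[OF \<phi>(1)] dirichlet_char_eq_0_iff[OF \<phi>(1), of 0] by auto
qed

lemma weil_correlation:
  fixes I :: "'a set"
  assumes p: "prime p" and \<phi>: "dirichlet_char p \<phi>" "\<phi> a \<noteq> 0" "\<phi> a \<noteq> 1"
    and I: "finite I" "F ` I \<subseteq> {0..<int p}" and i0: "i0 \<in> I" "\<And>i. i \<in> I \<Longrightarrow> F i = F i0 \<Longrightarrow> i = i0"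
  shows "cmod (\<Sum>x=0..<int p. \<Prod>i\<in>I. if \<sigma> i then \<phi> (x + F i) else cnj (\<phi> (x + F i))) \<le> real (card I) * sqrt (real p)"
proof -
  have p_gt_2: "p > 2" using dirichlet_char_nontrivial_imp_gt_2[OF p \<phi>] .
  have bound: "cmod (\<Sum>x=0..<int p. \<Prod>i\<in>I. if \<sigma> i then \<phi> (x + F i) else cnj (\<phi> (x + F i))) \<le> real (card I) * sqrt (real p)"
    if \<sigma>: "\<sigma> i0" for \<sigma>
  proof -
    define e where "e i = (if \<sigma> i then 1 else p - 2)" for i
    define m where "m c = (\<Sum>i\<in>{i\<in>I. F i = c}. e i)" for c
    have "(\<Prod>i\<in>I. if \<sigma> i then \<phi> (x + F i) else cnj (\<phi> (x + F i))) = (\<Prod>i\<in>I. \<phi> (x + F i) ^ e i)" for x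
      by (intro prod.cong refl) (auto simp: e_def cnj_dirichlet_char[OF p p_gt_2 \<phi>(1)])
    also have "(\<Prod>i\<in>I. \<phi> (x + F i) ^ e i) = (\<Prod>c\<in>F ` I. \<Prod>i\<in>{i\<in>I. F i = c}. \<phi> (x + F i) ^ e i)" for x
      using I by (intro prod.group[symmetric]) auto
    also have "(\<Prod>c\<in>F ` I. \<Prod>i\<in>{i\<in>I. F i = c}. \<phi> (x + F i) ^ e i) = (\<Prod>c\<in>F ` I. \<phi> (x + c) ^ m c)" for x
      by (intro prod.cong refl) (simp add: m_def power_sum)
    moreover have "{i\<in>I. F i = F i0} = {i0}" using i0 by auto
    then have "m (F i0) = 1" using \<sigma> by (simp add: m_def e_def)
    then have "cmod (\<Sum>x=0..<int p. \<Prod>c\<in>F ` I. \<phi> (x + c) ^ m c) \<le> real (card (F ` I) - 1) * sqrt (real p)"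
      using i0 I by (intro weil_character_sum[OF p \<phi>, of _ "F i0"]) auto
    moreover have "real (card (F ` I) - 1) * sqrt (real p) \<le> real (card I) * sqrt (real p)"
      using card_image_le[OF I(1), of F] by (intro mult_right_mono) auto
    ultimately show ?thesis by simp
  qed
  show ?thesis
  proof (cases "\<sigma> i0")
    case False
    have "cnj (\<Sum>x=0..<int p. \<Prod>i\<in>I. if \<sigma> i then \<phi> (x + F i) else cnj (\<phi> (x + F i))) =
        (\<Sum>x=0..<int p. \<Prod>i\<in>I. if \<not> \<sigma> i then \<phi> (x + F i) else cnj (\<phi> (x + F i)))"
      unfolding cnj_sum cnj_prod by (intro sum.cong prod.cong refl) auto
    then show ?thesis using bound[of "\<lambda>i. \<not> \<sigma> i"] False by (metis complex_mod_cnj)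
  qed (use bound in auto)
qed

lemma card_image_le_half:
  assumes fin: "finite A" and repeated: "\<And>i. i \<in> A \<Longrightarrow> \<exists>j\<in>A. j \<noteq> i \<and> F j = F i"
  shows "2 * card (F ` A) \<le> card A"
proof -
  have "2 \<le> card {i\<in>A. F i = c}" if c: "c \<in> F ` A" for c
  proof -
    obtain i where i: "i \<in> A" "F i = c" using c by auto
    then obtain j where j: "j \<in> A" "j \<noteq> i" "F j = F i" using repeated by blast
    then have "card {i, j} \<le> card {i\<in>A. F i = c}" using i fin by (intro card_mono) auto
    then show ?thesis using j by simp
  qed
  then have "2 * card (F ` A) \<le> (\<Sum>c\<in>F ` A. card {i\<in>A. F i = c})"
    using sum_bounded_below[of "F ` A" 2 "\<lambda>c. card {i\<in>A. F i = c}"] by (simp add: mult.commute)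
  also have "\<dots> = card A" using sum.group[OF fin, of "F ` A" F "\<lambda>_. 1 :: nat"] fin by simp
  finally show ?thesis .
qed

lemma ex_factorization_through_lessThan:
  assumes A: "finite A" "card (F ` A) \<le> r" and F: "F \<in> PiE A (\<lambda>_. B)" and B: "B \<noteq> {}"
  shows "\<exists>\<pi>\<in>PiE A (\<lambda>_. {..<r}). \<exists>G\<in>PiE {..<r} (\<lambda>_. B). F = (\<lambda>i\<in>A. G (\<pi> i))"
proof -
  obtain \<iota> where \<iota>: "\<iota> ` (F ` A) \<subseteq> {..<r}" "inj_on \<iota> (F ` A)"
    using card_le_inj[of "F ` A" "{..<r}"] A by auto
  obtain b where b: "b \<in> B" using B by auto
  define G where "G = (\<lambda>k\<in>{..<r}. if k \<in> \<iota> ` F ` A then inv_into (F ` A) \<iota> k else b)"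
  show ?thesis
  proof (intro bexI)
    show "F = (\<lambda>i\<in>A. G ((\<lambda>i\<in>A. \<iota> (F i)) i))"
    proof
      fix i show "F i = (\<lambda>i\<in>A. G ((\<lambda>i\<in>A. \<iota> (F i)) i)) i"
      proof (cases "i \<in> A")
        case True
        then have "\<iota> (F i) < r" "\<iota> (F i) \<in> \<iota> ` F ` A" using \<iota>(1) by auto
        then show ?thesis using True \<iota>(2) by (simp add: G_def)
      qed (use F in \<open>auto simp: PiE_iff extensional_def\<close>)
    qed
    have "inv_into (F ` A) \<iota> k \<in> B" if "k \<in> \<iota> ` F ` A" for k
      using inv_into_into[OF that] F by (auto simp: PiE_iff)
    then show "G \<in> PiE {..<r} (\<lambda>_. B)" using b by (auto simp: G_def)
    show "(\<lambda>i\<in>A. \<iota> (F i)) \<in> PiE A (\<lambda>_. {..<r})" using \<iota>(1) by auto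
  qed
qed

definition repeating_tuples :: "nat \<Rightarrow> 'a set \<Rightarrow> (nat \<Rightarrow> 'a) set" where
  "repeating_tuples n B = {F \<in> PiE {..<n} (\<lambda>_. B). \<forall>i<n. \<exists>j<n. j \<noteq> i \<and> F j = F i}"

lemma card_repeating_tuples_le:
  assumes B: "finite B" "B \<noteq> {}"
  shows "card (repeating_tuples (2 * r) B) \<le> r ^ (2 * r) * card B ^ r"
proof -
  let ?compose = "\<lambda>(\<pi> :: nat \<Rightarrow> nat, G :: nat \<Rightarrow> 'a). \<lambda>i\<in>{..<2 * r}. G (\<pi> i)"
  let ?D = "PiE {..<2 * r} (\<lambda>_. {..<r}) \<times> PiE {..<r} (\<lambda>_. B)"
  have "repeating_tuples (2 * r) B \<subseteq> ?compose ` ?D"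
  proof
    fix F assume F: "F \<in> repeating_tuples (2 * r) B"
    then have "2 * card (F ` {..<2 * r}) \<le> card {..<2 * r}"
      by (intro card_image_le_half) (auto simp: repeating_tuples_def)
    then have "card (F ` {..<2 * r}) \<le> r" by simp
    then show "F \<in> ?compose ` ?D"
      using ex_factorization_through_lessThan[of "{..<2 * r}" F r B] F B(2) by (auto simp: repeating_tuples_def image_iff)
  qed
  moreover have "finite ?D" using B by (auto intro!: finite_PiE)
  ultimately have "card (repeating_tuples (2 * r) B) \<le> card ?D" by (rule surj_card_le[rotated])
  then show ?thesis by (simp add: card_cartesian_product card_PiE)
qed

lemma norm_power_even_eq_sum_PiE:
  fixes w :: "'b \<Rightarrow> complex"
  assumes B: "finite B"
  shows "complex_of_real (cmod (\<Sum>b\<in>B. w b) ^ (2 * r)) =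
    (\<Sum>F\<in>PiE {..<2 * r} (\<lambda>_. B). \<Prod>i<2 * r. if i < r then w (F i) else cnj (w (F i)))"
proof -
  let ?W = "\<Sum>b\<in>B. w b"
  have "(\<Prod>i<r + n. \<Sum>b\<in>B. if i < r then w b else cnj (w b)) = ?W ^ r * cnj ?W ^ n" for n
  proof (induction n)
    case 0
    have "(\<Prod>i<r. \<Sum>b\<in>B. if i < r then w b else cnj (w b)) = (\<Prod>i<r. ?W)" by (intro prod.cong) auto
    then show ?case by simp
  qed (simp add: cnj_sum)
  from this[of r] have "(\<Prod>i<2 * r. \<Sum>b\<in>B. if i < r then w b else cnj (w b)) = (?W * cnj ?W) ^ r"
    by (simp add: mult_2 power_mult_distrib)
  moreover have "(?W * cnj ?W) ^ r = complex_of_real (cmod ?W ^ (2 * r))"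
    by (metis complex_norm_square of_real_power power_mult)
  ultimately show ?thesis using B by (simp add: prod_sum_PiE)
qed

theorem short_sum_moment:
  assumes p: "prime p" and \<phi>: "dirichlet_char p \<phi>" "\<phi> a \<noteq> 0" "\<phi> a \<noteq> 1" and h: "0 < h" "h < p"
  shows "(\<Sum>x=0..<int p. cmod (\<Sum>b=1..int h. \<phi> (x + b)) ^ (2 * r)) \<le>
    real (r ^ (2 * r)) * real h ^ r * real p + real h ^ (2 * r) * (2 * real r * sqrt (real p))"
proof -
  define u where "u i y = (if i < r then \<phi> y else cnj (\<phi> y))" for i y
  define tuples where "tuples = PiE {..<2 * r} (\<lambda>_. {1..int h})"
  define correlation where "correlation F = (\<Sum>x=0..<int p. \<Prod>i<2 * r. u i (x + F i))" for F
  have fin: "finite tuples" by (simp add: tuples_def finite_PiE)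
  have "cmod (\<phi> y) \<le> 1" for y
    using norm_dirichlet_char[OF p \<phi>(1), of y] by (cases "\<phi> y = 0") auto
  then have "cmod (\<Prod>i<2 * r. u i (x + F i)) \<le> 1" for F x
    unfolding prod_norm[symmetric] by (intro prod_le_1) (auto simp: u_def)
  then have trivial: "cmod (correlation F) \<le> real p" for F
    unfolding correlation_def using sum_norm_le[of "{0..<int p}" _ "\<lambda>_. 1"] by fastforce
  have weil: "cmod (correlation F) \<le> 2 * real r * sqrt (real p)"
    if F: "F \<in> tuples" "F \<notin> repeating_tuples (2 * r) {1..int h}" for F
  proof -
    obtain i0 where i0: "i0 < 2 * r" "\<And>j. j < 2 * r \<Longrightarrow> F j = F i0 \<Longrightarrow> j = i0"
      using F by (auto simp: tuples_def repeating_tuples_def)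
    moreover have "F ` {..<2 * r} \<subseteq> {0..<int p}" using F(1) h by (force simp: tuples_def PiE_iff)
    ultimately show ?thesis
      using weil_correlation[OF p \<phi>, of "{..<2 * r}" F i0 "\<lambda>i. i < r"] by (auto simp: correlation_def u_def)
  qed
  have "complex_of_real (\<Sum>x=0..<int p. cmod (\<Sum>b=1..int h. \<phi> (x + b)) ^ (2 * r)) = (\<Sum>F\<in>tuples. correlation F)"
    unfolding of_real_sum norm_power_even_eq_sum_PiE[OF finite_atLeastAtMost_int] correlation_def tuples_def u_def
    by (rule sum.swap)
  then have "(\<Sum>x=0..<int p. cmod (\<Sum>b=1..int h. \<phi> (x + b)) ^ (2 * r)) = cmod (\<Sum>F\<in>tuples. correlation F)"
    by (metis (no_types, lifting) norm_of_real abs_of_nonneg sum_nonneg zero_le_power norm_ge_zero)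
  also have "\<dots> \<le> (\<Sum>F\<in>tuples. (if F \<in> repeating_tuples (2 * r) {1..int h} then real p else 0) + 2 * real r * sqrt (real p))"
  proof (rule sum_norm_le)
    fix F assume "F \<in> tuples"
    then show "cmod (correlation F) \<le>
        (if F \<in> repeating_tuples (2 * r) {1..int h} then real p else 0) + 2 * real r * sqrt (real p)"
      using trivial[of F] weil[of F] by (simp add: add_increasing2)
  qed
  also have "\<dots> = real (card (repeating_tuples (2 * r) {1..int h})) * real p + real (card tuples) * (2 * real r * sqrt (real p))"
    using fin by (simp add: sum.distrib repeating_tuples_def tuples_def flip: sum.inter_filter)
  also have "real (card (repeating_tuples (2 * r) {1..int h})) \<le> real (r ^ (2 * r) * card {1..int h} ^ r)"
    using h by (simp only: of_nat_le_iff) (intro card_repeating_tuples_le, auto)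
  also have "real (card tuples) = real h ^ (2 * r)" by (simp add: tuples_def card_PiE)
  finally show ?thesis by (simp add: mult_right_mono)
qed

section \<open>Burgess' bound\<close>

lemma weighted_power_mean:
  fixes \<nu> w :: "'a \<Rightarrow> real"
  assumes fin: "finite A" and nonneg: "\<And>x. x \<in> A \<Longrightarrow> \<nu> x \<ge> 0" "\<And>x. x \<in> A \<Longrightarrow> w x \<ge> 0"
  shows "(\<Sum>x\<in>A. \<nu> x * w x) ^ Suc r \<le> (\<Sum>x\<in>A. \<nu> x) ^ r * (\<Sum>x\<in>A. \<nu> x * w x ^ Suc r)"
proof (cases "(\<Sum>x\<in>A. \<nu> x) = 0")
  case True
  then have "\<forall>x\<in>A. \<nu> x = 0" using fin nonneg by (simp add: sum_nonneg_eq_0_iff)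
  then show ?thesis by simp
next
  case False
  define s where "s = (\<Sum>x\<in>A. \<nu> x)"
  have s: "s > 0" using False nonneg by (simp add: s_def less_le sum_nonneg)
  have convex: "convex_on {0::real..} (\<lambda>x. x ^ n)" for n
    by (cases "even n") (auto intro: convex_on_subset[OF convex_power_even] convex_power_odd)
  have "(\<Sum>x\<in>A. (\<nu> x / s) *\<^sub>R w x) ^ Suc r \<le> (\<Sum>x\<in>A. (\<nu> x / s) * w x ^ Suc r)"
  proof (rule convex_on_sum[OF fin _ convex])
    show "A \<noteq> {}" using False by auto
    show "(\<Sum>x\<in>A. \<nu> x / s) = 1" using s by (simp add: s_def flip: sum_divide_distrib)
  qed (use nonneg s in auto)
  then have "(\<Sum>x\<in>A. \<nu> x * w x) ^ Suc r / s ^ Suc r \<le> (\<Sum>x\<in>A. \<nu> x * w x ^ Suc r) / s"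
    by (simp add: power_divide flip: sum_divide_distrib)
  then have "(\<Sum>x\<in>A. \<nu> x * w x) ^ Suc r \<le> (\<Sum>x\<in>A. \<nu> x * w x ^ Suc r) / s * s ^ Suc r"
    using s by (simp add: pos_divide_le_eq)
  then show ?thesis using s by (simp add: s_def mult.commute)
qed

lemma weighted_power_sum_le:
  fixes \<nu> w :: "'a \<Rightarrow> real"
  assumes fin: "finite A" and nonneg: "\<And>x. x \<in> A \<Longrightarrow> \<nu> x \<ge> 0" "\<And>x. x \<in> A \<Longrightarrow> w x \<ge> 0" and r: "r > 0"
  shows "(\<Sum>x\<in>A. \<nu> x * w x) ^ (2 * r) \<le>
    (\<Sum>x\<in>A. \<nu> x) ^ (2 * r - 2) * (\<Sum>x\<in>A. (\<nu> x)\<^sup>2) * (\<Sum>x\<in>A. w x ^ (2 * r))"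
proof -
  obtain r' where r': "r = Suc r'" using r by (cases r) auto
  have "(\<Sum>x\<in>A. \<nu> x * w x) ^ (2 * r) = ((\<Sum>x\<in>A. \<nu> x * w x) ^ r)\<^sup>2"
    by (simp add: mult.commute flip: power_mult)
  also have "\<dots> \<le> ((\<Sum>x\<in>A. \<nu> x) ^ r' * (\<Sum>x\<in>A. \<nu> x * w x ^ r))\<^sup>2"
    unfolding r' using nonneg by (intro power_mono weighted_power_mean fin zero_le_power sum_nonneg) auto
  also have "\<dots> = (\<Sum>x\<in>A. \<nu> x) ^ (2 * r - 2) * (\<Sum>x\<in>A. \<nu> x * w x ^ r)\<^sup>2"
    by (simp add: r' power_mult_distrib mult.commute flip: power_mult)
  also have "\<dots> \<le> (\<Sum>x\<in>A. \<nu> x) ^ (2 * r - 2) * ((\<Sum>x\<in>A. (\<nu> x)\<^sup>2) * (\<Sum>x\<in>A. (w x ^ r)\<^sup>2))"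
    using nonneg by (intro mult_left_mono Cauchy_Schwarz_ineq_sum zero_le_power sum_nonneg) auto
  finally show ?thesis by (simp add: mult_ac flip: power_mult)
qed

lemma sum_square_card_fibre:
  assumes "finite A" "finite B" "f ` A \<subseteq> B"
  shows "(\<Sum>y\<in>B. (card {x \<in> A. f x = y})\<^sup>2) = card {(x, x') \<in> A \<times> A. f x = f x'}"
proof -
  have "(\<Sum>y\<in>B. (card {x \<in> A. f x = y})\<^sup>2) = (\<Sum>y\<in>B. \<Sum>x | x \<in> A \<and> f x = y. card {x' \<in> A. f x' = f x})"
    by (simp add: power2_eq_square)
  also have "\<dots> = (\<Sum>x\<in>A. card {x' \<in> A. f x' = f x})" using assms by (rule sum.group)
  also have "\<dots> = card (Sigma A (\<lambda>x. {x' \<in> A. f x' = f x}))" using assms(1) by (subst card_SigmaI) auto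
  also have "Sigma A (\<lambda>x. {x' \<in> A. f x' = f x}) = {(x, x') \<in> A \<times> A. f x = f x'}" by auto
  finally show ?thesis .
qed

definition interval_sum :: "nat \<Rightarrow> nat \<Rightarrow> nat \<Rightarrow> complex" where
  "interval_sum p k A = (\<Sum>a=1..A. dchar p k (int a))"

context prime_mod
begin

lemma norm_interval_sum_le: "cmod (interval_sum p k A) \<le> real A"
  unfolding interval_sum_def
  using sum_norm_le[of "{1..A}" "\<lambda>a. dchar p k (int a)" "\<lambda>_. 1"] norm_dchar_le by simp

lemma interval_sum_shift: "cmod (interval_sum p k A - (\<Sum>a=1..A. dchar p k (int a + int t))) \<le> 2 * real t"
proof -
  let ?f = "\<lambda>a. dchar p k (int a)"
  have short: "cmod (\<Sum>a=b+1..b+t. ?f a) \<le> real t" for b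
    using sum_norm_le[of "{b+1..b+t}" ?f "\<lambda>_. 1"] norm_dchar_le by simp
  have "(\<Sum>a=1..A. dchar p k (int a + int t)) = (\<Sum>a=1+t..A+t. ?f a)"
    by (subst sum.shift_bounds_cl_nat_ivl) simp
  moreover have "(\<Sum>a=1..A+t. ?f a) = (\<Sum>a=1..A. ?f a) + (\<Sum>a=A+1..A+t. ?f a)"
    by (rule sum.ub_add_nat) simp
  moreover have "(\<Sum>a=1..t+A. ?f a) = (\<Sum>a=1..t. ?f a) + (\<Sum>a=t+1..t+A. ?f a)"
    by (rule sum.ub_add_nat) simp
  ultimately have "interval_sum p k A - (\<Sum>a=1..A. dchar p k (int a + int t)) =
      (\<Sum>a=0+1..0+t. ?f a) - (\<Sum>a=A+1..A+t. ?f a)"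
    by (simp add: interval_sum_def add.commute algebra_simps)
  also have "cmod \<dots> \<le> real t + real t"
    using norm_triangle_ineq4 add_mono[OF short short] by (rule order_trans)
  finally show ?thesis by simp
qed

lemma not_dvd_less: "0 < u \<Longrightarrow> u < p \<Longrightarrow> \<not> int p dvd int u"
  by (auto dest: dvd_imp_le)

text \<open>The residue of \<open>a / u\<close>.\<close>

definition quotient_mod :: "nat \<Rightarrow> nat \<Rightarrow> int" where
  "quotient_mod a u = int a * modular_inverse (int p) (int u) mod int p"

lemma cong_mult_quotient_mod:
  assumes "0 < u" "u < p"
  shows "[int u * quotient_mod a u = int a] (mod int p)"
proof -
  have "coprime (int u) (int p)"
    using prime_imp_coprime[OF prime_int_p not_dvd_less[OF assms]] by (simp add: coprime_commute)
  then have "[int a * (int u * modular_inverse (int p) (int u)) = int a * 1] (mod int p)"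
    by (intro cong_mult cong_refl cong_modular_inverse1)
  then show ?thesis
    by (simp add: quotient_mod_def unique_euclidean_semiring_class.cong_def mod_mult_right_eq mult.left_commute)
qed

lemma quotient_mod_in: "quotient_mod a u \<in> {0..<int p}"
  using p_ge_2 by (simp add: quotient_mod_def)

lemma quotient_mod_eqD:
  assumes eq: "quotient_mod a u = quotient_mod a' u'"
    and u: "0 < u" "u < p" "0 < u'" "u' < p" and less: "a * u' < p" "a' * u < p"
  shows "a * u' = a' * u"
proof -
  have "[int a * int u' = int u * quotient_mod a u * int u'] (mod int p)"
    by (intro cong_mult cong_refl cong_sym[OF cong_mult_quotient_mod] u)
  also have "int u * quotient_mod a u * int u' = int u' * quotient_mod a' u' * int u"
    by (simp add: eq)
  also have "[\<dots> = int a' * int u] (mod int p)"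
    by (intro cong_mult cong_refl cong_mult_quotient_mod u)
  finally have "[a * u' = a' * u] (mod p)" by (metis cong_int_iff of_nat_mult)
  then show ?thesis using less cong_less_modulus_unique_nat by blast
qed

lemma card_quotient_mod_collisions_le:
  assumes AV: "A * V < p" and A: "0 < A" "0 < V" and D: "\<And>m. 0 < m \<Longrightarrow> m \<le> A * V \<Longrightarrow> real (num_divisors m) \<le> D"
  shows "real (card {(w, w') \<in> ({1..A} \<times> {1..V}) \<times> ({1..A} \<times> {1..V}).
    quotient_mod (fst w) (snd w) = quotient_mod (fst w') (snd w')}) \<le> real (A * V) * D" (is "real (card ?C) \<le> _")
proof -
  let ?f = "\<lambda>((a :: nat, u :: nat), (a' :: nat, u' :: nat)). ((a, u'), a')"
  let ?T = "Sigma ({1..A} \<times> {1..V}) (\<lambda>(a, u'). {d. d dvd a * u'})"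
  have "1 * V \<le> A * V" using A by (intro mult_le_mono1) simp
  then have "V < p" using AV by linarith
  have cross: "a * u' = a' * u" if "((a, u), (a', u')) \<in> ?C" for a u a' u'
  proof (rule quotient_mod_eqD)
    have "a * u' \<le> A * V" "a' * u \<le> A * V" using that by (auto intro!: mult_le_mono)
    then show "a * u' < p" "a' * u < p" using AV by linarith+
  qed (use that \<open>V < p\<close> in auto)
  have "card ?C \<le> card ?T"
  proof (rule card_inj_on_le[where f = ?f])
    show "?f ` ?C \<subseteq> ?T"
    proof
      fix z assume "z \<in> ?f ` ?C"
      then obtain a u a' u' where z: "z = ((a, u'), a')" and w: "((a, u), (a', u')) \<in> ?C" by auto
      have "a' dvd a * u'" by (simp add: cross[OF w])
      then show "z \<in> ?T" using z w by auto
    qed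
    show "inj_on ?f ?C"
    proof (rule inj_onI)
      fix z z' assume z: "z \<in> ?C" "z' \<in> ?C" "?f z = ?f z'"
      obtain a u a' u' where z_eq: "z = ((a, u), (a', u'))" by (metis prod.exhaust)
      obtain b v b' v' where "z' = ((b, v), (b', v'))" by (metis prod.exhaust)
      with z(3) have z'_eq: "z' = ((a, v), (a', u'))" by (simp add: z_eq)
      have "a' * u = a' * v" using cross[of a u a' u'] cross[of a v a' u'] z(1,2) by (simp only: z_eq z'_eq)
      moreover have "a' > 0" using z(1) by (simp add: z_eq)
      ultimately show "z = z'" by (simp add: z_eq z'_eq)
    qed
  qed (auto intro!: finite_SigmaI)
  also have "card ?T = (\<Sum>(a, u')\<in>{1..A} \<times> {1..V}. num_divisors (a * u'))"
    by (subst card_SigmaI) (auto simp: num_divisors_def split_def intro!: sum.cong)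
  finally have "real (card ?C) \<le> (\<Sum>(a, u')\<in>{1..A} \<times> {1..V}. real (num_divisors (a * u')))"
    by (simp add: split_def flip: of_nat_sum)
  also have "\<dots> \<le> (\<Sum>(a, u')\<in>{1..A} \<times> {1..V}. D)"
    by (intro sum_mono) (auto intro!: D mult_le_mono)
  finally show ?thesis by simp
qed

definition quotient_count :: "nat \<Rightarrow> nat \<Rightarrow> int \<Rightarrow> real" where
  "quotient_count A V x = real (card {w \<in> {1..A} \<times> {1..V}. quotient_mod (fst w) (snd w) = x})"

lemma sum_quotient_mod:
  fixes f :: "int \<Rightarrow> real"
  shows "(\<Sum>a=1..A. \<Sum>u=1..V. f (quotient_mod a u)) = (\<Sum>x=0..<int p. quotient_count A V x * f x)"
proof -
  let ?B = "{1..A} \<times> {1..V}"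
  have "(\<Sum>a=1..A. \<Sum>u=1..V. f (quotient_mod a u)) = (\<Sum>w\<in>?B. f (quotient_mod (fst w) (snd w)))"
    by (simp add: sum.cartesian_product split_def)
  also have "\<dots> = (\<Sum>x=0..<int p. \<Sum>w | w \<in> ?B \<and> quotient_mod (fst w) (snd w) = x. f (quotient_mod (fst w) (snd w)))"
    using quotient_mod_in by (intro sum.group[symmetric]) auto
  also have "\<dots> = (\<Sum>x=0..<int p. quotient_count A V x * f x)"
    by (intro sum.cong refl) (simp add: quotient_count_def split_def)
  finally show ?thesis .
qed

lemma sum_quotient_count: "(\<Sum>x=0..<int p. quotient_count A V x) = real (A * V)"
  using sum_quotient_mod[of "\<lambda>_. 1" V A] by simp

lemma sum_square_quotient_count_le:
  assumes "A * V < p" "0 < A" "0 < V" "\<And>m. 0 < m \<Longrightarrow> m \<le> A * V \<Longrightarrow> real (num_divisors m) \<le> D"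
  shows "(\<Sum>x=0..<int p. (quotient_count A V x)\<^sup>2) \<le> real (A * V) * D"
proof -
  have "(\<Sum>x=0..<int p. (card {w \<in> {1..A} \<times> {1..V}. quotient_mod (fst w) (snd w) = x})\<^sup>2) =
      card {(w, w') \<in> ({1..A} \<times> {1..V}) \<times> ({1..A} \<times> {1..V}).
        quotient_mod (fst w) (snd w) = quotient_mod (fst w') (snd w')}"
    using quotient_mod_in by (intro sum_square_card_fibre) auto
  then have "(\<Sum>x=0..<int p. (quotient_count A V x)\<^sup>2) =
      real (card {(w, w') \<in> ({1..A} \<times> {1..V}) \<times> ({1..A} \<times> {1..V}).
        quotient_mod (fst w) (snd w) = quotient_mod (fst w') (snd w')})"
    by (simp only: quotient_count_def flip: of_nat_power of_nat_sum)
  then show ?thesis using card_quotient_mod_collisions_le[OF assms] by simp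
qed

definition window_sum :: "nat \<Rightarrow> nat \<Rightarrow> int \<Rightarrow> complex" where
  "window_sum k h x = (\<Sum>b=1..int h. dchar p k (x + b))"

lemma norm_progression_sum_le:
  assumes u: "0 < u" "u < p"
  shows "cmod (\<Sum>b=1..h. dchar p k (int a + int (u * b))) \<le> cmod (window_sum k h (quotient_mod a u))"
proof -
  have "[int a + int (u * b) = int u * (quotient_mod a u + int b)] (mod int p)" for b
    using cong_add[OF cong_sym[OF cong_mult_quotient_mod[OF u]] cong_refl] by (simp add: distrib_left)
  then have "dchar p k (int a + int (u * b)) = dchar p k (int u) * dchar p k (quotient_mod a u + int b)" for b
    by (metis dchar_cong dchar_mult)
  then have "(\<Sum>b=1..h. dchar p k (int a + int (u * b))) =
      dchar p k (int u) * (\<Sum>b=1..h. dchar p k (quotient_mod a u + int b))"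
    by (simp only: sum_distrib_left)
  also have "(\<Sum>b=1..h. dchar p k (quotient_mod a u + int b)) = window_sum k h (quotient_mod a u)"
    unfolding window_sum_def by (rule sum.reindex_bij_witness[of _ nat int]) auto
  finally show ?thesis
    using norm_dchar_le[of k "int u"] by (simp add: norm_mult mult_left_le_one_le)
qed

lemma interval_sum_le_window_sums:
  assumes V: "V < p"
  shows "real V * real h * cmod (interval_sum p k A) \<le>
    (\<Sum>x=0..<int p. quotient_count A V x * cmod (window_sum k h x)) + 2 * (real V * real h)\<^sup>2"
proof -
  let ?S = "\<lambda>u b. \<Sum>a=1..A. dchar p k (int a + int (u * b))"
  have "real V * real h * cmod (interval_sum p k A) = cmod (\<Sum>u=1..V. \<Sum>b=1..h. interval_sum p k A)"
    by (simp add: norm_mult)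
  also have "\<dots> \<le> cmod (\<Sum>u=1..V. \<Sum>b=1..h. ?S u b) + cmod (\<Sum>u=1..V. \<Sum>b=1..h. interval_sum p k A - ?S u b)"
    using norm_triangle_ineq[of "\<Sum>u=1..V. \<Sum>b=1..h. ?S u b" "\<Sum>u=1..V. \<Sum>b=1..h. interval_sum p k A - ?S u b"]
    by (simp only: sum_subtractf add_diff_eq add_diff_cancel_left')
  also have "cmod (\<Sum>u=1..V. \<Sum>b=1..h. interval_sum p k A - ?S u b) \<le> (\<Sum>u=1..V. \<Sum>b=1..h. 2 * real (V * h))"
  proof (intro sum_norm_le)
    fix u b assume ub: "u \<in> {1..V}" "b \<in> {1..h}"
    have "cmod (interval_sum p k A - ?S u b) \<le> 2 * real (u * b)" by (rule interval_sum_shift)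
    also have "real (u * b) \<le> real (V * h)" using ub by (simp only: of_nat_le_iff) (intro mult_le_mono, auto)
    finally show "cmod (interval_sum p k A - ?S u b) \<le> 2 * real (V * h)" by simp
  qed
  also have "\<dots> = 2 * (real V * real h)\<^sup>2" by (simp add: power2_eq_square)
  also have "(\<Sum>u=1..V. \<Sum>b=1..h. ?S u b) = (\<Sum>u=1..V. \<Sum>a=1..A. \<Sum>b=1..h. dchar p k (int a + int (u * b)))"
    by (intro sum.cong refl sum.swap)
  also have "\<dots> = (\<Sum>a=1..A. \<Sum>u=1..V. \<Sum>b=1..h. dchar p k (int a + int (u * b)))" by (rule sum.swap)
  also have "cmod \<dots> \<le> (\<Sum>a=1..A. \<Sum>u=1..V. cmod (window_sum k h (quotient_mod a u)))"
    using V by (intro sum_norm_le norm_progression_sum_le) auto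
  also have "\<dots> = (\<Sum>x=0..<int p. quotient_count A V x * cmod (window_sum k h x))" by (rule sum_quotient_mod)
  finally show ?thesis by simp
qed

text \<open>Hoelder's inequality against the multiplicities of the residues \<open>a / u\<close>, and the \<open>2 r\<close>-th moment of the window
  sums.\<close>

lemma weighted_window_sums_le:
  assumes k: "0 < k" "k < p - 1" and A: "0 < A" "0 < V" "A * V < p" and h: "0 < h" "h < p" and r: "r > 0"
    and D: "\<And>m. 0 < m \<Longrightarrow> m \<le> A * V \<Longrightarrow> real (num_divisors m) \<le> D" and sqrt_p: "sqrt (real p) \<le> real h ^ r"
  shows "real (A * V) * (\<Sum>x=0..<int p. quotient_count A V x * cmod (window_sum k h x)) ^ (2 * r) \<le>
    (real (A * V) * real h) ^ (2 * r) * (D * (real (r ^ (2 * r)) + 2 * real r) * sqrt (real p))"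
proof -
  obtain a where a: "dchar p k a \<noteq> 0" "dchar p k a \<noteq> 1" using dchar_nontrivial[OF k] by blast
  define Q where "Q = real (A * V)"
  have D_pos: "0 \<le> D" using D[of 1] A by (simp add: Suc_leI)
  have "(\<Sum>x=0..<int p. cmod (window_sum k h x) ^ (2 * r)) \<le>
      real (r ^ (2 * r)) * real h ^ r * real p + real h ^ (2 * r) * (2 * real r * sqrt (real p))"
    unfolding window_sum_def by (rule short_sum_moment[OF prime_p dirichlet_char_dchar a h])
  also have "\<dots> \<le> real h ^ (2 * r) * ((real (r ^ (2 * r)) + 2 * real r) * sqrt (real p))"
  proof -
    have "real h ^ r * (sqrt (real p) * sqrt (real p)) \<le> real h ^ r * (real h ^ r * sqrt (real p))"
      using sqrt_p by (intro mult_left_mono mult_right_mono) auto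
    then have "real (r ^ (2 * r)) * (real h ^ r * real p) \<le> real (r ^ (2 * r)) * (real h ^ (2 * r) * sqrt (real p))"
      by (intro mult_left_mono) (auto simp: mult_2 power_add)
    then show ?thesis by (simp add: algebra_simps)
  qed
  finally have moment: "(\<Sum>x=0..<int p. cmod (window_sum k h x) ^ (2 * r)) \<le>
      real h ^ (2 * r) * ((real (r ^ (2 * r)) + 2 * real r) * sqrt (real p))" .
  have "(\<Sum>x=0..<int p. quotient_count A V x * cmod (window_sum k h x)) ^ (2 * r) \<le>
      (\<Sum>x=0..<int p. quotient_count A V x) ^ (2 * r - 2) * (\<Sum>x=0..<int p. (quotient_count A V x)\<^sup>2) *
      (\<Sum>x=0..<int p. cmod (window_sum k h x) ^ (2 * r))"
    by (rule weighted_power_sum_le) (auto simp: quotient_count_def r)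
  also have "\<dots> \<le> Q ^ (2 * r - 2) * (Q * D) * (real h ^ (2 * r) * ((real (r ^ (2 * r)) + 2 * real r) * sqrt (real p)))"
    unfolding sum_quotient_count Q_def using sum_square_quotient_count_le[OF A(3) A(1,2) D] D_pos
    by (intro mult_mono mult_left_mono moment mult_nonneg_nonneg sum_nonneg) auto
  finally have "Q * (\<Sum>x=0..<int p. quotient_count A V x * cmod (window_sum k h x)) ^ (2 * r) \<le>
      Q * (Q ^ (2 * r - 2) * (Q * D) * (real h ^ (2 * r) * ((real (r ^ (2 * r)) + 2 * real r) * sqrt (real p))))"
    by (rule mult_left_mono) (simp add: Q_def)
  also have "\<dots> = (Q ^ (2 * r - 2) * Q\<^sup>2) * (real h ^ (2 * r) * (D * (real (r ^ (2 * r)) + 2 * real r) * sqrt (real p)))"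
    by (simp add: power2_eq_square)
  also have "Q ^ (2 * r - 2) * Q\<^sup>2 = Q ^ (2 * r)"
  proof -
    have "2 * r - 2 + 2 = 2 * r" using r by simp
    then show ?thesis by (metis power_add)
  qed
  finally show ?thesis by (simp add: Q_def power_mult_distrib)
qed

lemma burgess_with_parameters:
  assumes k: "0 < k" "k < p - 1" and A: "0 < A" "0 < V" "A * V < p" and h: "0 < h" "h < p" and r: "r > 0"
    and D: "\<And>m. 0 < m \<Longrightarrow> m \<le> A * V \<Longrightarrow> real (num_divisors m) \<le> D" and sqrt_p: "sqrt (real p) \<le> real h ^ r"
    and \<tau>: "0 \<le> \<tau>" "D * (real (r ^ (2 * r)) + 2 * real r) * sqrt (real p) \<le> real (A * V) * \<tau> ^ (2 * r)"
  shows "cmod (interval_sum p k A) \<le> real A * \<tau> + 2 * (real V * real h)"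
proof -
  define Z where "Z = (\<Sum>x=0..<int p. quotient_count A V x * cmod (window_sum k h x))"
  have AV: "real (A * V) > 0" using A by simp
  have "real (A * V) * Z ^ (2 * r) \<le> (real (A * V) * real h) ^ (2 * r) * (real (A * V) * \<tau> ^ (2 * r))"
    using weighted_window_sums_le[OF k A h r D sqrt_p] mult_left_mono[OF \<tau>(2)]
    unfolding Z_def by (rule order_trans) auto
  then have "real (A * V) * Z ^ (2 * r) \<le> real (A * V) * (real (A * V) * real h * \<tau>) ^ (2 * r)"
    by (simp add: power_mult_distrib mult_ac)
  then have "Z ^ (2 * r) \<le> (real (A * V) * real h * \<tau>) ^ (2 * r)" using AV by (simp only: mult_le_cancel_left_pos)
  then have Z_le: "Z \<le> real (A * V) * real h * \<tau>"
    using r \<tau>(1) by (intro power_le_imp_le_base[of Z "2 * r - 1"]) (auto simp: Suc_diff_Suc)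
  have "1 * V \<le> A * V" using A by (intro mult_le_mono1) simp
  then have "V < p" using A(3) by linarith
  then have "real V * real h * cmod (interval_sum p k A) \<le> real (A * V) * real h * \<tau> + 2 * (real V * real h)\<^sup>2"
    using interval_sum_le_window_sums[of V h k A] Z_le unfolding Z_def by linarith
  then have "real V * real h * cmod (interval_sum p k A) \<le> real V * real h * (real A * \<tau> + 2 * (real V * real h))"
    by (simp add: power2_eq_square algebra_simps)
  then show ?thesis using A(2) h(1) by (simp add: mult_le_cancel_left_pos)
qed

end

lemma ex_nat_between_half:
  fixes x :: real
  assumes "1 \<le> x"
  shows "\<exists>n>0. x / 2 \<le> real n \<and> real n \<le> x"
proof -
  have "1 \<le> \<lfloor>x\<rfloor>" using assms by simp
  then have "x / 2 \<le> real (nat \<lfloor>x\<rfloor>)" by linarith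
  then show ?thesis using \<open>1 \<le> \<lfloor>x\<rfloor>\<close> by (intro exI[of _ "nat \<lfloor>x\<rfloor>"]) auto
qed

lemma ex_nat_between_double:
  fixes x :: real
  assumes "1 \<le> x"
  shows "\<exists>n>0. x \<le> real n \<and> real n \<le> 2 * x"
  using assms by (intro exI[of _ "nat \<lceil>x\<rceil>"]) linarith

lemma two_mult_powr_three_quarters_less:
  fixes x :: real
  assumes "x > 16"
  shows "2 * x powr (3 / 4) < x"
proof -
  have "(16 :: real) powr (1 / 4) = (2 powr 4) powr (1 / 4)" by simp
  also have "\<dots> = 2" unfolding powr_powr by simp
  finally have "2 < x powr (1 / 4)"
    using powr_less_mono2[of "1 / 4" 16 x] assms by simp
  then have "2 * x powr (3 / 4) < x powr (1 / 4) * x powr (3 / 4)" using assms by simp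
  also have "\<dots> = x" using assms by (simp flip: powr_add)
  finally show ?thesis .
qed

lemma powr_saving_le:
  fixes x c w \<epsilon> \<theta> :: real and r :: nat
  defines "\<theta> \<equiv> 1 / (2 * real r)"
  assumes "1 \<le> x" "1 \<le> c" "0 < r" "\<theta> \<le> \<epsilon> / 8" and w: "x powr (1 / 2 + 2 * \<epsilon> - 2 * \<theta>) / 2 \<le> w"
  shows "c * x powr (1 / 2 + \<epsilon> / 2) / 2 \<le> w * (c * x powr (- (\<epsilon> * \<theta>))) ^ (2 * r)"
proof -
  have "0 \<le> \<theta>" by (simp add: \<theta>_def)
  then have "c * x powr (1 / 2 + \<epsilon> / 2) / 2 \<le> c * x powr ((1 / 2 + 2 * \<epsilon> - 2 * \<theta>) + - \<epsilon>) / 2"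
    using assms(2-5) by (intro mult_left_mono divide_right_mono powr_mono) auto
  also have "\<dots> = (x powr (1 / 2 + 2 * \<epsilon> - 2 * \<theta>) / 2) * (c * x powr (- \<epsilon>))" by (simp only: powr_add) simp
  also have "\<dots> \<le> w * (c * x powr (- \<epsilon>))" using w assms(3) by (intro mult_right_mono) auto
  also have "\<dots> \<le> w * (c ^ (2 * r) * x powr (- \<epsilon>))"
  proof (intro mult_left_mono mult_right_mono)
    show "c \<le> c ^ (2 * r)" using power_increasing[of 1 "2 * r" c] assms(3,4) by simp
    show "0 \<le> w" using w by (rule order_trans[rotated]) simp
  qed simp
  also have "c ^ (2 * r) * x powr (- \<epsilon>) = (c * x powr (- (\<epsilon> * \<theta>))) ^ (2 * r)"
    using assms(2,4) by (simp add: power_mult_distrib \<theta>_def powr_powr flip: powr_realpow)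
  finally show ?thesis .
qed

lemma ex_burgess_window:
  fixes x \<epsilon> \<theta> :: real and A :: nat
  assumes x: "16 < x" and \<epsilon>: "0 < \<epsilon>" "\<epsilon> \<le> 1 / 8" and \<theta>: "0 < \<theta>" "\<theta> \<le> \<epsilon> / 8"
    and A: "x powr (1 / 4 + \<epsilon>) \<le> real A" "real A \<le> 2 * x powr (1 / 4 + \<epsilon>)"
  shows "\<exists>V h :: nat. 0 < V \<and> real (A * V) < x \<and> x powr (1 / 2 + 2 * \<epsilon> - 2 * \<theta>) / 2 \<le> real (A * V) \<and>
    0 < h \<and> real h < x \<and> x powr \<theta> \<le> real h \<and> real V * real h \<le> 2 * x powr (1 / 4 + \<epsilon> - \<theta>)"
proof -
  let ?\<alpha> = "1 / 4 + \<epsilon> - 2 * \<theta>"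
  have ge_1: "1 \<le> x powr a" if "0 \<le> a" for a using x that by (simp add: ge_one_powr_ge_zero)
  have small: "2 * x powr a < x" if "a \<le> 3 / 4" for a
    using two_mult_powr_three_quarters_less[OF x] powr_mono[OF that, of x] x by linarith
  have "0 \<le> ?\<alpha>" using \<epsilon> \<theta> by simp
  then obtain V :: nat where V: "0 < V" "x powr ?\<alpha> / 2 \<le> real V" "real V \<le> x powr ?\<alpha>"
    using ex_nat_between_half[OF ge_1] by blast
  obtain h :: nat where h: "0 < h" "x powr \<theta> \<le> real h" "real h \<le> 2 * x powr \<theta>"
    using ex_nat_between_double[OF ge_1[of \<theta>]] \<theta> by auto
  have "real h < x" using h(3) small[of \<theta>] \<epsilon> \<theta> by simp
  moreover have "x powr (1 / 2 + 2 * \<epsilon> - 2 * \<theta>) / 2 \<le> real (A * V)"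
    and AV_le: "real (A * V) \<le> 2 * x powr (1 / 2 + 2 * \<epsilon> - 2 * \<theta>)"
    using mult_mono[OF A(1) V(2)] mult_mono[OF A(2) V(3)] by (simp_all add: algebra_simps flip: powr_add)
  moreover have "real (A * V) < x" using AV_le small[of "1 / 2 + 2 * \<epsilon> - 2 * \<theta>"] \<epsilon> \<theta> by simp
  moreover have "real V * real h \<le> x powr ?\<alpha> * (2 * x powr \<theta>)" using V(3) h(3) by (intro mult_mono) auto
  moreover have "x powr ?\<alpha> * (2 * x powr \<theta>) = 2 * (x powr ?\<alpha> * x powr \<theta>)" by simp
  moreover have "x powr ?\<alpha> * x powr \<theta> = x powr (1 / 4 + \<epsilon> - \<theta>)" by (simp flip: powr_add)
  ultimately show ?thesis using V(1) h(1,2) by (intro exI[of _ V] exI[of _ h]) simp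
qed

lemma (in prime_mod) burgess_large_prime:
  fixes \<epsilon> \<theta> Cd :: real and A r :: nat
  defines "\<theta> \<equiv> 1 / (2 * real r)" and "c \<equiv> 2 * Cd * (real (r ^ (2 * r)) + 2 * real r)"
  assumes \<epsilon>: "0 < \<epsilon>" "\<epsilon> \<le> 1 / 8" and r: "r > 0" "\<theta> \<le> \<epsilon> / 8"
    and Cd: "Cd \<ge> 1" "\<And>n. n > 0 \<Longrightarrow> real (num_divisors n) \<le> Cd * real n powr (\<epsilon> / 2)"
    and k: "0 < k" "k < p - 1" and p: "p > 16"
    and A: "real p powr (1 / 4 + \<epsilon>) \<le> real A" "real A \<le> 2 * real p powr (1 / 4 + \<epsilon>)"
  shows "cmod (interval_sum p k A) \<le> (c + 4) * real A * real p powr (- (\<epsilon> * \<theta>))"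
proof -
  let ?p = "real p"
  have p_pos: "?p \<ge> 1" "?p > 0" using p by simp_all
  have \<theta>: "\<theta> > 0" using r(1) by (simp add: \<theta>_def)
  have "1 * 1 \<le> Cd * (2 * real r)" using Cd(1) r(1) by (intro mult_mono) auto
  also have "\<dots> \<le> c" using Cd(1) by (simp add: c_def algebra_simps)
  finally have c: "c \<ge> 1" by simp
  obtain V h :: nat where V: "0 < V" "real (A * V) < ?p" "?p powr (1 / 2 + 2 * \<epsilon> - 2 * \<theta>) / 2 \<le> real (A * V)"
    and h: "0 < h" "real h < ?p" "?p powr \<theta> \<le> real h" and Vh: "real V * real h \<le> 2 * ?p powr (1 / 4 + \<epsilon> - \<theta>)"
    using ex_burgess_window[OF _ \<epsilon> \<theta> r(2) A] p by auto
  have AV: "A * V < p" and h_less: "h < p" using V(2) h(2) by (simp_all only: of_nat_less_iff)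
  have A_pos: "0 < A" using A(1) p_pos by (cases A) auto
  have divisors: "real (num_divisors m) \<le> Cd * ?p powr (\<epsilon> / 2)" if "0 < m" "m \<le> A * V" for m
  proof -
    have "real m powr (\<epsilon> / 2) \<le> ?p powr (\<epsilon> / 2)" using that AV \<epsilon> by (intro powr_mono2) auto
    then show ?thesis using Cd(2)[OF that(1)] Cd(1) by (meson mult_left_mono order_trans zero_le_one)
  qed
  have "sqrt ?p = (?p powr \<theta>) ^ r"
    using p_pos r(1) by (simp add: \<theta>_def powr_powr powr_half_sqrt flip: powr_realpow)
  also have "\<dots> \<le> real h ^ r" using h(3) by (intro power_mono) auto
  finally have sqrt_p: "sqrt ?p \<le> real h ^ r" .
  have "Cd * ?p powr (\<epsilon> / 2) * (real (r ^ (2 * r)) + 2 * real r) * sqrt ?p = c * ?p powr (1 / 2 + \<epsilon> / 2) / 2"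
    using p_pos by (simp add: c_def powr_half_sqrt[symmetric] powr_add)
  also have "\<dots> \<le> real (A * V) * (c * ?p powr (- (\<epsilon> * \<theta>))) ^ (2 * r)"
    using p_pos(1) c r V(3) unfolding \<theta>_def by (rule powr_saving_le)
  finally have "cmod (interval_sum p k A) \<le> real A * (c * ?p powr (- (\<epsilon> * \<theta>))) + 2 * (real V * real h)"
    using c by (intro burgess_with_parameters[OF k A_pos V(1) AV h(1) h_less r(1) divisors sqrt_p]) auto
  also have "real V * real h \<le> 2 * (?p powr (1 / 4 + \<epsilon>) * ?p powr (- \<theta>))" using Vh by (simp flip: powr_add)
  also have "\<dots> \<le> 2 * (real A * ?p powr (- (\<epsilon> * \<theta>)))"
    using A(1) \<epsilon> \<theta> p_pos by (intro mult_left_mono mult_mono powr_mono) auto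
  finally show ?thesis by (simp add: algebra_simps)
qed

theorem burgess_bound:
  fixes \<epsilon> :: real
  assumes \<epsilon>: "0 < \<epsilon>" "\<epsilon> \<le> 1 / 8"
  shows "\<exists>\<delta>>0. \<exists>C>0. \<forall>p k A. prime p \<longrightarrow> 0 < k \<longrightarrow> k < p - 1 \<longrightarrow> real p powr (1 / 4 + \<epsilon>) \<le> real A \<longrightarrow>
    real A \<le> 2 * real p powr (1 / 4 + \<epsilon>) \<longrightarrow> cmod (interval_sum p k A) \<le> C * real A * real p powr (- \<delta>)"
proof -
  define r where "r = nat \<lceil>4 / \<epsilon>\<rceil>"
  define \<theta> where "\<theta> = 1 / (2 * real r)"
  have r_ge: "4 / \<epsilon> \<le> real r" unfolding r_def by linarith
  then have r: "r > 0" using \<epsilon> by (metis divide_pos_pos less_le_trans of_nat_0_less_iff zero_less_numeral)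
  have "4 \<le> \<epsilon> * real r" using r_ge \<epsilon> by (simp add: field_simps)
  then have \<theta>: "0 < \<theta>" "\<theta> \<le> \<epsilon> / 8" using r by (simp_all add: \<theta>_def field_simps)
  obtain Cd where Cd: "Cd \<ge> 1" "\<And>n. n > 0 \<Longrightarrow> real (num_divisors n) \<le> Cd * real n powr (\<epsilon> / 2)"
    using divisor_bound[of "\<epsilon> / 2"] \<epsilon> by auto
  define c where "c = 2 * Cd * (real (r ^ (2 * r)) + 2 * real r)"
  have c: "c \<ge> 0" using Cd(1) by (simp add: c_def)
  show ?thesis
  proof (rule exI[of _ "\<epsilon> * \<theta>"], rule conjI, use \<epsilon> \<theta> in simp, rule exI[of _ "c + 16"], intro conjI allI impI)
    show "c + 16 > 0" using c by simp
    fix p k A :: nat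
    assume p: "prime p" and k: "0 < k" "k < p - 1"
      and A: "real p powr (1 / 4 + \<epsilon>) \<le> real A" "real A \<le> 2 * real p powr (1 / 4 + \<epsilon>)"
    interpret prime_mod p by unfold_locales (rule p)
    let ?saving = "real p powr (- (\<epsilon> * \<theta>))"
    show "cmod (interval_sum p k A) \<le> (c + 16) * real A * ?saving"
    proof (cases "p > 16")
      case True
      have "cmod (interval_sum p k A) \<le> (c + 4) * real A * ?saving"
        unfolding c_def \<theta>_def
        using \<theta>(2) by (intro burgess_large_prime[OF \<epsilon> r _ Cd k True A]) (simp_all add: \<theta>_def)
      also have "\<dots> \<le> (c + 16) * real A * ?saving" by (intro mult_right_mono) auto
      finally show ?thesis .
    next
      case False
      have "\<epsilon> * \<theta> \<le> 1 * 1" using \<epsilon> \<theta> by (intro mult_mono) auto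
      then have "real p powr (\<epsilon> * \<theta>) \<le> real p powr 1" using p_ge_2 by (intro powr_mono) auto
      also have "\<dots> \<le> c + 16" using False c p_ge_2 by simp
      finally have "1 \<le> (c + 16) * ?saving" using p_ge_2 by (simp add: powr_minus field_simps)
      then have "real A * 1 \<le> real A * ((c + 16) * ?saving)" by (intro mult_left_mono) auto
      then show ?thesis using norm_interval_sum_le[of k A] by (simp add: mult_ac)
    qed
  qed
qed

section \<open>Boxes of natural numbers\<close>

definition nat_box :: "nat list \<Rightarrow> nat list set" where
  "nat_box v = {d. list_all2 (\<lambda>x D. x \<in> {1..D}) d v}"

definition factorizations :: "nat list \<Rightarrow> nat \<Rightarrow> nat list set" where
  "factorizations v x = {d \<in> nat_box v. prod_list d = x}"

lemma nat_box_Nil [simp]: "nat_box [] = {[]}"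
  by (auto simp: nat_box_def)

lemma nat_box_Cons: "nat_box (D # v) = (\<lambda>(x, d). x # d) ` ({1..D} \<times> nat_box v)"
  by (auto simp: nat_box_def list_all2_Cons2 image_iff)

lemma finite_nat_box [simp]: "finite (nat_box v)"
  by (induction v) (auto simp: nat_box_Cons)

lemma length_nat_box: "d \<in> nat_box v \<Longrightarrow> length d = length v"
  by (auto simp: nat_box_def dest: list_all2_lengthD)

lemma set_nat_box_subset:
  assumes "d \<in> nat_box v" "set v \<subseteq> {1..A}"
  shows "set d \<subseteq> {1..A}"
  using assms
proof (induction v arbitrary: d)
  case (Cons D v)
  then show ?case by (fastforce simp: nat_box_Cons)
qed simp

lemma prod_list_nat_box: "d \<in> nat_box v \<Longrightarrow> prod_list d \<in> {1..prod_list v}"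
proof (induction v arbitrary: d)
  case (Cons D v)
  then obtain x e where d: "d = x # e" "x \<in> {1..D}" "e \<in> nat_box v" by (auto simp: nat_box_Cons)
  then show ?case using Cons.IH[of e] mult_le_mono[of 1 x 1 "prod_list e"] by (auto intro: mult_le_mono)
qed auto

lemma inj_on_Cons_pair: "inj_on (\<lambda>(x, d). x # d) A"
  by (auto simp: inj_on_def)

lemma sum_nat_box_Cons: "(\<Sum>d\<in>nat_box (D # v). f d) = (\<Sum>x=1..D. \<Sum>d\<in>nat_box v. f (x # d))"
  unfolding nat_box_Cons sum.reindex[OF inj_on_Cons_pair] sum.cartesian_product by (simp add: split_def)

lemma card_nat_box: "card (nat_box v) = prod_list v"
  by (induction v) (simp_all add: nat_box_Cons card_image[OF inj_on_Cons_pair] card_cartesian_product)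

lemma card_factorizations_le:
  assumes "x > 0"
  shows "card (factorizations v x) \<le> num_divisors x ^ length v"
proof -
  have "factorizations v x \<subseteq> {d. set d \<subseteq> {d. d dvd x} \<and> length d = length v}"
    using length_nat_box by (auto simp: factorizations_def intro: prod_list_dvd)
  then have "card (factorizations v x) \<le> card {d. set d \<subseteq> {d. d dvd x} \<and> length d = length v}"
    using assms by (intro card_mono finite_lists_length_eq) auto
  also have "\<dots> = num_divisors x ^ length v"
    unfolding num_divisors_def using assms by (intro card_lists_length_eq) auto
  finally show ?thesis .
qed

lemma dvd_prod_list_factor:
  "x dvd prod_list d \<Longrightarrow> \<exists>f. list_all2 (dvd) f d \<and> prod_list f = x" for x :: nat
proof (induction d arbitrary: x)
  case Nil
  then show ?case by (intro exI[of _ "[]"]) auto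
next
  case (Cons y d)
  then have "x dvd y * prod_list d" by simp
  then obtain a b where ab: "x = a * b" "a dvd y" "b dvd prod_list d" by (rule division_decomp[THEN exE]) blast
  obtain f where "list_all2 (dvd) f d" "prod_list f = b" using Cons.IH[OF ab(3)] by auto
  then show ?case using ab by (intro exI[of _ "a # f"]) auto
qed

lemma list_all2_dvd_set_subset:
  assumes "list_all2 (dvd) f d" "set d \<subseteq> {1..A}"
  shows "set f \<subseteq> {1..A :: nat}"
  using assms
proof (induction rule: list_all2_induct)
  case (Cons x f y d)
  then have "x \<noteq> 0" "x \<le> y" "y \<le> A" by (auto dest: dvd_imp_le)
  then show ?case using Cons by auto
qed simp

definition dyadic_sizes :: "nat \<Rightarrow> nat \<Rightarrow> nat set" where
  "dyadic_sizes A L = (\<lambda>i. min (2 ^ i) A) ` {..L}"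

definition dyadic_boxes :: "nat \<Rightarrow> nat \<Rightarrow> nat \<Rightarrow> nat \<Rightarrow> nat list set" where
  "dyadic_boxes A L l B = {F. set F \<subseteq> dyadic_sizes A L \<and> length F = l \<and> prod_list F \<le> B}"

lemma dyadic_boxes_subset: "dyadic_boxes A L l B \<subseteq> {F. set F \<subseteq> dyadic_sizes A L \<and> length F = l}"
  by (auto simp: dyadic_boxes_def)

lemma finite_dyadic_boxes: "finite (dyadic_boxes A L l B)"
  using dyadic_boxes_subset by (rule finite_subset) (auto simp: dyadic_sizes_def intro: finite_lists_length_eq)

lemma card_dyadic_boxes_le: "card (dyadic_boxes A L l B) \<le> (L + 1) ^ l"
proof -
  have "card (dyadic_boxes A L l B) \<le> card {F. set F \<subseteq> dyadic_sizes A L \<and> length F = l}"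
    by (intro card_mono dyadic_boxes_subset finite_lists_length_eq) (simp add: dyadic_sizes_def)
  also have "\<dots> = card (dyadic_sizes A L) ^ l" by (intro card_lists_length_eq) (simp add: dyadic_sizes_def)
  also have "\<dots> \<le> (L + 1) ^ l"
    using card_image_le[of "{..L}" "\<lambda>i. min (2 ^ i) A"] by (intro power_mono) (auto simp: dyadic_sizes_def)
  finally show ?thesis .
qed

lemma dyadic_sizes_subset: "1 \<le> A \<Longrightarrow> dyadic_sizes A L \<subseteq> {1..A}"
  by (auto simp: dyadic_sizes_def)

lemma ex_dyadic_size:
  assumes "x \<in> {1..A}" "A \<le> 2 ^ L"
  shows "\<exists>b\<in>dyadic_sizes A L. x \<le> b \<and> b \<le> 2 * x"
proof -
  define i where "i = (LEAST i. x \<le> 2 ^ i)"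
  have L: "x \<le> 2 ^ L" using assms by simp
  have "x \<le> 2 ^ i" "i \<le> L" unfolding i_def using L by (rule LeastI, intro Least_le)
  moreover have "2 ^ i \<le> 2 * x"
  proof (cases i)
    case (Suc j)
    then have "\<not> x \<le> 2 ^ j" using not_less_Least[of j "\<lambda>i. x \<le> 2 ^ i"] by (simp add: i_def)
    then show ?thesis using Suc by simp
  qed (use assms in simp)
  ultimately show ?thesis using assms by (intro bexI[of _ "min (2 ^ i) A"]) (auto simp: dyadic_sizes_def)
qed

lemma ex_dyadic_box:
  assumes "set f \<subseteq> {1..A}" "A \<le> 2 ^ L"
  shows "\<exists>F. set F \<subseteq> dyadic_sizes A L \<and> length F = length f \<and> f \<in> nat_box F \<and>
    prod_list F \<le> 2 ^ length f * prod_list f"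
  using assms(1)
proof (induction f)
  case Nil
  then show ?case by (intro exI[of _ "[]"]) auto
next
  case (Cons x f)
  then obtain F where F: "length F = length f" "set F \<subseteq> dyadic_sizes A L" "f \<in> nat_box F"
    "prod_list F \<le> 2 ^ length f * prod_list f" by auto
  obtain b where b: "b \<in> dyadic_sizes A L" "x \<le> b" "b \<le> 2 * x"
    using ex_dyadic_size[OF _ assms(2), of x] Cons.prems by auto
  have "b * prod_list F \<le> (2 * x) * (2 ^ length f * prod_list f)" using b F by (intro mult_le_mono) auto
  then have "prod_list (b # F) \<le> 2 ^ length (x # f) * prod_list (x # f)" by (simp add: mult_ac)
  moreover have "x # f \<in> nat_box (b # F)" using F(3) b Cons.prems by (auto simp: nat_box_Cons)
  ultimately show ?case using F b by (intro exI[of _ "b # F"]) auto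
qed

lemma ex_dyadic_box_divisor:
  assumes d: "d \<in> nat_box v" "set v \<subseteq> {1..A}" and A: "A \<le> 2 ^ L" and a: "a dvd prod_list d" "2 ^ length v * a \<le> B"
  shows "\<exists>F\<in>dyadic_boxes A L (length v) B. \<exists>f\<in>nat_box F. prod_list f = a \<and> prod_list F \<le> 2 ^ length v * a"
proof -
  obtain f where f: "list_all2 (dvd) f d" "prod_list f = a" using dvd_prod_list_factor[OF a(1)] by blast
  have "length f = length v" using f(1) length_nat_box[OF d(1)] list_all2_lengthD by fastforce
  moreover have "set f \<subseteq> {1..A}" using list_all2_dvd_set_subset[OF f(1) set_nat_box_subset[OF d]] .
  ultimately obtain F where "set F \<subseteq> dyadic_sizes A L" "length F = length v" "f \<in> nat_box F"
    "prod_list F \<le> 2 ^ length v * a"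
    using ex_dyadic_box[OF _ A, of f] f(2) by auto
  then show ?thesis using f(2) a(2) by (intro bexI[of _ F] bexI[of _ f]) (auto simp: dyadic_boxes_def)
qed

section \<open>Small solutions of a homogeneous linear congruence\<close>

locale congruence_lattice = prime_mod +
  fixes g g' :: int
  assumes not_dvd: "\<not> int p dvd g" "\<not> int p dvd g'"
begin

definition lattice_points :: "(int \<times> int) set" where
  "lattice_points = {(x, y). [g * x = g' * y] (mod int p)}"

definition max_norm :: "int \<times> int \<Rightarrow> int" where
  "max_norm z = max \<bar>fst z\<bar> \<bar>snd z\<bar>"

lemma not_dvd_of_abs_less: "x \<noteq> 0 \<Longrightarrow> \<bar>x\<bar> < int p \<Longrightarrow> \<not> int p dvd x"
  using zdvd_not_zless[of "\<bar>x\<bar>" "int p"] by simp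

lemma cancel_left: "int p dvd g * x \<Longrightarrow> int p dvd x" "int p dvd g' * x \<Longrightarrow> int p dvd x"
  using not_dvd prime_int_p by (simp_all add: prime_dvd_mult_iff)

lemma lattice_diff:
  assumes "[g * x - g' * y = g * x' - g' * y'] (mod int p)"
  shows "(x - x', y - y') \<in> lattice_points"
  using assms by (simp add: lattice_points_def cong_iff_dvd_diff algebra_simps)

lemma coordinates_nonzero:
  assumes "(x, y) \<in> lattice_points" "(x, y) \<noteq> (0, 0)" "max_norm (x, y) < int p"
  shows "x \<noteq> 0 \<and> y \<noteq> 0"
proof -
  have dvd: "int p dvd g * x - g' * y" using assms(1) by (simp add: lattice_points_def cong_iff_dvd_diff)
  have "int p dvd y" if "x = 0" using dvd that cancel_left(2)[of y] by simp
  moreover have "int p dvd x" if "y = 0" using dvd that cancel_left(1)[of x] by simp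
  moreover have "\<bar>x\<bar> < int p" "\<bar>y\<bar> < int p" using assms(3) by (simp_all add: max_norm_def)
  ultimately show ?thesis using assms(2) not_dvd_of_abs_less[of x] not_dvd_of_abs_less[of y] by auto
qed

lemma lattice_Pair_divide:
  assumes "(c * x, c * y) \<in> lattice_points" "\<not> int p dvd c"
  shows "(x, y) \<in> lattice_points"
proof -
  have "int p dvd c * (g * x - g' * y)" using assms(1) by (simp add: lattice_points_def cong_iff_dvd_diff algebra_simps)
  then show ?thesis using assms(2) prime_int_p by (simp add: prime_dvd_mult_iff lattice_points_def cong_iff_dvd_diff)
qed

lemma det_dvd:
  assumes "(x, y) \<in> lattice_points" "(a, b) \<in> lattice_points"
  shows "int p dvd x * b - y * a"
proof -
  have "int p dvd b * (g * x - g' * y) - y * (g * a - g' * b)"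
    by (rule dvd_diff[OF dvd_mult dvd_mult]) (use assms in \<open>simp_all add: lattice_points_def cong_iff_dvd_diff\<close>)
  also have "b * (g * x - g' * y) - y * (g * a - g' * b) = g * (x * b - y * a)" by (simp add: algebra_simps)
  finally show ?thesis by (rule cancel_left)
qed

lemma ex_short_vector: "\<exists>z\<in>lattice_points. z \<noteq> (0, 0) \<and> (max_norm z)\<^sup>2 \<le> int p"
proof -
  define n where "n = nat \<lfloor>sqrt (real p)\<rfloor>"
  have n: "real n \<le> sqrt (real p)" "sqrt (real p) < real n + 1" unfolding n_def by simp_all
  have "real (n\<^sup>2) \<le> real p" using n(1) power_mono[of "real n" "sqrt (real p)" 2] by simp
  then have n_le: "n\<^sup>2 \<le> p" by (simp only: of_nat_le_iff)
  have "real p < real ((n + 1)\<^sup>2)" using n(2) power_strict_mono[of "sqrt (real p)" "real n + 1" 2] by (simp add: add.commute)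
  then have less_n: "p < (n + 1)\<^sup>2" by (simp only: of_nat_less_iff)
  define B where "B = {0..int n} \<times> {0..int n}"
  define f where "f = (\<lambda>(x, y). (g * x - g' * y) mod int p)"
  have "f ` B \<subseteq> {0..<int p}" using p_ge_2 by (auto simp: f_def)
  then have "card (f ` B) \<le> p" using card_mono[of "{0..<int p}" "f ` B"] by simp
  also have "\<dots> < card B" using less_n by (simp add: B_def power2_eq_square nat_add_distrib)
  finally have "\<not> inj_on f B" using card_image[of f B] by auto
  then obtain x y x' y' where xy: "(x, y) \<in> B" "(x', y') \<in> B" "f (x, y) = f (x', y')" "(x, y) \<noteq> (x', y')"
    by (auto simp: inj_on_def)
  have "(x - x', y - y') \<in> lattice_points"
    using xy(3) by (intro lattice_diff) (simp add: f_def unique_euclidean_semiring_class.cong_def)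
  moreover have "(max_norm (x - x', y - y'))\<^sup>2 \<le> (int n)\<^sup>2"
    using xy(1,2) by (intro power_mono) (auto simp: B_def max_norm_def)
  then have "(max_norm (x - x', y - y'))\<^sup>2 \<le> int p" using n_le by (simp flip: of_nat_power)
  ultimately show ?thesis using xy(4) by (intro bexI[of _ "(x - x', y - y')"]) auto
qed

definition solutions :: "nat \<Rightarrow> (nat \<times> nat) set" where
  "solutions K = {(x, y) \<in> {1..K} \<times> {1..K}. (int x, int y) \<in> lattice_points}"

lemma finite_solutions [simp]: "finite (solutions K)"
  by (rule finite_subset[of _ "{1..K} \<times> {1..K}"]) (auto simp: solutions_def)

end

locale minimal_lattice_vector = congruence_lattice +
  fixes a b :: int
  assumes in_lattice: "(a, b) \<in> lattice_points" and nonzero: "(a, b) \<noteq> (0, 0)"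
    and minimal: "z \<in> lattice_points \<Longrightarrow> z \<noteq> (0, 0) \<Longrightarrow> max_norm (a, b) \<le> max_norm z"
begin

definition M :: nat where "M = nat (max_norm (a, b))"

lemma max_norm_eq: "max \<bar>a\<bar> \<bar>b\<bar> = int M"
  by (simp add: M_def max_norm_def)

lemma M_pos: "0 < M"
  using nonzero max_norm_eq by (auto simp: max_def split: if_splits)

lemma M_square_le: "M\<^sup>2 \<le> p"
proof -
  obtain z where z: "z \<in> lattice_points" "z \<noteq> (0, 0)" "(max_norm z)\<^sup>2 \<le> int p" using ex_short_vector by blast
  have "(int M)\<^sup>2 \<le> (max_norm z)\<^sup>2"
    using minimal[OF z(1,2)] by (intro power_mono) (auto simp: max_norm_def max_norm_eq)
  then have "int (M\<^sup>2) \<le> int p" unfolding of_nat_power using z(3) by (rule order_trans)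
  then show ?thesis by (simp only: of_nat_le_iff)
qed

lemma M_less: "M < p"
proof -
  have "M \<le> M\<^sup>2" by (simp add: power2_eq_square)
  moreover have "M \<noteq> p" using M_square_le p_ge_2 by (auto simp: power2_eq_square)
  ultimately show ?thesis using M_square_le by linarith
qed

lemma nonzero_a: "a \<noteq> 0" and nonzero_b: "b \<noteq> 0"
  using coordinates_nonzero[OF in_lattice nonzero] M_less by (simp_all add: max_norm_def max_norm_eq)

lemma coprime: "coprime a b"
proof -
  define c where "c = gcd a b"
  have c: "c > 0" using nonzero_a by (simp add: c_def)
  obtain x y where xy: "a = c * x" "b = c * y" unfolding c_def by (metis dvdE gcd_dvd1 gcd_dvd2)
  have "c \<le> \<bar>a\<bar>" using nonzero_a unfolding c_def by (intro zdvd_imp_le) auto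
  then have "c < int p" using max_norm_eq M_less by simp
  then have "(x, y) \<in> lattice_points"
    using lattice_Pair_divide[of c x y] in_lattice c by (simp add: not_dvd_of_abs_less flip: xy)
  moreover have "(x, y) \<noteq> (0, 0)" using nonzero xy by auto
  ultimately have norm_le: "max_norm (a, b) \<le> max_norm (x, y)" by (rule minimal)
  have norm_eq: "max_norm (a, b) = c * max_norm (x, y)"
    using c by (simp add: max_norm_def xy abs_mult max_mult_distrib_left)
  have "0 < max_norm (x, y)" using M_pos norm_le by (simp add: M_def)
  moreover have "c * max_norm (x, y) \<le> 1 * max_norm (x, y)" using norm_le norm_eq by simp
  ultimately have "c \<le> 1" by (simp only: mult_le_cancel_right_pos)
  then have "c = 1" using c by simp
  then show ?thesis by (simp add: c_def coprime_iff_gcd_eq_1)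
qed

lemma det_abs_le:
  assumes "(x, y) \<in> solutions K"
  shows "\<bar>int x * b - int y * a\<bar> \<le> 2 * int K * int M"
proof -
  have "\<bar>int x * b - int y * a\<bar> \<le> \<bar>int x\<bar> * \<bar>b\<bar> + \<bar>int y\<bar> * \<bar>a\<bar>" by (metis abs_mult abs_triangle_ineq4)
  also have "\<dots> \<le> int K * int M + int K * int M"
    using assms max_norm_eq by (intro add_mono mult_mono) (auto simp: solutions_def)
  finally show ?thesis by simp
qed

lemma multiple_if_det_eq_0:
  assumes "x * b = y * a"
  obtains t where "x = t * a" "y = t * b"
proof -
  have "a dvd x * b" using assms by simp
  then have "a dvd x" using coprime by (simp add: coprime_dvd_mult_left_iff)
  then obtain t where "x = t * a" by (metis dvdE mult.commute)
  then show ?thesis using that assms nonzero_a by simp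
qed

lemma solution_multiple:
  assumes "2 * K * M < p" and xy: "(x, y) \<in> solutions K"
  obtains t where "int x = t * a" "int y = t * b"
proof -
  have "2 * int K * int M < int p" using assms(1) by (metis of_nat_less_iff of_nat_mult of_nat_numeral)
  then have "\<bar>int x * b - int y * a\<bar> < int p" using det_abs_le[OF xy] by linarith
  moreover have "int p dvd int x * b - int y * a" using xy in_lattice by (auto simp: solutions_def intro: det_dvd)
  ultimately have "int x * b = int y * a" using not_dvd_of_abs_less[of "int x * b - int y * a"] by auto
  then show ?thesis using that by (rule multiple_if_det_eq_0)
qed

lemma card_solutions_mult_M_le:
  assumes "2 * K * M < p"
  shows "card (solutions K) * M \<le> K"
proof -
  have multiple: "\<exists>s\<in>{1..K div M}. x = s * nat \<bar>a\<bar> \<and> y = s * nat \<bar>b\<bar>" if xy: "(x, y) \<in> solutions K" for x y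
  proof -
    obtain t where t: "int x = t * a" "int y = t * b" using solution_multiple[OF assms xy] .
    have x: "x = nat \<bar>t\<bar> * nat \<bar>a\<bar>" using arg_cong[OF t(1), of "\<lambda>i. nat \<bar>i\<bar>"] by (simp add: nat_abs_mult_distrib)
    have y: "y = nat \<bar>t\<bar> * nat \<bar>b\<bar>" using arg_cong[OF t(2), of "\<lambda>i. nat \<bar>i\<bar>"] by (simp add: nat_abs_mult_distrib)
    have "max (nat \<bar>a\<bar>) (nat \<bar>b\<bar>) = M" using max_norm_eq by linarith
    moreover have bounds: "0 < x" "x \<le> K" "y \<le> K" using xy by (simp_all add: solutions_def)
    ultimately have "nat \<bar>t\<bar> * M \<le> K" using x y by (metis max_def)
    then have "nat \<bar>t\<bar> \<in> {1..K div M}" using bounds(1) x M_pos by (auto simp: less_eq_div_iff_mult_less_eq)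
    then show ?thesis using x y by blast
  qed
  have "solutions K \<subseteq> (\<lambda>s. (s * nat \<bar>a\<bar>, s * nat \<bar>b\<bar>)) ` {1..K div M}"
    using multiple by (auto simp: image_iff)
  then have "card (solutions K) \<le> K div M" using surj_card_le[of "{1..K div M}"] by simp
  then have "card (solutions K) * M \<le> K div M * M" by simp
  also have "\<dots> \<le> K" by (rule div_times_less_eq_dividend)
  finally show ?thesis .
qed

lemma abs_minimal_in_lattice:
  assumes "2 * K * M < p" "solutions K \<noteq> {}"
  shows "(\<bar>a\<bar>, \<bar>b\<bar>) \<in> lattice_points"
proof -
  obtain x y where xy: "(x, y) \<in> solutions K" using assms(2) by auto
  obtain t where t: "int x = t * a" "int y = t * b" using solution_multiple[OF assms(1) xy] .
  have "0 < t * a" "0 < t * b" using xy unfolding t[symmetric] by (auto simp: solutions_def)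
  then have "(\<bar>a\<bar>, \<bar>b\<bar>) = (a, b) \<or> (\<bar>a\<bar>, \<bar>b\<bar>) = (0 - a, 0 - b)" by (auto simp: zero_less_mult_iff)
  moreover have "(0 - a, 0 - b) \<in> lattice_points"
    using in_lattice by (intro lattice_diff) (simp add: lattice_points_def cong_iff_dvd_diff dvd_diff_commute)
  ultimately show ?thesis using in_lattice by metis
qed

text \<open>If \<open>(a, b)\<close> is not that short, then a solution is determined by the multiple of \<open>p\<close> that is its determinant with
  \<open>(a, b)\<close> and by its position along \<open>(a, b)\<close>, measured in a coordinate in which \<open>(a, b)\<close> is longest.\<close>

definition long_coordinate :: "nat \<times> nat \<Rightarrow> nat" where
  "long_coordinate z = (if \<bar>a\<bar> = int M then fst z else snd z)"

lemma eq_if_same_line_and_position: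
  assumes "int x * b - int y * a = int x' * b - int y' * a"
    and "long_coordinate (x, y) div M = long_coordinate (x', y') div M"
  shows "(x, y) = (x', y')"
proof -
  have "(int x - int x') * b = (int y - int y') * a" using assms(1) by (simp add: algebra_simps)
  then obtain t where t: "int x - int x' = t * a" "int y - int y' = t * b" by (rule multiple_if_det_eq_0)
  have "\<bar>int c - int c'\<bar> < int M" if "c div M = c' div M" for c c' :: nat
  proof -
    have "int c - int c' = int (c mod M) - int (c' mod M)"
      using that by (metis add_diff_cancel_left mult_div_mod_eq of_nat_add)
    moreover have "int (c mod M) < int M" "int (c' mod M) < int M" using M_pos by simp_all
    ultimately show ?thesis by linarith
  qed
  then have "\<bar>int (long_coordinate (x, y)) - int (long_coordinate (x', y'))\<bar> < int M" using assms(2) .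
  moreover have "\<bar>int (long_coordinate (x, y)) - int (long_coordinate (x', y'))\<bar> = \<bar>t\<bar> * int M"
    using t max_norm_eq by (auto simp: long_coordinate_def abs_mult max_def split: if_splits)
  ultimately have "t = 0" using M_pos by (simp add: mult_less_cancel_right1)
  then show ?thesis using t by simp
qed

lemma card_solutions_le_lines_mult_positions:
  "card (solutions K) \<le> nat (2 * (2 * int K * int M div int p) + 1) * (K div M + 1)"
proof -
  define q where "q z = (int (fst z) * b - int (snd z) * a) div int p" for z :: "nat \<times> nat"
  define T where "T = 2 * int K * int M div int p"
  have det: "int x * b - int y * a = int p * q (x, y)" if "(x, y) \<in> solutions K" for x y
  proof -
    have "int p dvd int x * b - int y * a" using that in_lattice by (auto simp: solutions_def intro: det_dvd)
    then show ?thesis by (simp add: q_def)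
  qed
  have p_pos: "0 < int p" using p_ge_2 by simp
  have "card (solutions K) \<le> card ({- T..T} \<times> {0..K div M})"
  proof (rule card_inj_on_le[where f = "\<lambda>z. (q z, long_coordinate z div M)"])
    show "inj_on (\<lambda>z. (q z, long_coordinate z div M)) (solutions K)"
    proof (rule inj_onI)
      fix z z' assume "z \<in> solutions K" "z' \<in> solutions K"
        "(q z, long_coordinate z div M) = (q z', long_coordinate z' div M)"
      then show "z = z'"
        using det eq_if_same_line_and_position[of "fst z" "snd z" "fst z'" "snd z'"] by (cases z, cases z') auto
    qed
    have q_le: "\<bar>q (x, y)\<bar> \<le> T" if "(x, y) \<in> solutions K" for x y
    proof -
      have "\<bar>q (x, y)\<bar> * int p \<le> 2 * int K * int M"
        using det_abs_le[OF that] unfolding det[OF that] by (simp add: abs_mult mult.commute)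
      then show ?thesis unfolding T_def using zdiv_mono1[of "\<bar>q (x, y)\<bar> * int p" _ "int p"] p_pos by simp
    qed
    show "(\<lambda>z. (q z, long_coordinate z div M)) ` solutions K \<subseteq> {- T..T} \<times> {0..K div M}"
    proof (intro image_subsetI)
      fix z assume z: "z \<in> solutions K"
      then have "long_coordinate z div M \<le> K div M"
        by (intro div_le_mono) (auto simp: long_coordinate_def solutions_def)
      then show "(q z, long_coordinate z div M) \<in> {- T..T} \<times> {0..K div M}"
        using q_le[of "fst z" "snd z"] z by simp linarith
    qed
  qed auto
  also have "\<dots> = nat (2 * T + 1) * (K div M + 1)"
    using p_pos by (simp add: card_cartesian_product T_def pos_imp_zdiv_nonneg_iff)
  finally show ?thesis by (simp only: T_def)
qed

lemma real_card_solutions_le: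
  "real (card (solutions K)) \<le> (4 * real K * real M / real p + 1) * (real K / real M + 1)"
proof -
  define T where "T = 2 * int K * int M div int p"
  have "real (card (solutions K)) \<le> real (nat (2 * T + 1)) * real (K div M + 1)"
    unfolding T_def using card_solutions_le_lines_mult_positions by (metis of_nat_le_iff of_nat_mult)
  also have "\<dots> \<le> (4 * real K * real M / real p + 1) * (real K / real M + 1)"
  proof (rule mult_mono)
    have "0 \<le> T" using p_ge_2 by (simp add: T_def pos_imp_zdiv_nonneg_iff)
    then have "real (nat (2 * T + 1)) = 2 * real_of_int T + 1" by simp
    also have "real_of_int T \<le> real_of_int (2 * int K * int M) / real_of_int (int p)"
      unfolding T_def by (rule real_of_int_div4)
    finally show "real (nat (2 * T + 1)) \<le> 4 * real K * real M / real p + 1" by simp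
    show "real (K div M + 1) \<le> real K / real M + 1" using of_nat_div_le_of_nat[of K M] by simp
  qed simp_all
  finally show ?thesis .
qed

lemma card_solutions_mult_p_le:
  assumes "p \<le> 2 * K * M"
  shows "card (solutions K) * p \<le> 18 * K\<^sup>2"
proof -
  have "M * M \<le> 2 * K * M" using assms M_square_le unfolding power2_eq_square by linarith
  then have "M \<le> 2 * K" using M_pos by (metis mult_le_cancel2)
  then have "real M \<le> 2 * real K" by linarith
  then have K: "1 \<le> 2 * real K / real M" using M_pos by simp
  have "real p \<le> 2 * real K * real M" using assms by (metis of_nat_le_iff of_nat_mult of_nat_numeral)
  then have p: "1 \<le> 2 * real K * real M / real p" using p_ge_2 by simp
  have "real (card (solutions K)) \<le> (4 * real K * real M / real p + 1) * (real K / real M + 1)"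
    by (rule real_card_solutions_le)
  also have "\<dots> \<le> (6 * real K * real M / real p) * (3 * real K / real M)" using K p by (intro mult_mono) auto
  also have "\<dots> = 18 * (real K)\<^sup>2 / real p" using M_pos by (simp add: power2_eq_square)
  finally have "real (card (solutions K)) * real p \<le> 18 * (real K)\<^sup>2" using p_ge_2 by (simp add: pos_le_divide_eq)
  then have "real (card (solutions K) * p) \<le> real (18 * K\<^sup>2)" by simp
  then show ?thesis by (simp only: of_nat_le_iff)
qed

end

lemma (in congruence_lattice) solutions_cases [case_names equidistributed multiples]:
  obtains "card (solutions K) * p \<le> 18 * K\<^sup>2"
  | a b where "0 < a" "0 < b" "card (solutions K) * max a b \<le> K"
      "solutions K \<noteq> {} \<Longrightarrow> [g * int a = g' * int b] (mod int p)"
      "\<And>x y. (x, y) \<in> solutions K \<Longrightarrow> a dvd x \<and> b dvd y"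
proof -
  obtain z0 where "z0 \<in> lattice_points" "z0 \<noteq> (0, 0)" using ex_short_vector by blast
  then obtain z where z: "z \<in> lattice_points" "z \<noteq> (0, 0)"
    "\<And>w. w \<in> lattice_points \<Longrightarrow> w \<noteq> (0, 0) \<Longrightarrow> nat (max_norm z) \<le> nat (max_norm w)"
    using ex_has_least_nat[of "\<lambda>z. z \<in> lattice_points \<and> z \<noteq> (0, 0)" z0 "\<lambda>z. nat (max_norm z)"] by blast
  interpret minimal_lattice_vector p g g' "fst z" "snd z"
  proof unfold_locales
    fix w assume "w \<in> lattice_points" "w \<noteq> (0, 0)"
    then have "nat (max_norm z) \<le> nat (max_norm w)" by (rule z(3))
    moreover have "0 \<le> max_norm w" by (simp add: max_norm_def)
    ultimately show "max_norm (fst z, snd z) \<le> max_norm w" by simp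
  qed (use z in auto)
  show ?thesis
  proof (cases "2 * K * M < p")
    case True
    show ?thesis
    proof (rule that(2)[of "nat \<bar>fst z\<bar>" "nat \<bar>snd z\<bar>"])
      have "max (nat \<bar>fst z\<bar>) (nat \<bar>snd z\<bar>) = M" using max_norm_eq by linarith
      then show "card (solutions K) * max (nat \<bar>fst z\<bar>) (nat \<bar>snd z\<bar>) \<le> K"
        using card_solutions_mult_M_le[OF True] by simp
      show "nat \<bar>fst z\<bar> dvd x \<and> nat \<bar>snd z\<bar> dvd y" if "(x, y) \<in> solutions K" for x y
        using solution_multiple[OF True that] by (metis dvd_triv_right nat_abs_dvd_iff)
    qed (use nonzero_a nonzero_b abs_minimal_in_lattice[OF True] in \<open>auto simp: lattice_points_def\<close>)
  next
    case False
    then show ?thesis by (intro that(1) card_solutions_mult_p_le) simp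
  qed
qed

section \<open>Multiplicative energy of boxes\<close>

lemma card_le_mult_card_fibres:
  assumes "finite T" "f ` S \<subseteq> T" "\<And>t. t \<in> T \<Longrightarrow> card {s \<in> S. f s = t} \<le> c"
  shows "card S \<le> c * card T"
proof -
  have "S = (\<Union>t\<in>T. {s \<in> S. f s = t})" using assms(2) by auto
  then have "card S \<le> (\<Sum>t\<in>T. card {s \<in> S. f s = t})" using card_UN_le[OF assms(1)] by metis
  also have "\<dots> \<le> c * card T"
    using sum_bounded_above[of T "\<lambda>t. card {s \<in> S. f s = t}" c] assms(3) by (simp add: mult.commute)
  finally show ?thesis .
qed

lemma card_related_pairs_le:
  assumes fin: "finite A" "finite B" and into: "\<phi> ` A \<subseteq> B"
    and fibres: "\<And>y. y \<in> B \<Longrightarrow> card {x \<in> A. \<phi> x = y} \<le> c"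
    and rel: "\<And>x x'. x \<in> A \<Longrightarrow> x' \<in> A \<Longrightarrow> R x x' \<Longrightarrow> S (\<phi> x) (\<phi> x')"
  shows "card {(x, x') \<in> A \<times> A. R x x'} \<le> c\<^sup>2 * card {(y, y') \<in> B \<times> B. S y y'}"
proof (rule card_le_mult_card_fibres)
  show "finite {(y, y') \<in> B \<times> B. S y y'}"
    by (rule finite_subset[of _ "B \<times> B"]) (use fin(2) in auto)
  show "map_prod \<phi> \<phi> ` {(x, x') \<in> A \<times> A. R x x'} \<subseteq> {(y, y') \<in> B \<times> B. S y y'}"
    using into rel by auto
  fix t assume "t \<in> {(y, y') \<in> B \<times> B. S y y'}"
  then obtain y y' where t: "t = (y, y')" "y \<in> B" "y' \<in> B" by auto
  have "card {s \<in> {(x, x') \<in> A \<times> A. R x x'}. map_prod \<phi> \<phi> s = t} \<le> card ({x \<in> A. \<phi> x = y} \<times> {x \<in> A. \<phi> x = y'})"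
    using fin(1) by (intro card_mono) (auto simp: t)
  also have "\<dots> \<le> c\<^sup>2"
    unfolding card_cartesian_product power2_eq_square using t by (intro mult_le_mono fibres)
  finally show "card {s \<in> {(x, x') \<in> A \<times> A. R x x'}. map_prod \<phi> \<phi> s = t} \<le> c\<^sup>2" .
qed

context prime_mod
begin

definition box_sum :: "int set \<Rightarrow> nat list \<Rightarrow> nat \<Rightarrow> complex" where
  "box_sum G v k = (\<Sum>g\<in>G. dchar p k g) * prod_list (map (interval_sum p k) v)"

definition energy :: "int set \<Rightarrow> nat list \<Rightarrow> real" where
  "energy G v = (\<Sum>k<p - 1. (cmod (box_sum G v k))\<^sup>2) / real (p - 1)"

definition energy_ratio :: "int set \<Rightarrow> nat list \<Rightarrow> real" where
  "energy_ratio G v = energy G v / (real (card G) * real (prod_list v))"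

lemma interval_sum_1 [simp]: "interval_sum p k (Suc 0) = 1"
  by (simp add: interval_sum_def)

lemma prod_interval_sum: "prod_list (map (interval_sum p k) v) = (\<Sum>d\<in>nat_box v. dchar p k (int (prod_list d)))"
  by (induction v) (simp_all add: sum_nat_box_Cons interval_sum_def sum_product dchar_mult)

lemma box_sum_eq: "box_sum G v k = (\<Sum>z\<in>G \<times> nat_box v. dchar p k (fst z * int (prod_list (snd z))))"
  by (simp add: box_sum_def prod_interval_sum sum_product sum.cartesian_product dchar_mult split_def)

lemma box_sum_Cons: "box_sum G (a # v) k = interval_sum p k a * box_sum G v k"
  by (simp add: box_sum_def)

lemma box_sum_mset: "mset v = mset w \<Longrightarrow> box_sum G v k = box_sum G w k"
proof -
  assume "mset v = mset w"
  then have "mset (map (interval_sum p k) v) = mset (map (interval_sum p k) w)" by simp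
  then show ?thesis unfolding box_sum_def by (simp only: flip: prod_mset_prod_list)
qed

lemma energy_ratio_mset: "mset v = mset w \<Longrightarrow> energy_ratio G v = energy_ratio G w"
  unfolding energy_ratio_def energy_def by (simp only: box_sum_mset[of v w] flip: prod_mset_prod_list)

lemma energy_nonneg: "energy G v \<ge> 0"
  unfolding energy_def by (intro divide_nonneg_nonneg sum_nonneg) auto

lemma energy_ratio_nonneg: "energy_ratio G v \<ge> 0"
  by (simp add: energy_ratio_def energy_nonneg)

lemma energy_le_if_energy_ratio_le:
  assumes "energy_ratio G v \<le> c" "0 < card G" "0 < prod_list v"
  shows "energy G v \<le> c * (real (card G) * real (prod_list v))"
  using assms by (simp add: energy_ratio_def pos_divide_le_eq)

lemma energy_ratio_Cons_1 [simp]: "energy_ratio G (Suc 0 # v) = energy_ratio G v"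
  by (simp add: energy_ratio_def energy_def box_sum_Cons)

lemma energy_ratio_replicate_1_append: "energy_ratio G (replicate n (Suc 0) @ v) = energy_ratio G v"
  by (induction n) simp_all

lemma sum_norm_box_sum_square: "(\<Sum>k<p - 1. (cmod (box_sum G v k))\<^sup>2) = real (p - 1) * energy G v"
  using p_ge_2 by (simp add: energy_def)

lemma energy_log_convex: "(energy G (a # v))\<^sup>2 \<le> energy G (a # a # v) * energy G v"
proof -
  let ?f = "\<lambda>k. cmod (box_sum G (a # a # v) k)" and ?h = "\<lambda>k. cmod (box_sum G v k)"
  have "(\<Sum>k<p - 1. (cmod (box_sum G (a # v) k))\<^sup>2) = (\<Sum>k<p - 1. ?f k * ?h k)"
    by (simp add: box_sum_Cons norm_mult power2_eq_square mult_ac)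
  then have "(real (p - 1) * energy G (a # v))\<^sup>2 \<le> (\<Sum>k<p - 1. (?f k)\<^sup>2) * (\<Sum>k<p - 1. (?h k)\<^sup>2)"
    using Cauchy_Schwarz_ineq_sum[of ?f ?h "{..<p - 1}"] by (simp only: sum_norm_box_sum_square)
  then have "(real (p - 1))\<^sup>2 * (energy G (a # v))\<^sup>2 \<le> (real (p - 1))\<^sup>2 * (energy G (a # a # v) * energy G v)"
    unfolding sum_norm_box_sum_square by (simp only: power2_eq_square mult_ac)
  then show ?thesis using p_ge_2 by simp
qed

lemma energy_ratio_log_convex: "(energy_ratio G (a # v))\<^sup>2 \<le> energy_ratio G (a # a # v) * energy_ratio G v"
  using divide_right_mono[OF energy_log_convex, of "(real (card G) * real (prod_list (a # v)))\<^sup>2"]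
  by (simp add: energy_ratio_def power_divide power2_eq_square mult_ac)

lemma second_moment_residues:
  assumes "E \<subseteq> {1..<int p}"
  shows "(\<Sum>k<p - 1. (cmod (\<Sum>x\<in>E. dchar p k x))\<^sup>2) = real ((p - 1) * card E)"
proof -
  have eq_if_cong: "x = y" if "x \<in> E" "y \<in> E" "[x = y] (mod int p)" for x y
    using that assms by (intro cong_less_imp_eq_int[of x "int p" y]) auto
  have "(\<Sum>k<p - 1. (cmod (\<Sum>x\<in>E. dchar p k x))\<^sup>2) = real ((p - 1) * card {(x, y) \<in> E \<times> E. [x = y] (mod int p)})"
    using assms finite_subset by (intro second_moment_eq) (auto dest!: zdvd_imp_le)
  also have "{(x, y) \<in> E \<times> E. [x = y] (mod int p)} = (\<lambda>x. (x, x)) ` E" by (auto dest: eq_if_cong)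
  also have "card \<dots> = card E" by (intro card_image) (auto simp: inj_on_def)
  finally show ?thesis .
qed

lemma not_dvd_nat_box:
  assumes "d \<in> nat_box v" "\<forall>a\<in>set v. a < p"
  shows "\<not> p dvd prod_list d"
  using assms
proof (induction v arbitrary: d)
  case Nil
  then show ?case using p_ge_2 by auto
next
  case (Cons a v)
  then obtain x e where d: "d = x # e" "x \<in> {1..a}" "e \<in> nat_box v" by (auto simp: nat_box_Cons)
  then have "\<not> p dvd x" using Cons.prems(2) by (auto dest: dvd_imp_le)
  moreover have "\<not> p dvd prod_list e" using Cons.IH[OF d(3)] Cons.prems(2) by simp
  ultimately show ?case using prime_p by (simp add: d prime_dvd_mult_iff)
qed

end

locale residue_set = prime_mod +
  fixes G :: "int set"
  assumes G_subset: "G \<subseteq> {1..<int p}"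
begin

lemma finite_G: "finite G"
  using G_subset finite_subset by blast

lemma not_dvd_G: "g \<in> G \<Longrightarrow> \<not> int p dvd g"
  using G_subset by (auto dest!: zdvd_imp_le)

lemma not_dvd_G_mult_nat_box:
  assumes "\<forall>a\<in>set v. a < p" "z \<in> G \<times> nat_box v"
  shows "\<not> int p dvd fst z * int (prod_list (snd z))"
  using assms not_dvd_nat_box[of "snd z" v] by (intro not_dvd_mult) (simp_all add: not_dvd_G mem_Times_iff)

definition box_pairs :: "nat list \<Rightarrow> nat list \<Rightarrow> ((int \<times> nat list) \<times> (int \<times> nat list)) set" where
  "box_pairs v w = {(z, z') \<in> (G \<times> nat_box v) \<times> (G \<times> nat_box w).
     [fst z * int (prod_list (snd z)) = fst z' * int (prod_list (snd z'))] (mod int p)}"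

lemma finite_box_pairs: "finite (box_pairs v w)"
  by (rule finite_subset[of _ "(G \<times> nat_box v) \<times> (G \<times> nat_box w)"]) (auto simp: box_pairs_def finite_G)

lemma energy_eq_card:
  assumes "\<forall>a\<in>set v. a < p"
  shows "energy G v = real (card (box_pairs v v))"
proof -
  have "(\<Sum>k<p - 1. (cmod (box_sum G v k))\<^sup>2) = real ((p - 1) * card (box_pairs v v))"
    unfolding box_sum_eq box_pairs_def using finite_G not_dvd_G_mult_nat_box[OF assms]
    by (intro second_moment_eq) auto
  then show ?thesis using p_ge_2 by (simp add: energy_def)
qed

lemma card_box_pairs_le:
  assumes "\<forall>a\<in>set v. a < p" "\<forall>a\<in>set w. a < p"
  shows "real (card (box_pairs v w)) \<le> sqrt (energy G v * energy G w)"
proof (rule real_le_rsqrt)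
  have "of_nat ((p - 1) * card (box_pairs v w)) = (\<Sum>k<p - 1. box_sum G v k * cnj (box_sum G w k))"
    unfolding box_sum_eq box_pairs_def
    using finite_G not_dvd_G_mult_nat_box[OF assms(1)] not_dvd_G_mult_nat_box[OF assms(2)]
    by (intro bilinear_orthogonality[symmetric]) auto
  then have "real ((p - 1) * card (box_pairs v w)) = cmod (\<Sum>k<p - 1. box_sum G v k * cnj (box_sum G w k))"
    by (simp only: norm_of_nat flip: \<open>of_nat _ = _\<close>)
  also have "\<dots> \<le> (\<Sum>k<p - 1. cmod (box_sum G v k) * cmod (box_sum G w k))"
    using norm_sum[of "\<lambda>k. box_sum G v k * cnj (box_sum G w k)" "{..<p - 1}"] by (simp add: norm_mult)
  finally have "(real ((p - 1) * card (box_pairs v w)))\<^sup>2 \<le>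
      (\<Sum>k<p - 1. cmod (box_sum G v k) * cmod (box_sum G w k))\<^sup>2"
    by (intro power_mono) auto
  also have "\<dots> \<le> (\<Sum>k<p - 1. (cmod (box_sum G v k))\<^sup>2) * (\<Sum>k<p - 1. (cmod (box_sum G w k))\<^sup>2)"
    by (rule Cauchy_Schwarz_ineq_sum)
  finally have "(real (p - 1))\<^sup>2 * (real (card (box_pairs v w)))\<^sup>2 \<le> (real (p - 1))\<^sup>2 * (energy G v * energy G w)"
    unfolding sum_norm_box_sum_square by (simp only: of_nat_mult power2_eq_square mult_ac)
  then show "(real (card (box_pairs v w)))\<^sup>2 \<le> energy G v * energy G w" using p_ge_2 by simp
qed

lemma energy_ratio_Nil:
  assumes "card G > 0"
  shows "energy_ratio G [] = 1"
  using second_moment_residues[OF G_subset] assms p_ge_2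
  by (simp add: energy_ratio_def energy_def box_sum_def)

lemma energy_ratio_merge:
  assumes D: "\<And>n. 0 < n \<Longrightarrow> n < p \<Longrightarrow> num_divisors n \<le> D"
    and ab: "a * b < p" "0 < a" "0 < b" and v: "\<forall>c\<in>set v. c < p"
  shows "energy_ratio G (a # b # v) \<le> real (D\<^sup>2) * energy_ratio G ((a * b) # v)"
proof -
  define \<phi> where "\<phi> = (\<lambda>(g :: int, d). (g, hd d * hd (tl d) # tl (tl d) :: nat list))"
  have "card (box_pairs (a # b # v) (a # b # v)) \<le> D\<^sup>2 * card (box_pairs ((a * b) # v) ((a * b) # v))"
    unfolding box_pairs_def
  proof (rule card_related_pairs_le)
    show "\<phi> ` (G \<times> nat_box (a # b # v)) \<subseteq> G \<times> nat_box ((a * b) # v)"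
      by (auto simp: \<phi>_def nat_box_Cons image_iff intro: mult_le_mono)
    fix z assume "z \<in> G \<times> nat_box ((a * b) # v)"
    then obtain g n d where z: "z = (g, n # d)" "n \<in> {1..a * b}" by (auto simp: nat_box_Cons)
    have "{y \<in> G \<times> nat_box (a # b # v). \<phi> y = z} \<subseteq> (\<lambda>x. (g, x # n div x # d)) ` {x. x dvd n}"
      by (auto simp: \<phi>_def z nat_box_Cons image_iff)
    then have "card {y \<in> G \<times> nat_box (a # b # v). \<phi> y = z} \<le> num_divisors n"
      unfolding num_divisors_def using z(2) by (intro surj_card_le) auto
    also have "\<dots> \<le> D" using z(2) ab(1) by (intro D) auto
    finally show "card {y \<in> G \<times> nat_box (a # b # v). \<phi> y = z} \<le> D" .
  next
    fix z z' assume "z \<in> G \<times> nat_box (a # b # v)" "z' \<in> G \<times> nat_box (a # b # v)"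
      "[fst z * int (prod_list (snd z)) = fst z' * int (prod_list (snd z'))] (mod int p)"
    then show "[fst (\<phi> z) * int (prod_list (snd (\<phi> z))) = fst (\<phi> z') * int (prod_list (snd (\<phi> z')))] (mod int p)"
      by (auto simp: \<phi>_def nat_box_Cons mult.assoc)
  qed (simp_all add: finite_G)
  then have "real (card (box_pairs (a # b # v) (a # b # v))) \<le>
      real (D\<^sup>2) * real (card (box_pairs ((a * b) # v) ((a * b) # v)))"
    by (metis of_nat_le_iff of_nat_mult)
  moreover have "a \<le> a * b" "b \<le> a * b" using ab(2,3) by simp_all
  then have "a < p" "b < p" using ab(1) by linarith+
  ultimately have "energy G (a # b # v) \<le> real (D\<^sup>2) * energy G ((a * b) # v)"
    using energy_eq_card[of "a # b # v"] energy_eq_card[of "(a * b) # v"] ab(1) v by simp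
  then show ?thesis
    unfolding energy_ratio_def times_divide_eq_right by (simp add: divide_right_mono mult.assoc)
qed

end

locale box_energy = residue_set +
  fixes D A L :: nat
  assumes card_G_pos: "card G > 0"
    and num_divisors_le: "\<And>n. 0 < n \<Longrightarrow> n < p \<Longrightarrow> num_divisors n \<le> D"
    and A_ge_1: "1 \<le> A" and A_less: "A < p" and A_le: "A \<le> 2 ^ L"
begin

lemma entries_less: "set v \<subseteq> {1..A} \<Longrightarrow> \<forall>a\<in>set v. a < p"
  using A_less by auto

lemma prod_list_pos: "set v \<subseteq> {1..A} \<Longrightarrow> 0 < prod_list v"
  by (induction v) auto

lemma D_ge_1: "1 \<le> D"
  using num_divisors_le[of 1] p_ge_2 by simp

definition box_products :: "nat list \<Rightarrow> nat set" where
  "box_products v = prod_list ` nat_box v"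

definition product_solutions :: "nat list \<Rightarrow> int \<times> int \<Rightarrow> (nat \<times> nat) set" where
  "product_solutions v z = {(x, y) \<in> box_products v \<times> box_products v. [fst z * int x = snd z * int y] (mod int p)}"

definition linked_pairs :: "nat list \<Rightarrow> nat list \<Rightarrow> (int \<times> int) set" where
  "linked_pairs v w = (\<lambda>(z, z'). (fst z, fst z')) ` box_pairs v w"

lemma finite_box_products: "finite (box_products v)"
  by (simp add: box_products_def)

lemma finite_product_solutions: "finite (product_solutions v z)"
  by (rule finite_subset[of _ "box_products v \<times> box_products v"])
    (auto simp: product_solutions_def finite_box_products)

lemma box_products_bounds: "x \<in> box_products v \<Longrightarrow> x \<in> {1..prod_list v}"
  using prod_list_nat_box by (auto simp: box_products_def)

lemma box_products_less:
  assumes "x \<in> box_products v" "set v \<subseteq> {1..A}" "prod_list v \<le> p"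
  shows "x < p"
proof -
  have "\<not> p dvd x" using assms(1) not_dvd_nat_box[OF _ entries_less[OF assms(2)]] by (auto simp: box_products_def)
  moreover have "x \<le> p" using box_products_bounds[OF assms(1)] assms(3) by simp
  ultimately show ?thesis by (metis dvd_refl le_neq_implies_less)
qed

lemma product_solutions_subset:
  assumes "g \<in> G" "g' \<in> G"
  shows "product_solutions v (g, g') \<subseteq> congruence_lattice.solutions p g g' (prod_list v)"
proof -
  interpret congruence_lattice p g g' using assms not_dvd_G by unfold_locales auto
  show ?thesis using box_products_bounds by (fastforce simp: product_solutions_def solutions_def lattice_points_def)
qed

lemma card_box_pairs_le_sum_product_solutions:
  assumes v: "set v \<subseteq> {1..A}" "prod_list v \<le> p"
  shows "card (box_pairs v v) \<le> D ^ (2 * length v) * (\<Sum>z\<in>G \<times> G. card (product_solutions v z))"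
proof -
  let ?R = "\<lambda>z z' :: int \<times> nat. [fst z * int (snd z) = fst z' * int (snd z')] (mod int p)"
  have "card (box_pairs v v) \<le>
      (D ^ length v)\<^sup>2 * card {(z, z') \<in> (G \<times> box_products v) \<times> (G \<times> box_products v). ?R z z'}"
    unfolding box_pairs_def
  proof (rule card_related_pairs_le[where \<phi> = "\<lambda>(g, d). (g, prod_list d)"])
    show "(\<lambda>(g, d). (g, prod_list d)) ` (G \<times> nat_box v) \<subseteq> G \<times> box_products v"
      by (auto simp: box_products_def)
    fix z assume "z \<in> G \<times> box_products v"
    then obtain g x where z: "z = (g, x)" "x \<in> box_products v" by auto
    have "{y \<in> G \<times> nat_box v. (case y of (g, d) \<Rightarrow> (g, prod_list d)) = z} \<subseteq> Pair g ` factorizations v x"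
      by (auto simp: z factorizations_def)
    then have "card {y \<in> G \<times> nat_box v. (case y of (g, d) \<Rightarrow> (g, prod_list d)) = z} \<le> card (factorizations v x)"
      by (intro surj_card_le) (simp_all add: factorizations_def)
    also have "\<dots> \<le> num_divisors x ^ length v"
      using box_products_bounds[OF z(2)] by (intro card_factorizations_le) auto
    also have "\<dots> \<le> D ^ length v"
      using box_products_bounds[OF z(2)] box_products_less[OF z(2) v] by (intro power_mono num_divisors_le) auto
    finally show "card {y \<in> G \<times> nat_box v. (case y of (g, d) \<Rightarrow> (g, prod_list d)) = z} \<le> D ^ length v" .
  qed (auto simp: finite_G finite_box_products)
  also have "card {(z, z') \<in> (G \<times> box_products v) \<times> (G \<times> box_products v). ?R z z'} =
      card (SIGMA z:G \<times> G. product_solutions v z)"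
    by (rule bij_betw_same_card[of "\<lambda>((g, x), (g', y)). ((g, g'), (x, y))"], rule bij_betw_imageI)
      (auto simp: inj_on_def product_solutions_def image_iff)
  also have "\<dots> = (\<Sum>z\<in>G \<times> G. card (product_solutions v z))"
    using finite_G finite_product_solutions by (intro card_SigmaI) auto
  finally show ?thesis by (simp flip: power_mult add: mult.commute)
qed

lemma linked_pairs_subset: "linked_pairs v w \<subseteq> G \<times> G"
  by (auto simp: linked_pairs_def box_pairs_def)

lemma card_linked_pairs_le:
  assumes v: "set v \<subseteq> {1..A}" "energy_ratio G v \<le> Q" and w: "set w \<subseteq> {1..A}" "energy_ratio G w \<le> Q"
  shows "real (card (linked_pairs v w)) \<le> Q * real (card G) * sqrt (real (prod_list v) * real (prod_list w))"
proof -
  have Q: "0 \<le> Q" using energy_ratio_nonneg v(2) by (rule order_trans)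
  have "card (linked_pairs v w) \<le> card (box_pairs v w)"
    unfolding linked_pairs_def using finite_box_pairs by (rule card_image_le)
  then have "real (card (linked_pairs v w)) \<le> real (card (box_pairs v w))" by simp
  also have "\<dots> \<le> sqrt (energy G v * energy G w)" using v(1) w(1) by (intro card_box_pairs_le entries_less)
  also have "\<dots> \<le> sqrt ((Q * (real (card G) * real (prod_list v))) * (Q * (real (card G) * real (prod_list w))))"
    using v w card_G_pos energy_nonneg Q
    by (intro real_sqrt_le_mono mult_mono energy_le_if_energy_ratio_le prod_list_pos) auto
  also have "(Q * (real (card G) * real (prod_list v))) * (Q * (real (card G) * real (prod_list w))) =
      (Q * real (card G))\<^sup>2 * (real (prod_list v) * real (prod_list w))"
    by (simp add: power2_eq_square)
  also have "sqrt \<dots> = Q * real (card G) * sqrt (real (prod_list v) * real (prod_list w))"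
    using Q by (simp add: real_sqrt_mult)
  finally show ?thesis .
qed

definition short_boxes :: "nat \<Rightarrow> nat list set" where
  "short_boxes l = dyadic_boxes A L l (2 ^ l * card G)"

lemma short_boxes_entries: "F \<in> short_boxes l \<Longrightarrow> set F \<subseteq> {1..A}"
  using dyadic_sizes_subset[OF A_ge_1] by (auto simp: short_boxes_def dyadic_boxes_def)

lemma ex_short_boxes_linking:
  assumes v: "set v \<subseteq> {1..A}" and z: "z \<in> G \<times> G" and xy: "(x, y) \<in> product_solutions v z"
    and a: "a dvd x" "a \<le> M" "0 < a" and b: "b dvd y" "b \<le> M" "0 < b" and M: "M \<le> card G"
    and cong: "[fst z * int a = snd z * int b] (mod int p)"
  shows "\<exists>F\<in>short_boxes (length v). \<exists>F'\<in>short_boxes (length v). z \<in> linked_pairs F F' \<and>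
    sqrt (real (prod_list F) * real (prod_list F')) \<le> 2 ^ length v * real M"
proof -
  have short_box: "\<exists>F\<in>short_boxes (length v). \<exists>f\<in>nat_box F. prod_list f = c \<and> prod_list F \<le> 2 ^ length v * M"
    if c: "u \<in> box_products v" "c dvd u" "c \<le> M" for u c
  proof -
    obtain d where "d \<in> nat_box v" "c dvd prod_list d" using c by (auto simp: box_products_def)
    moreover have "2 ^ length v * c \<le> 2 ^ length v * card G" using c(3) M by simp
    moreover have "2 ^ length v * c \<le> 2 ^ length v * M" using c(3) by simp
    ultimately show ?thesis
      using ex_dyadic_box_divisor[OF _ v A_le] unfolding short_boxes_def by (meson order_trans)
  qed
  obtain F f where F: "F \<in> short_boxes (length v)" "f \<in> nat_box F" "prod_list f = a" "prod_list F \<le> 2 ^ length v * M"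
    using short_box[of x a] xy a by (auto simp: product_solutions_def)
  obtain F' f' where F': "F' \<in> short_boxes (length v)" "f' \<in> nat_box F'" "prod_list f' = b"
    "prod_list F' \<le> 2 ^ length v * M"
    using short_box[of y b] xy b by (auto simp: product_solutions_def)
  have "((fst z, f), (snd z, f')) \<in> box_pairs F F'" using z F F' cong by (auto simp: box_pairs_def)
  then have "z \<in> linked_pairs F F'" unfolding linked_pairs_def by force
  moreover have "real (prod_list F) * real (prod_list F') \<le> (real (2 ^ length v * M))\<^sup>2"
    unfolding power2_eq_square using F(4) F'(4) by (intro mult_mono of_nat_mono) auto
  then have "sqrt (real (prod_list F) * real (prod_list F')) \<le> sqrt ((real (2 ^ length v * M))\<^sup>2)"
    by (rule real_sqrt_le_mono)
  ultimately show ?thesis using F(1) F'(1) by (intro bexI[of _ F] bexI[of _ F']) auto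
qed

definition link_weight :: "nat list \<Rightarrow> nat list \<times> nat list \<Rightarrow> real" where
  "link_weight v FF = real (prod_list v) * 2 ^ length v / sqrt (real (prod_list (fst FF)) * real (prod_list (snd FF)))"

lemma link_weight_nonneg: "0 \<le> link_weight v FF"
  by (simp add: link_weight_def)

lemma divide_le_link_weight:
  assumes v: "set v \<subseteq> {1..A}" and z: "z \<in> G \<times> G" and sol: "product_solutions v z \<noteq> {}"
    and ab: "0 < a" "0 < b" "max a b \<le> card G" "[fst z * int a = snd z * int b] (mod int p)"
    and dvd: "\<And>x y. (x, y) \<in> product_solutions v z \<Longrightarrow> a dvd x \<and> b dvd y"
  shows "real (prod_list v) / real (max a b) \<le>
    (\<Sum>(F, F')\<in>short_boxes (length v) \<times> short_boxes (length v). of_bool (z \<in> linked_pairs F F') * link_weight v (F, F'))"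
proof -
  let ?B = "short_boxes (length v)"
  obtain x y where xy: "(x, y) \<in> product_solutions v z" using sol by auto
  obtain F F' where F: "F \<in> ?B" "F' \<in> ?B" "z \<in> linked_pairs F F'"
    "sqrt (real (prod_list F) * real (prod_list F')) \<le> 2 ^ length v * real (max a b)"
    using ex_short_boxes_linking[OF v z xy _ max.cobounded1 ab(1) _ max.cobounded2 ab(2,3,4)] dvd[OF xy] by blast
  have "real (prod_list v) / real (max a b) = real (prod_list v) * 2 ^ length v / (2 ^ length v * real (max a b))"
    by simp
  also have "\<dots> \<le> link_weight v (F, F')"
    unfolding link_weight_def fst_conv snd_conv
    using F ab(1) prod_list_pos short_boxes_entries by (intro divide_left_mono mult_pos_pos) auto
  also have "\<dots> = (\<Sum>(F, F')\<in>{(F, F')}. of_bool (z \<in> linked_pairs F F') * link_weight v (F, F'))" using F(3) by simp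
  also have "\<dots> \<le> (\<Sum>(F, F')\<in>?B \<times> ?B. of_bool (z \<in> linked_pairs F F') * link_weight v (F, F'))"
    using F(1,2) link_weight_nonneg
    by (intro sum_mono2) (auto simp: short_boxes_def finite_dyadic_boxes split: prod.splits)
  finally show ?thesis .
qed

lemma card_product_solutions_le:
  assumes v: "set v \<subseteq> {1..A}" and z: "z \<in> G \<times> G"
  shows "real (card (product_solutions v z)) \<le>
    18 * (real (prod_list v))\<^sup>2 / real p + real (prod_list v) / real (card G) +
    (\<Sum>(F, F')\<in>short_boxes (length v) \<times> short_boxes (length v). of_bool (z \<in> linked_pairs F F') * link_weight v (F, F'))"
    (is "_ \<le> ?main + ?tail + ?linked")
proof -
  let ?K = "prod_list v"
  have nonneg: "0 \<le> ?main" "0 \<le> ?tail" "0 \<le> ?linked"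
    using link_weight_nonneg by (auto intro!: sum_nonneg)
  have g: "fst z \<in> G" "snd z \<in> G" using z by auto
  interpret congruence_lattice p "fst z" "snd z" using g not_dvd_G by unfold_locales auto
  have sub: "product_solutions v z \<subseteq> solutions ?K" using product_solutions_subset[OF g] by simp
  then have card_le: "card (product_solutions v z) \<le> card (solutions ?K)" by (intro card_mono finite_solutions)
  show ?thesis
  proof (cases "product_solutions v z = {}")
    case False
    show ?thesis
    proof (cases rule: solutions_cases[of ?K])
      case equidistributed
      then have "real (card (solutions ?K) * p) \<le> real (18 * ?K\<^sup>2)" by (simp only: of_nat_le_iff)
      then have "real (card (solutions ?K)) \<le> ?main" using p_ge_2 by (simp add: pos_le_divide_eq)
      then show ?thesis using card_le nonneg by linarith
    next
      case (multiples a b)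
      have "real (card (solutions ?K) * max a b) \<le> real ?K" using multiples(3) by (simp only: of_nat_le_iff)
      then have bound: "real (card (solutions ?K)) \<le> real ?K / real (max a b)"
        using multiples(1) by (simp add: pos_le_divide_eq)
      have "real ?K / real (max a b) \<le> ?tail + ?linked"
      proof (cases "max a b \<le> card G")
        case True
        have "[fst z * int a = snd z * int b] (mod int p)" using multiples(4) False sub by blast
        then have "real ?K / real (max a b) \<le> ?linked"
          using multiples(1,2,5) True False sub by (intro divide_le_link_weight[OF v z]) blast+
        then show ?thesis using nonneg by linarith
      next
        case False
        then have "real ?K / real (max a b) \<le> ?tail" using card_G_pos by (intro divide_left_mono) auto
        then show ?thesis using nonneg by linarith
      qed
      then show ?thesis using card_le bound nonneg by linarith
    qed
  qed (use nonneg in simp)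
qed

lemma sum_linked_pairs_le:
  assumes Q: "\<And>F. F \<in> short_boxes (length v) \<Longrightarrow> energy_ratio G F \<le> Q" "1 \<le> Q"
  shows "(\<Sum>z\<in>G \<times> G. \<Sum>(F, F')\<in>short_boxes (length v) \<times> short_boxes (length v).
      of_bool (z \<in> linked_pairs F F') * link_weight v (F, F')) \<le>
    real (L + 1) ^ (2 * length v) * (2 ^ length v * Q * (real (card G) * real (prod_list v)))"
proof -
  let ?B = "short_boxes (length v)"
  have "(\<Sum>z\<in>G \<times> G. \<Sum>(F, F')\<in>?B \<times> ?B. of_bool (z \<in> linked_pairs F F') * link_weight v (F, F')) =
      (\<Sum>(F, F')\<in>?B \<times> ?B. \<Sum>z\<in>G \<times> G. of_bool (z \<in> linked_pairs F F') * link_weight v (F, F'))"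
    by (subst sum.swap) (simp add: split_def)
  also have "\<dots> = (\<Sum>(F, F')\<in>?B \<times> ?B. real (card (linked_pairs F F')) * link_weight v (F, F'))"
  proof (intro sum.cong refl, clarify)
    fix F F'
    have "G \<times> G \<inter> {z. z \<in> linked_pairs F F'} = linked_pairs F F'" using linked_pairs_subset by auto
    then show "(\<Sum>z\<in>G \<times> G. of_bool (z \<in> linked_pairs F F') * link_weight v (F, F')) =
        real (card (linked_pairs F F')) * link_weight v (F, F')"
      using finite_G by (simp flip: sum_distrib_right)
  qed
  also have "\<dots> \<le> (\<Sum>(F, F')\<in>?B \<times> ?B. 2 ^ length v * Q * (real (card G) * real (prod_list v)))"
  proof (intro sum_mono, clarify)
    fix F F' assume F: "F \<in> ?B" "F' \<in> ?B"
    define s where "s = sqrt (real (prod_list F) * real (prod_list F'))"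
    have "0 < s" using F prod_list_pos short_boxes_entries by (auto simp: s_def)
    then have "Q * real (card G) * s * link_weight v (F, F') = 2 ^ length v * Q * (real (card G) * real (prod_list v))"
      unfolding link_weight_def fst_conv snd_conv s_def[symmetric] by simp
    moreover have "real (card (linked_pairs F F')) \<le> Q * real (card G) * s"
      unfolding s_def using F Q(1) short_boxes_entries by (intro card_linked_pairs_le)
    ultimately show "real (card (linked_pairs F F')) * link_weight v (F, F') \<le>
        2 ^ length v * Q * (real (card G) * real (prod_list v))"
      by (metis link_weight_nonneg mult_right_mono)
  qed
  also have "\<dots> = real (card ?B) ^ 2 * (2 ^ length v * Q * (real (card G) * real (prod_list v)))"
    by (simp add: card_cartesian_product power2_eq_square split_def)
  also have "\<dots> \<le> (real (L + 1) ^ length v)\<^sup>2 * (2 ^ length v * Q * (real (card G) * real (prod_list v)))"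
  proof (intro mult_right_mono power_mono)
    show "real (card ?B) \<le> real (L + 1) ^ length v"
      unfolding short_boxes_def of_nat_power[symmetric] of_nat_le_iff by (rule card_dyadic_boxes_le)
  qed (use Q(2) in auto)
  finally show ?thesis by (simp flip: power_mult add: mult.commute)
qed

definition energy_loss :: "nat \<Rightarrow> real" where
  "energy_loss l = 20 * real D ^ (2 * l) * 2 ^ l * real (L + 1) ^ (2 * l)"

lemma energy_loss_ge_1: "1 \<le> energy_loss l"
proof -
  have "1 * 1 * 1 * 1 \<le> energy_loss l"
    unfolding energy_loss_def using D_ge_1 by (intro mult_mono one_le_power) auto
  then show ?thesis by simp
qed

lemma energy_ratio_le_if_short_boxes:
  assumes Q: "\<And>F. F \<in> short_boxes (length v) \<Longrightarrow> energy_ratio G F \<le> Q" "1 \<le> Q"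
    and v: "set v \<subseteq> {1..A}" "prod_list v * card G \<le> p"
  shows "energy_ratio G v \<le> energy_loss (length v) * Q"
proof -
  let ?N = "real (card G)" and ?K = "real (prod_list v)" and ?l = "length v"
  let ?c = "2 ^ ?l * real (L + 1) ^ (2 * ?l) * Q"
  have "prod_list v \<le> prod_list v * card G" using card_G_pos by simp
  then have K: "prod_list v \<le> p" using v(2) by (rule order_trans)
  have NK_pos: "0 < ?N * ?K" using card_G_pos prod_list_pos[OF v(1)] by simp
  have "real (prod_list v * card G) \<le> real p" using v(2) by (simp only: of_nat_le_iff)
  then have "(?N * ?K) * (?N * ?K) \<le> (?N * ?K) * real p" by (intro mult_left_mono) (simp_all add: mult.commute)
  then have NK_le: "(?N * ?K)\<^sup>2 / real p \<le> ?N * ?K" using p_ge_2 by (simp add: pos_divide_le_eq power2_eq_square)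
  have c: "1 \<le> ?c"
  proof -
    have "1 * 1 * 1 \<le> ?c" using Q(2) by (intro mult_mono one_le_power) auto
    then show ?thesis by simp
  qed
  have "(\<Sum>z\<in>G \<times> G. real (card (product_solutions v z))) \<le>
      (\<Sum>z\<in>G \<times> G. 18 * ?K\<^sup>2 / real p + ?K / ?N +
        (\<Sum>(F, F')\<in>short_boxes ?l \<times> short_boxes ?l. of_bool (z \<in> linked_pairs F F') * link_weight v (F, F')))"
    using v(1) by (intro sum_mono card_product_solutions_le)
  also have "\<dots> \<le> ?N\<^sup>2 * (18 * ?K\<^sup>2 / real p + ?K / ?N) + ?c * (?N * ?K)"
    using sum_linked_pairs_le[OF Q] by (simp add: sum.distrib card_cartesian_product power2_eq_square mult_ac)
  also have "?N\<^sup>2 * (18 * ?K\<^sup>2 / real p + ?K / ?N) = 18 * ((?N * ?K)\<^sup>2 / real p) + ?N * ?K"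
    using card_G_pos by (simp add: power2_eq_square field_simps)
  also have "18 * ((?N * ?K)\<^sup>2 / real p) + ?N * ?K + ?c * (?N * ?K) \<le> (19 + ?c) * (?N * ?K)"
    using NK_le by (simp add: ring_distribs)
  also have "\<dots> \<le> 20 * ?c * (?N * ?K)" using c NK_pos by (intro mult_right_mono) linarith+
  finally have sum_le: "(\<Sum>z\<in>G \<times> G. real (card (product_solutions v z))) \<le> 20 * ?c * (?N * ?K)" .
  have "energy G v = real (card (box_pairs v v))" using v(1) by (intro energy_eq_card entries_less)
  also have "\<dots> \<le> real D ^ (2 * ?l) * (\<Sum>z\<in>G \<times> G. real (card (product_solutions v z)))"
    using card_box_pairs_le_sum_product_solutions[OF v(1) K] by (metis of_nat_le_iff of_nat_mult of_nat_power of_nat_sum)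
  also have "\<dots> \<le> real D ^ (2 * ?l) * (20 * ?c * (?N * ?K))" using sum_le by (intro mult_left_mono) auto
  finally have "energy G v \<le> energy_loss ?l * Q * (?N * ?K)" by (simp add: energy_loss_def mult_ac)
  then show ?thesis using NK_pos by (simp add: energy_ratio_def pos_divide_le_eq)
qed

end

lemma ex_small_product_of_two:
  assumes F: "4 \<le> length F" "0 \<notin> set F" "prod_list F \<le> A\<^sup>2"
  shows "\<exists>a b w. mset F = mset (a # b # w) \<and> a * b \<le> (A :: nat)"
proof -
  obtain a b c d w where F_eq: "F = a # b # c # d # w"
    using F(1) by (auto simp: numeral_eq_Suc Suc_le_length_iff)
  show ?thesis
  proof (cases "a * b \<le> A")
    case True
    then show ?thesis using F_eq by blast
  next
    case ab: False
    have w: "1 \<le> prod_list w" using F(2) by (simp add: F_eq Suc_le_eq prod_list_zero_iff flip: neq0_conv)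
    have "c * d \<le> A"
    proof (rule ccontr)
      assume "\<not> c * d \<le> A"
      then have "(A + 1) * (A + 1) \<le> (a * b) * (c * d)" using ab by (intro mult_le_mono) auto
      also have "\<dots> \<le> (a * b) * (c * d) * prod_list w" using mult_le_mono2[OF w] by simp
      also have "\<dots> \<le> A * A" using F(3) by (simp add: F_eq power2_eq_square mult_ac)
      finally show False by simp
    qed
    moreover have "mset F = mset (c # d # a # b # w)" by (simp add: F_eq)
    ultimately show ?thesis by blast
  qed
qed

lemma le_power_if_le_mult_powr:
  fixes x c :: real
  assumes "0 < x" "x \<le> c * x powr (1 - (1 / 2) ^ n)"
  shows "x \<le> c ^ (2 ^ n)"
proof -
  let ?\<theta> = "(1 / 2) ^ n :: real"
  have "x * x powr ?\<theta> \<le> (c * x powr (1 - ?\<theta>)) * x powr ?\<theta>" using assms(2) by (intro mult_right_mono) auto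
  also have "\<dots> = c * x" using assms(1) by (simp add: mult.assoc flip: powr_add)
  finally have "x powr ?\<theta> \<le> c" using assms(1) by (simp add: mult.commute)
  then have "(x powr ?\<theta>) ^ (2 ^ n) \<le> c ^ (2 ^ n)" by (intro power_mono) auto
  moreover have "(x powr ?\<theta>) ^ (2 ^ n) = x"
    using assms(1) by (simp add: powr_powr power_one_over flip: powr_realpow)
  ultimately show ?thesis by simp
qed

context box_energy
begin

text \<open>An entry \<open>a\<close> may be doubled as long as the volume remains below \<open>p / N\<close>; log-convexity then removes it at the
  cost of a square root of the trivial bound \<open>c\<close>.\<close>

lemma energy_ratio_le_powr:
  assumes c: "1 \<le> c"
    and bound: "\<And>v. length v \<le> l \<Longrightarrow> set v \<subseteq> {1..A} \<Longrightarrow> prod_list v * card G \<le> p \<Longrightarrow> energy_ratio G v \<le> c"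
    and R: "R * A * card G \<le> p"
    and v: "length v < l" "set v \<subseteq> {1..A}" "prod_list v \<le> R"
  shows "energy_ratio G v \<le> c powr (1 - (1 / 2) ^ length v)"
  using v
proof (induction v)
  case Nil
  then show ?case using energy_ratio_Nil[OF card_G_pos] c by simp
next
  case (Cons a v)
  let ?\<theta> = "(1 / 2) ^ length v :: real"
  have a: "1 \<le> a" "a \<le> A" using Cons.prems(2) by auto
  have "prod_list v \<le> a * prod_list v" using a(1) by simp
  also have "\<dots> \<le> R" using Cons.prems(3) by simp
  finally have "energy_ratio G v \<le> c powr (1 - ?\<theta>)" using Cons by simp
  moreover have "energy_ratio G (a # a # v) \<le> c"
  proof (rule bound)
    have "a * (a * prod_list v) \<le> A * R" using a Cons.prems by (intro mult_le_mono) auto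
    then have "a * (a * prod_list v) * card G \<le> A * R * card G" by (rule mult_le_mono1)
    also have "\<dots> \<le> p" using R by (simp add: mult.commute[of A R])
    finally show "prod_list (a # a # v) * card G \<le> p" by simp
  qed (use Cons.prems in auto)
  ultimately have "energy_ratio G (a # a # v) * energy_ratio G v \<le> c * c powr (1 - ?\<theta>)"
    using c energy_ratio_nonneg by (intro mult_mono) auto
  then have "(energy_ratio G (a # v))\<^sup>2 \<le> c * c powr (1 - ?\<theta>)" using energy_ratio_log_convex by (rule order_trans[rotated])
  also have "\<dots> = (c powr (1 - (1 / 2) ^ length (a # v)))\<^sup>2"
    using c powr_add[of c 1 "1 - ?\<theta>"] by (simp add: power2_eq_square flip: powr_add)
  finally show ?case by (rule power2_le_imp_le) simp
qed

lemma energy_ratio_le_powr_full_length: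
  assumes c: "1 \<le> c"
    and bound: "\<And>v. length v \<le> l \<Longrightarrow> set v \<subseteq> {1..A} \<Longrightarrow> prod_list v * card G \<le> p \<Longrightarrow> energy_ratio G v \<le> c"
    and R: "R * A * card G \<le> p" "R \<le> A\<^sup>2"
    and F: "length F = l" "4 \<le> l" "set F \<subseteq> {1..A}" "prod_list F \<le> R"
  shows "energy_ratio G F \<le> real (D\<^sup>2) * c powr (1 - (1 / 2) ^ (l - 1))"
proof -
  obtain a b w where abw: "mset F = mset (a # b # w)" "a * b \<le> A"
    using ex_small_product_of_two[of F A] F R(2) by fastforce
  have set_F: "set F = set (a # b # w)" using abw(1) by (rule mset_eq_setD)
  have length_F: "length F = length (a # b # w)" using abw(1) by (rule mset_eq_length)
  have prod_F: "prod_list F = a * b * prod_list w"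
    using abw(1) by (metis prod_mset_prod_list prod_list.Cons mult.assoc)
  have ab: "1 \<le> a" "1 \<le> b" and w: "set w \<subseteq> {1..A}" using set_F F(3) by auto
  have "energy_ratio G F = energy_ratio G (a # b # w)" using abw(1) by (rule energy_ratio_mset)
  also have "\<dots> \<le> real (D\<^sup>2) * energy_ratio G ((a * b) # w)"
    using ab abw(2) A_less entries_less[OF w] by (intro energy_ratio_merge num_divisors_le) auto
  also have "\<dots> \<le> real (D\<^sup>2) * c powr (1 - (1 / 2) ^ length ((a * b) # w))"
    using ab abw(2) w F length_F prod_F
    by (intro mult_left_mono energy_ratio_le_powr[OF c bound R(1)]) auto
  also have "length ((a * b) # w) = l - 1" using F(1) length_F by simp
  finally show ?thesis .
qed

lemma short_boxes_subset: "short_boxes l \<subseteq> {F. length F = l \<and> set F \<subseteq> {1..A} \<and> prod_list F \<le> 2 ^ l * card G}"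
  using short_boxes_entries by (auto simp: short_boxes_def dyadic_boxes_def)

lemma energy_ratio_le:
  assumes l: "4 \<le> l" and R: "2 ^ l * card G * A * card G \<le> p" "2 ^ l * card G \<le> A\<^sup>2"
    and v: "length v \<le> l" "set v \<subseteq> {1..A}" "prod_list v * card G \<le> p"
  shows "energy_ratio G v \<le> (real (D\<^sup>2) * energy_loss l) ^ (2 ^ (l - 1))"
proof -
  define Q where "Q = Max (insert 1 (energy_ratio G ` short_boxes l))"
  define c where "c = energy_loss l * Q"
  have fin: "finite (short_boxes l)" by (simp add: short_boxes_def finite_dyadic_boxes)
  have Q_ge_1: "1 \<le> Q" unfolding Q_def using fin by (intro Max_ge) auto
  have Q: "energy_ratio G F \<le> Q" if "F \<in> short_boxes l" for F
    unfolding Q_def using fin that by (intro Max_ge) auto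
  have c: "1 \<le> c" using mult_mono[OF energy_loss_ge_1 Q_ge_1] by (simp add: c_def energy_loss_def)
  have bound: "energy_ratio G u \<le> c" if u: "length u \<le> l" "set u \<subseteq> {1..A}" "prod_list u * card G \<le> p" for u
  proof -
    have "energy_ratio G (replicate (l - length u) (Suc 0) @ u) \<le> c"
      using energy_ratio_le_if_short_boxes[of "replicate (l - length u) (Suc 0) @ u" Q] u Q Q_ge_1 A_ge_1
      by (simp add: c_def set_replicate_conv_if)
    then show ?thesis by (simp only: energy_ratio_replicate_1_append)
  qed
  let ?\<theta> = "(1 / 2) ^ (l - 1) :: real"
  have "Q \<in> insert 1 (energy_ratio G ` short_boxes l)" unfolding Q_def using fin by (intro Max_in) auto
  then have "Q \<le> real (D\<^sup>2) * c powr (1 - ?\<theta>)"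
  proof
    assume "Q = 1"
    have "1 * 1 \<le> real (D\<^sup>2) * c powr (1 - ?\<theta>)"
      using D_ge_1 c by (intro mult_mono ge_one_powr_ge_zero) (auto simp: power_le_one)
    then show ?thesis using \<open>Q = 1\<close> by simp
  next
    assume "Q \<in> energy_ratio G ` short_boxes l"
    then obtain F where "F \<in> short_boxes l" "Q = energy_ratio G F" by auto
    then show ?thesis
      using short_boxes_subset l by (simp only:) (rule energy_ratio_le_powr_full_length[OF c bound R], auto)
  qed
  then have "c \<le> energy_loss l * (real (D\<^sup>2) * c powr (1 - ?\<theta>))"
    unfolding c_def using energy_loss_ge_1[of l] by (intro mult_left_mono) auto
  then have "c \<le> (real (D\<^sup>2) * energy_loss l) ^ (2 ^ (l - 1))"
    using c by (intro le_power_if_le_mult_powr) (simp_all add: mult_ac)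
  then show ?thesis using bound[OF v] by simp
qed

lemma energy_loss_power_le:
  fixes x c c' :: real
  assumes "real D \<le> c * x" "real (L + 1) \<le> c' * x"
  shows "(real (D\<^sup>2) * energy_loss l) ^ k \<le>
    (c\<^sup>2 * (20 * c ^ (2 * l) * 2 ^ l * c' ^ (2 * l))) ^ k * x ^ ((4 * l + 2) * k)"
proof -
  have nonneg: "0 \<le> c * x" "0 \<le> c' * x" using assms by linarith+
  have "(real (D\<^sup>2) * energy_loss l) ^ k \<le>
      ((c * x)\<^sup>2 * (20 * (c * x) ^ (2 * l) * 2 ^ l * (c' * x) ^ (2 * l))) ^ k"
    unfolding of_nat_power energy_loss_def using assms nonneg by (intro power_mono mult_mono) auto
  also have "(c * x)\<^sup>2 * (20 * (c * x) ^ (2 * l) * 2 ^ l * (c' * x) ^ (2 * l)) =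
      (c\<^sup>2 * (20 * c ^ (2 * l) * 2 ^ l * c' ^ (2 * l))) * (x ^ 2 * x ^ (2 * l) * x ^ (2 * l))"
    by (simp add: power_mult_distrib mult_ac)
  also have "x ^ 2 * x ^ (2 * l) * x ^ (2 * l) = x ^ (4 * l + 2)" by (simp flip: power_add)
  finally show ?thesis by (simp only: power_mult_distrib power_mult)
qed

end

lemma ex_dyadic_exponent:
  assumes "0 < \<mu>"
  shows "\<exists>C>0. \<forall>p\<ge>2. \<exists>L. p \<le> 2 ^ L \<and> real (L + 1) \<le> C * real p powr \<mu>"
proof (intro exI[of _ "3 + 1 / (\<mu> * ln 2)"] conjI allI impI)
  show "0 < 3 + 1 / (\<mu> * ln 2)" using assms by (intro add_pos_pos) auto
  fix p :: nat assume p: "2 \<le> p"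
  define L where "L = nat \<lceil>log 2 (real p)\<rceil>"
  have "real p = 2 powr log 2 (real p)" using p by simp
  also have "\<dots> \<le> 2 powr real L" unfolding L_def by (intro powr_mono) (auto intro: real_nat_ceiling_ge)
  finally have "real p \<le> real (2 ^ L)" by (simp add: powr_realpow)
  then have "p \<le> 2 ^ L" by (simp only: of_nat_le_iff)
  moreover have "real (L + 1) \<le> (3 + 1 / (\<mu> * ln 2)) * real p powr \<mu>"
  proof -
    have "ln (real p) \<le> real p powr \<mu> / \<mu>" using p assms by (intro ln_powr_bound) auto
    then have "log 2 (real p) \<le> real p powr \<mu> / \<mu> / ln 2" unfolding log_def by (intro divide_right_mono) auto
    moreover have "0 \<le> log 2 (real p)" using p by simp
    then have "real L \<le> log 2 (real p) + 1" unfolding L_def by linarith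
    moreover have "1 \<le> real p powr \<mu>" using p assms by (intro ge_one_powr_ge_zero) auto
    ultimately show ?thesis by (simp add: ring_distribs)
  qed
  ultimately show "\<exists>L. p \<le> 2 ^ L \<and> real (L + 1) \<le> (3 + 1 / (\<mu> * ln 2)) * real p powr \<mu>" by blast
qed

theorem energy_ratio_bound:
  fixes \<kappa> :: real and l :: nat
  assumes \<kappa>: "0 < \<kappa>" and l: "4 \<le> l"
  shows "\<exists>C>0. \<forall>p A v G. prime p \<longrightarrow> G \<subseteq> {1..<int p} \<longrightarrow> 0 < card G \<longrightarrow> 1 \<le> A \<longrightarrow> A < p \<longrightarrow>
    2 ^ l * card G * A * card G \<le> p \<longrightarrow> 2 ^ l * card G \<le> A\<^sup>2 \<longrightarrow> length v \<le> l \<longrightarrow> set v \<subseteq> {1..A} \<longrightarrow>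
    prod_list v * card G \<le> p \<longrightarrow> prime_mod.energy_ratio p G v \<le> C * real p powr \<kappa>"
proof -
  define e where "e = (4 * l + 2) * 2 ^ (l - 1)"
  define \<mu> where "\<mu> = \<kappa> / real e"
  have e: "0 < e" by (simp add: e_def)
  then have \<mu>: "0 < \<mu>" using \<kappa> by (simp add: \<mu>_def)
  obtain Cd where Cd: "1 \<le> Cd" "\<And>n. 0 < n \<Longrightarrow> real (num_divisors n) \<le> Cd * real n powr \<mu>"
    using divisor_bound[OF \<mu>] by auto
  obtain Cl where Cl: "0 < Cl" "\<And>p. 2 \<le> p \<Longrightarrow> \<exists>L. p \<le> 2 ^ L \<and> real (L + 1) \<le> Cl * real p powr \<mu>"
    using ex_dyadic_exponent[OF \<mu>] by auto
  define C where "C = (Cd\<^sup>2 * (20 * Cd ^ (2 * l) * 2 ^ l * Cl ^ (2 * l))) ^ (2 ^ (l - 1))"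
  show ?thesis
  proof (intro exI[of _ C] conjI allI impI)
    show "0 < C" using Cd(1) Cl(1) by (simp add: C_def)
    fix p A v and G :: "int set"
    assume p: "prime p" and G: "G \<subseteq> {1..<int p}" "0 < card G" and A: "1 \<le> A" "A < p"
      and R: "2 ^ l * card G * A * card G \<le> p" "2 ^ l * card G \<le> A\<^sup>2"
      and v: "length v \<le> l" "set v \<subseteq> {1..A}" "prod_list v * card G \<le> p"
    define x where "x = real p powr \<mu>"
    have p_ge_2: "2 \<le> p" using p by (rule prime_ge_2_nat)
    have x: "1 \<le> x" unfolding x_def using p_ge_2 \<mu> by (intro ge_one_powr_ge_zero) auto
    define D where "D = nat \<lfloor>Cd * x\<rfloor>"
    have D_le: "real D \<le> Cd * x" unfolding D_def using Cd(1) x by simp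
    have D: "num_divisors n \<le> D" if "0 < n" "n < p" for n
    proof -
      have "real (num_divisors n) \<le> Cd * real n powr \<mu>" using Cd(2) that by simp
      also have "\<dots> \<le> Cd * x" unfolding x_def using that Cd(1) \<mu> by (intro mult_left_mono powr_mono2) auto
      finally show ?thesis unfolding D_def by (simp add: le_nat_floor)
    qed
    obtain L where L: "p \<le> 2 ^ L" "real (L + 1) \<le> Cl * x" using Cl(2)[OF p_ge_2] unfolding x_def by blast
    interpret box_energy p G D A L using p G A L(1) D by unfold_locales auto
    have "energy_ratio G v \<le> (real (D\<^sup>2) * energy_loss l) ^ (2 ^ (l - 1))" by (rule energy_ratio_le[OF l R v])
    also have "\<dots> \<le> C * x ^ e"
      unfolding C_def e_def using D_le L(2) by (rule energy_loss_power_le)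
    also have "x ^ e = real p powr \<kappa>"
      unfolding x_def using p_ge_2 e by (simp add: \<mu>_def powr_powr flip: powr_realpow)
    finally show "energy_ratio G v \<le> C * real p powr \<kappa>" .
  qed
qed

section \<open>Residues that are not represented\<close>

definition unrepresented :: "nat \<Rightarrow> nat \<Rightarrow> int set \<Rightarrow> int set" where
  "unrepresented p H G = {x \<in> {1..<int p}. \<forall>g\<in>G. \<forall>h\<in>{1..H}. \<not> [g * int h = x] (mod int p)}"

lemma unrepresented_subset: "unrepresented p H G \<subseteq> {1..<int p}"
  by (auto simp: unrepresented_def)

lemma finite_unrepresented: "finite (unrepresented p H G)"
  using unrepresented_subset by (rule finite_subset) simp

lemma card_unrepresented_le: "card (unrepresented p H G) \<le> p"
  using card_mono[OF _ unrepresented_subset, of p H G] by simp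

lemma unrepresented_antimono: "G' \<subseteq> G \<Longrightarrow> H' \<le> H \<Longrightarrow> unrepresented p H G \<subseteq> unrepresented p H' G'"
  by (fastforce simp: unrepresented_def)

text \<open>If \<open>x\<close> is small, save one factor \<open>x\<close>; otherwise \<open>x\<close> is so large that replacing \<open>b\<close> by its bound \<open>r\<close> pays for
  \<open>n\<close> further factors \<open>x\<close>.\<close>

lemma power_split_square_le:
  fixes a b r w x :: real
  assumes "0 \<le> a" "0 \<le> b" "b \<le> r" "0 \<le> x" "0 < w"
  shows "(a * b * x ^ Suc i)\<^sup>2 \<le> w\<^sup>2 * (a * b * x ^ i)\<^sup>2 + (r / w ^ n)\<^sup>2 * (a * x ^ (n + Suc i))\<^sup>2"
proof (cases "x \<le> w")
  case True
  then have "x * (a * b * x ^ i) \<le> w * (a * b * x ^ i)" using assms by (intro mult_right_mono) auto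
  then have "a * b * x ^ Suc i \<le> w * (a * b * x ^ i)" by (simp add: mult_ac)
  then have "(a * b * x ^ Suc i)\<^sup>2 \<le> (w * (a * b * x ^ i))\<^sup>2" using assms by (intro power_mono) auto
  then show ?thesis by (simp add: power_mult_distrib add_increasing2)
next
  case False
  then have "1 \<le> x ^ n / w ^ n" using assms by (simp add: power_mono)
  then have "(a * x ^ Suc i) * b \<le> (a * x ^ Suc i) * (r * (x ^ n / w ^ n))"
    using assms mult_mono[of b r 1 "x ^ n / w ^ n"] by (intro mult_left_mono) auto
  then have "a * b * x ^ Suc i \<le> r / w ^ n * (a * x ^ (n + Suc i))" by (simp add: power_add mult_ac)
  then have "(a * b * x ^ Suc i)\<^sup>2 \<le> (r / w ^ n * (a * x ^ (n + Suc i)))\<^sup>2" using assms by (intro power_mono) auto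
  also have "\<dots> = (r / w ^ n)\<^sup>2 * (a * x ^ (n + Suc i))\<^sup>2" by (rule power_mult_distrib)
  finally show ?thesis by (simp add: add_increasing)
qed

context prime_mod
begin

lemma card_missed_residues_le:
  assumes A: "finite A" "\<And>a. a \<in> A \<Longrightarrow> \<not> int p dvd f a" and E: "E \<subseteq> {1..<int p}"
    and missed: "\<And>a x. a \<in> A \<Longrightarrow> x \<in> E \<Longrightarrow> \<not> [f a = x] (mod int p)"
  shows "real (card E) * (real (card A))\<^sup>2 \<le> real (p - 1) * (\<Sum>k=1..<p - 1. (cmod (\<Sum>a\<in>A. dchar p k (f a)))\<^sup>2)"
proof (cases "card E = 0")
  case True
  then show ?thesis by (simp add: sum_nonneg)
next
  case False
  define s where "s k = (\<Sum>x\<in>E. dchar p k x)" for k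
  define t where "t k = (\<Sum>a\<in>A. dchar p k (f a))" for k
  have finite_E: "finite E" using E finite_subset by blast
  have not_dvd_E: "\<not> int p dvd x" if "x \<in> E" for x using that E by (auto dest!: zdvd_imp_le)
  have "(\<Sum>k<p - 1. t k * cnj (s k)) = of_nat ((p - 1) * card {(a, x) \<in> A \<times> E. [f a = x] (mod int p)})"
    unfolding s_def t_def using A finite_E not_dvd_E by (intro bilinear_orthogonality) auto
  also have "{(a, x) \<in> A \<times> E. [f a = x] (mod int p)} = {}" using missed by auto
  finally have "(\<Sum>k\<in>insert 0 {1..<p - 1}. t k * cnj (s k)) = 0"
    using p_ge_2 by (simp add: atLeast1_lessThan_eq_remove0 insert_absorb)
  then have "t 0 * cnj (s 0) = - (\<Sum>k=1..<p - 1. t k * cnj (s k))" by (simp add: eq_neg_iff_add_eq_0)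
  moreover have "t 0 = of_nat (card A)" "s 0 = of_nat (card E)"
    using A(2) not_dvd_E by (simp_all add: s_def t_def dchar_principal)
  ultimately have "of_nat (card A) * of_nat (card E) = - (\<Sum>k=1..<p - 1. t k * cnj (s k))" by simp
  then have "real (card A) * real (card E) = cmod (\<Sum>k=1..<p - 1. t k * cnj (s k))"
    by (metis norm_minus_cancel norm_mult norm_of_nat)
  also have "\<dots> \<le> (\<Sum>k=1..<p - 1. cmod (t k) * cmod (s k))"
    using norm_sum[of "\<lambda>k. t k * cnj (s k)" "{1..<p - 1}"] by (simp add: norm_mult)
  finally have "(real (card A) * real (card E))\<^sup>2 \<le> (\<Sum>k=1..<p - 1. cmod (t k) * cmod (s k))\<^sup>2"
    by (intro power_mono) auto
  also have "\<dots> \<le> (\<Sum>k=1..<p - 1. (cmod (t k))\<^sup>2) * (\<Sum>k=1..<p - 1. (cmod (s k))\<^sup>2)"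
    by (rule Cauchy_Schwarz_ineq_sum)
  also have "\<dots> \<le> (\<Sum>k=1..<p - 1. (cmod (t k))\<^sup>2) * (\<Sum>k<p - 1. (cmod (s k))\<^sup>2)"
    by (intro mult_left_mono sum_mono2 sum_nonneg) auto
  also have "\<dots> = (\<Sum>k=1..<p - 1. (cmod (t k))\<^sup>2) * real ((p - 1) * card E)"
    unfolding s_def second_moment_residues[OF E] ..
  finally have "real (card E) * (real (card E) * (real (card A))\<^sup>2) \<le>
      real (card E) * (real (p - 1) * (\<Sum>k=1..<p - 1. (cmod (t k))\<^sup>2))"
    by (simp add: power2_eq_square mult_ac)
  then show ?thesis using False by (simp add: t_def)
qed

lemma norm_box_sum: "cmod (box_sum G v k) = cmod (\<Sum>g\<in>G. dchar p k g) * (\<Prod>a\<leftarrow>v. cmod (interval_sum p k a))"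
proof -
  have "cmod (prod_list (map (interval_sum p k) v)) = (\<Prod>a\<leftarrow>v. cmod (interval_sum p k a))"
    by (induction v) (simp_all add: norm_mult)
  then show ?thesis by (simp add: box_sum_def norm_mult)
qed

lemma sum_nonprincipal_box_sum_le:
  assumes w: "0 < w" and r: "\<And>k. 0 < k \<Longrightarrow> k < p - 1 \<Longrightarrow> cmod (interval_sum p k A) \<le> r"
  shows "(\<Sum>k=1..<p - 1. (cmod (box_sum G (A # replicate (Suc i) U) k))\<^sup>2) \<le> real (p - 1) *
    (w\<^sup>2 * energy G (A # replicate i U) + (r / w ^ n)\<^sup>2 * energy G (replicate (n + Suc i) U))"
proof -
  let ?P = "\<lambda>k. cmod (box_sum G (A # replicate i U) k)" and ?Q = "\<lambda>k. cmod (box_sum G (replicate (n + Suc i) U) k)"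
  have "(\<Sum>k=1..<p - 1. (cmod (box_sum G (A # replicate (Suc i) U) k))\<^sup>2) \<le>
      (\<Sum>k=1..<p - 1. w\<^sup>2 * (?P k)\<^sup>2 + (r / w ^ n)\<^sup>2 * (?Q k)\<^sup>2)"
  proof (rule sum_mono)
    fix k assume "k \<in> {1..<p - 1}"
    then have "cmod (interval_sum p k A) \<le> r" by (intro r) auto
    then show "(cmod (box_sum G (A # replicate (Suc i) U) k))\<^sup>2 \<le> w\<^sup>2 * (?P k)\<^sup>2 + (r / w ^ n)\<^sup>2 * (?Q k)\<^sup>2"
      using power_split_square_le[of "cmod (\<Sum>g\<in>G. dchar p k g)" "cmod (interval_sum p k A)" r
          "cmod (interval_sum p k U)" w i n] w
      by (simp add: norm_box_sum prod_list_replicate mult_ac)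
  qed
  also have "\<dots> \<le> (\<Sum>k<p - 1. w\<^sup>2 * (?P k)\<^sup>2 + (r / w ^ n)\<^sup>2 * (?Q k)\<^sup>2)" by (intro sum_mono2) auto
  also have "\<dots> = w\<^sup>2 * (\<Sum>k<p - 1. (?P k)\<^sup>2) + (r / w ^ n)\<^sup>2 * (\<Sum>k<p - 1. (?Q k)\<^sup>2)"
    by (simp only: sum.distrib sum_distrib_left)
  finally show ?thesis unfolding sum_norm_box_sum_square by (simp add: algebra_simps)
qed

end

context residue_set
begin

lemma card_unrepresented_mult_le:
  assumes v: "\<forall>a\<in>set v. a < p"
  shows "real (card (unrepresented p (prod_list v) G)) * (real (card G) * real (prod_list v))\<^sup>2 \<le>
    real (p - 1) * (\<Sum>k=1..<p - 1. (cmod (box_sum G v k))\<^sup>2)"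
proof -
  let ?E = "unrepresented p (prod_list v) G" and ?f = "\<lambda>z. fst z * int (prod_list (snd z))"
  have "real (card ?E) * (real (card (G \<times> nat_box v)))\<^sup>2 \<le>
      real (p - 1) * (\<Sum>k=1..<p - 1. (cmod (\<Sum>z\<in>G \<times> nat_box v. dchar p k (?f z)))\<^sup>2)"
  proof (rule card_missed_residues_le[OF _ not_dvd_G_mult_nat_box[OF v] unrepresented_subset])
    fix z x assume "z \<in> G \<times> nat_box v" "x \<in> ?E"
    then show "\<not> [?f z = x] (mod int p)"
      using prod_list_nat_box[of "snd z" v] by (auto simp: unrepresented_def)
  qed (simp add: finite_G)
  then show ?thesis by (simp add: card_cartesian_product card_nat_box box_sum_eq)
qed

lemma card_unrepresented_power_le:
  assumes G: "0 < card G" and U: "0 < U" and \<eta>: "0 < \<eta>" and less: "U ^ Suc n < p"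
    and \<rho>: "\<And>k. 0 < k \<Longrightarrow> k < p - 1 \<Longrightarrow> cmod (interval_sum p k (U ^ Suc n)) \<le> \<rho> * real (U ^ Suc n)"
    and c: "energy_ratio G (U ^ Suc n # replicate i U) \<le> c" "energy_ratio G (replicate (n + Suc i) U) \<le> c"
    and large: "p \<le> 2 * (card G * U ^ (n + Suc i))"
  shows "real (card (unrepresented p (U ^ (n + Suc (Suc i))) G)) \<le> 2 * c * real p * (\<eta>\<^sup>2 + (\<rho> / \<eta> ^ n)\<^sup>2)"
proof -
  let ?v = "U ^ Suc n # replicate (Suc i) U" and ?u = "real U" and ?E = "unrepresented p (U ^ (n + Suc (Suc i))) G"
  define w where "w = real (card G) * real (U ^ (n + Suc i))"
  define z where "z = \<eta>\<^sup>2 + (\<rho> / \<eta> ^ n)\<^sup>2"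
  have w: "0 < w" using G U by (simp add: w_def)
  have "U \<le> U ^ Suc n" using U by (simp add: self_le_power)
  then have "U < p" using less by (rule le_less_trans)
  then have v: "\<forall>a\<in>set ?v. a < p" using less by auto
  have prod_v: "prod_list ?v = U ^ (n + Suc (Suc i))" "real (prod_list ?v) = ?u * real (U ^ (n + Suc i))"
    by (simp_all add: prod_list_replicate power_add)
  have energies: "energy G (U ^ Suc n # replicate i U) \<le> c * w" "energy G (replicate (n + Suc i) U) \<le> c * w"
    using energy_le_if_energy_ratio_le[OF c(1) G] energy_le_if_energy_ratio_le[OF c(2) G] U
    by (simp_all add: w_def prod_list_replicate power_add mult_ac)
  have "real (card ?E) * (w * ?u)\<^sup>2 \<le> real (p - 1) * (\<Sum>k=1..<p - 1. (cmod (box_sum G ?v k))\<^sup>2)"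
    using card_unrepresented_mult_le[OF v] unfolding prod_v(2) unfolding prod_v(1) by (simp add: w_def mult_ac)
  also have "\<dots> \<le> real (p - 1) * (real (p - 1) *
      ((?u * \<eta>)\<^sup>2 * energy G (U ^ Suc n # replicate i U) +
       (\<rho> * real (U ^ Suc n) / (?u * \<eta>) ^ n)\<^sup>2 * energy G (replicate (n + Suc i) U)))"
    using U \<eta> \<rho> by (intro mult_left_mono sum_nonprincipal_box_sum_le) auto
  also have "\<dots> \<le> real p * (real p * ((?u * \<eta>)\<^sup>2 * (c * w) + (\<rho> * real (U ^ Suc n) / (?u * \<eta>) ^ n)\<^sup>2 * (c * w)))"
    using energies energy_nonneg by (intro mult_mono add_mono mult_left_mono add_nonneg_nonneg mult_nonneg_nonneg) auto
  also have "\<rho> * real (U ^ Suc n) / (?u * \<eta>) ^ n = ?u * (\<rho> / \<eta> ^ n)"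
    using U by (simp add: power_mult_distrib)
  also have "real p * (real p * ((?u * \<eta>)\<^sup>2 * (c * w) + (?u * (\<rho> / \<eta> ^ n))\<^sup>2 * (c * w))) = (w * ?u\<^sup>2) * ((real p)\<^sup>2 * c * z)"
    unfolding power_mult_distrib z_def by (simp add: power2_eq_square algebra_simps)
  finally have "(w * ?u\<^sup>2) * (real (card ?E) * w) \<le> (w * ?u\<^sup>2) * ((real p)\<^sup>2 * c * z)"
    by (simp add: power2_eq_square mult_ac)
  then have card_le: "real (card ?E) * w \<le> (real p)\<^sup>2 * c * z" using w U by simp
  have "real p \<le> real (2 * (card G * U ^ (n + Suc i)))" using large by (simp only: of_nat_le_iff)
  then have "real (card ?E) * real p \<le> real (card ?E) * (2 * w)" by (intro mult_left_mono) (simp_all add: w_def)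
  also have "\<dots> \<le> real p * (2 * c * real p * z)" using card_le by (simp add: power2_eq_square mult_ac)
  finally show ?thesis using p_ge_2 by (simp add: z_def mult.commute[of _ "real p"])
qed

end

lemma ex_box_exponents:
  fixes \<epsilon> :: real
  assumes "0 < \<epsilon>" "\<epsilon> \<le> 1 / 16"
  shows "\<exists>u n i. 0 < u \<and> u * real (Suc n) = 1 / 4 + \<epsilon> / 2 \<and> 3 / 8 \<le> u * real i \<and>
    u * real (n + Suc (Suc i)) \<le> 5 / 8 + 3 * \<epsilon> / 4 \<and> 4 \<le> n + Suc i"
proof -
  let ?\<alpha> = "1 / 4 + \<epsilon> / 2"
  define n where "n = nat \<lceil>8 * ?\<alpha> / \<epsilon>\<rceil>"
  define u where "u = ?\<alpha> / real (Suc n)"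
  define i where "i = nat \<lceil>3 / (8 * u)\<rceil>"
  have u: "0 < u" "u * real (Suc n) = ?\<alpha>" using assms by (simp_all add: u_def)
  have "8 * ?\<alpha> / \<epsilon> \<le> real (Suc n)" unfolding n_def by linarith
  then have u_le: "u \<le> \<epsilon> / 8" using assms by (simp add: u_def field_simps)
  have "0 \<le> 3 / (8 * u)" using u by simp
  then have i: "3 / (8 * u) \<le> real i" "real i \<le> 3 / (8 * u) + 1" unfolding i_def by linarith+
  then have "u * (3 / (8 * u)) \<le> u * real i" "u * real i \<le> u * (3 / (8 * u) + 1)"
    using u(1) by (simp_all only: mult_left_mono less_imp_le)
  then have ui: "3 / 8 \<le> u * real i" "u * real i \<le> 3 / 8 + u" using u(1) by (simp_all add: ring_distribs)
  have "u * real (n + Suc (Suc i)) = ?\<alpha> + u * real i + u" using u(2) by (simp add: algebra_simps)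
  then have "u * real (n + Suc (Suc i)) \<le> 5 / 8 + 3 * \<epsilon> / 4" using ui(2) u_le by simp
  moreover have "4 \<le> i"
  proof -
    have "u * 4 \<le> u * real i" using ui(1) u_le assms by simp
    then show ?thesis using u(1) by simp
  qed
  ultimately show ?thesis using u ui(1) by (intro exI[of _ u] exI[of _ n] exI[of _ i]) simp
qed

lemma eventually_ex_power_approx:
  fixes u :: real
  assumes u: "0 < u"
  shows "\<forall>\<^sub>F x in at_top. \<exists>U>0. \<forall>k\<le>K. x powr (u * real k) \<le> real (U ^ k) \<and> real (U ^ k) \<le> 2 * x powr (u * real k)"
proof -
  have "((\<lambda>x. (1 + x powr - u) ^ K) \<longlongrightarrow> (1 + 0) ^ K) at_top"
    by (intro tendsto_intros tendsto_neg_powr u filterlim_ident) (use u in auto)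
  then have "\<forall>\<^sub>F x in at_top. (1 + x powr - u) ^ K < 2" by (rule order_tendstoD) simp
  then show ?thesis
    using eventually_ge_at_top[of 1]
  proof eventually_elim
    case (elim x)
    define U where "U = nat \<lceil>x powr u\<rceil>"
    have "1 \<le> x powr u" using elim u by (intro ge_one_powr_ge_zero) auto
    then have U: "x powr u \<le> real U" "real U \<le> x powr u + 1" unfolding U_def by linarith+
    then have U_pos: "0 < U" using \<open>1 \<le> x powr u\<close> by (cases U) auto
    have powr_eq: "(x powr u) ^ k = x powr (u * real k)" for k
      using elim by (simp add: powr_powr flip: powr_realpow)
    have "x powr (u * real k) \<le> real (U ^ k)" for k
      unfolding powr_eq[symmetric] of_nat_power using U(1) by (intro power_mono) auto
    moreover have "real (U ^ k) \<le> 2 * x powr (u * real k)" if "k \<le> K" for k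
    proof -
      have "real (U ^ k) \<le> (x powr u + 1) ^ k" unfolding of_nat_power using U(2) by (intro power_mono) auto
      also have "x powr u + 1 = x powr u * (1 + x powr - u)" using elim by (simp add: ring_distribs flip: powr_add)
      also have "(x powr u * (1 + x powr - u)) ^ k = x powr (u * real k) * (1 + x powr - u) ^ k"
        by (simp add: power_mult_distrib powr_eq)
      also have "\<dots> \<le> x powr (u * real k) * (1 + x powr - u) ^ K"
        using that by (intro mult_left_mono power_increasing) auto
      also have "\<dots> \<le> x powr (u * real k) * 2" using elim(1) by (intro mult_left_mono) auto
      finally show ?thesis by simp
    qed
    ultimately show ?case using U_pos by blast
  qed
qed

lemma eventually_powr_ge:
  fixes a c :: real
  assumes "0 < a"
  shows "\<forall>\<^sub>F x in at_top. c \<le> x powr a"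
  using filterlim_at_top[of "\<lambda>x. x powr a" at_top] real_powr_at_top[OF assms] by auto

lemma power_saving_square_le:
  fixes x :: real
  assumes "1 \<le> x" "0 \<le> c" "\<tau> * real (Suc n) \<le> \<delta>"
  shows "(x powr (- \<tau>))\<^sup>2 + (c * x powr (- \<delta>) / (x powr (- \<tau>)) ^ n)\<^sup>2 \<le> (1 + c\<^sup>2) * x powr (- 2 * \<tau>)"
proof -
  have "(x powr (- \<tau>)) ^ n = x powr (- \<tau> * real n)" using assms(1) by (simp add: powr_powr flip: powr_realpow)
  then have "x powr (- \<delta>) / (x powr (- \<tau>)) ^ n = x powr (- \<delta> - (- \<tau> * real n))" by (simp only: powr_diff)
  also have "\<dots> \<le> x powr (- \<tau>)" using assms by (intro powr_mono) (simp_all add: algebra_simps)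
  finally have "c * (x powr (- \<delta>) / (x powr (- \<tau>)) ^ n) \<le> c * x powr (- \<tau>)" using assms(2) by (rule mult_left_mono)
  then have "(c * x powr (- \<delta>) / (x powr (- \<tau>)) ^ n)\<^sup>2 \<le> (c * x powr (- \<tau>))\<^sup>2" using assms(2) by (intro power_mono) auto
  moreover have "(x powr (- \<tau>))\<^sup>2 = x powr (- 2 * \<tau>)" by (simp add: power2_eq_square flip: powr_add)
  ultimately show ?thesis by (simp add: power_mult_distrib ring_distribs)
qed

locale box_sizes = residue_set +
  fixes \<epsilon> u :: real and n i U :: nat
  assumes \<epsilon>: "0 < \<epsilon>" "\<epsilon> \<le> 1 / 16"
    and u_Suc_n: "u * real (Suc n) = 1 / 4 + \<epsilon> / 2" and u_i: "3 / 8 \<le> u * real i"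
    and u_total: "u * real (n + Suc (Suc i)) \<le> 5 / 8 + 3 * \<epsilon> / 4"
    and U_pos: "0 < U"
    and power_U: "\<And>k. k \<le> n + Suc (Suc i) \<Longrightarrow>
      real p powr (u * real k) \<le> real (U ^ k) \<and> real (U ^ k) \<le> 2 * real p powr (u * real k)"
    and p_large: "2 \<le> real p powr (\<epsilon> / 4)" "2 ^ (n + Suc i) \<le> real p powr (\<epsilon> / 2)"
    and card_G_ge: "real p powr (3 / 8) \<le> real (card G)"
begin

lemma powr_mono_p: "a \<le> b \<Longrightarrow> real p powr a \<le> real p powr b"
  using p_ge_2 by (intro powr_mono) auto

definition A :: nat where "A = U ^ Suc n"

definition V :: nat where "V = U ^ (n + Suc i)"

definition N :: nat where "N = p div V"

lemma A_ge: "real p powr (1 / 4 + \<epsilon> / 2) \<le> real A" and A_le: "real A \<le> 2 * real p powr (1 / 4 + \<epsilon> / 2)"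
  using power_U[of "Suc n"] unfolding A_def u_Suc_n by simp_all

lemma volume_le: "real (U ^ (n + Suc (Suc i))) \<le> real p powr (5 / 8 + \<epsilon>)"
proof -
  have "real (U ^ (n + Suc (Suc i))) \<le> 2 * real p powr (u * real (n + Suc (Suc i)))" using power_U by blast
  also have "\<dots> \<le> real p powr (\<epsilon> / 4) * real p powr (5 / 8 + 3 * \<epsilon> / 4)"
    using p_large(1) powr_mono_p[OF u_total] by (intro mult_mono) auto
  also have "\<dots> = real p powr (5 / 8 + \<epsilon>)" by (simp add: add.commute flip: powr_add)
  finally show ?thesis .
qed

lemma V_pos: "0 < V"
  using U_pos by (simp add: V_def)

lemma V_less: "V < p"
proof -
  have "V \<le> U ^ (n + Suc (Suc i))" unfolding V_def using U_pos by (intro power_increasing) auto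
  then have "real V \<le> real p powr (5 / 8 + \<epsilon>)" using volume_le by linarith
  also have "\<dots> < real p powr 1" using p_ge_2 \<epsilon> by (intro powr_less_mono) auto
  finally show ?thesis using p_ge_2 by simp
qed

lemma U_le_A: "U \<le> A"
  unfolding A_def using U_pos by (simp add: self_le_power)

lemma A_mult_power: "A * U ^ i = V"
  by (simp add: A_def V_def power_add)

lemma A_less: "A < p"
proof -
  have "A * 1 \<le> A * U ^ i" using U_pos by (intro mult_le_mono) (simp_all add: Suc_leI)
  then show ?thesis using V_less by (simp add: A_mult_power)
qed

lemma N_pos: "0 < N"
  using V_less V_pos by (simp add: N_def div_greater_zero_iff)

lemma N_V_le: "N * V \<le> p"
  by (simp add: N_def)

lemma p_le_N_V: "p \<le> 2 * (N * V)"
proof -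
  have "p < N * V + V" unfolding N_def using dividend_less_div_times[OF V_pos, of p] by (simp add: add.commute)
  moreover have "V \<le> N * V" using N_pos by simp
  ultimately show ?thesis by linarith
qed

lemma N_le_powr: "real N \<le> real p powr (3 / 8 - \<epsilon> / 2)"
proof -
  have "5 / 8 + \<epsilon> / 2 \<le> u * real (n + Suc i)" using u_Suc_n u_i by (simp add: algebra_simps)
  then have "real p powr (5 / 8 + \<epsilon> / 2) \<le> real p powr (u * real (n + Suc i))" by (rule powr_mono_p)
  also have "\<dots> \<le> real V" unfolding V_def using power_U[of "n + Suc i"] by simp
  finally have "real p powr (5 / 8 + \<epsilon> / 2) \<le> real V" .
  then have "real N * real p powr (5 / 8 + \<epsilon> / 2) \<le> real N * real V" by (intro mult_left_mono) auto
  also have "\<dots> \<le> real p powr 1" using N_V_le p_ge_2 by (simp flip: of_nat_mult)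
  finally have "real N \<le> real p powr 1 / real p powr (5 / 8 + \<epsilon> / 2)"
    using p_ge_2 by (simp add: pos_le_divide_eq)
  then show ?thesis unfolding powr_diff[symmetric] by simp
qed

lemma N_le_card_G: "N \<le> card G"
proof -
  have "real N \<le> real p powr (3 / 8)" using N_le_powr powr_mono_p[of "3 / 8 - \<epsilon> / 2" "3 / 8"] \<epsilon> by simp
  then show ?thesis using card_G_ge by simp
qed

lemma dyadic_N_le_powr: "real (2 ^ (n + Suc i) * N) \<le> real p powr (3 / 8)"
proof -
  have "real (2 ^ (n + Suc i) * N) \<le> real p powr (\<epsilon> / 2) * real p powr (3 / 8 - \<epsilon> / 2)"
    unfolding of_nat_mult of_nat_power using p_large(2) N_le_powr by (intro mult_mono) auto
  then show ?thesis by (simp flip: powr_add)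
qed

lemma dyadic_N_A_N_le: "2 ^ (n + Suc i) * N * A * N \<le> p"
proof -
  have "real p powr (3 / 8) \<le> real (U ^ i)" using powr_mono_p[OF u_i] power_U[of i] by simp
  then have "real (2 ^ (n + Suc i) * N) \<le> real (U ^ i)" using dyadic_N_le_powr by linarith
  then have "2 ^ (n + Suc i) * N \<le> U ^ i" by (simp only: of_nat_le_iff)
  then have "(2 ^ (n + Suc i) * N) * (A * N) \<le> U ^ i * (A * N)" by (rule mult_le_mono1)
  also have "\<dots> = N * V" by (simp flip: A_mult_power)
  finally show ?thesis using N_V_le by (simp only: mult.assoc)
qed

lemma dyadic_N_le_square: "2 ^ (n + Suc i) * N \<le> A\<^sup>2"
proof -
  have "real p powr (3 / 8) \<le> real p powr ((1 / 4 + \<epsilon> / 2) + (1 / 4 + \<epsilon> / 2))" using \<epsilon> by (intro powr_mono_p) auto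
  also have "\<dots> = (real p powr (1 / 4 + \<epsilon> / 2))\<^sup>2" by (simp only: powr_add power2_eq_square)
  also have "\<dots> \<le> (real A)\<^sup>2" using A_ge by (intro power_mono) auto
  finally have "real (2 ^ (n + Suc i) * N) \<le> real (A\<^sup>2)" using dyadic_N_le_powr by simp
  then show ?thesis by (simp only: of_nat_le_iff)
qed

lemma card_unrepresented_le_powr:
  fixes C\<^sub>1 C\<^sub>2 \<delta> \<tau> :: real
  assumes H: "real p powr (5 / 8 + \<epsilon>) \<le> real H" and C: "0 \<le> C\<^sub>1" "0 \<le> C\<^sub>2" and \<tau>: "\<tau> * real (Suc n) \<le> \<delta>"
    and burgess: "\<And>k A. 0 < k \<Longrightarrow> k < p - 1 \<Longrightarrow> real p powr (1 / 4 + \<epsilon> / 2) \<le> real A \<Longrightarrow>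
      real A \<le> 2 * real p powr (1 / 4 + \<epsilon> / 2) \<Longrightarrow> cmod (interval_sum p k A) \<le> C\<^sub>1 * real A * real p powr (- \<delta>)"
    and energy: "\<And>A v G. G \<subseteq> {1..<int p} \<Longrightarrow> 0 < card G \<Longrightarrow> 1 \<le> A \<Longrightarrow> A < p \<Longrightarrow>
      2 ^ (n + Suc i) * card G * A * card G \<le> p \<Longrightarrow> 2 ^ (n + Suc i) * card G \<le> A\<^sup>2 \<Longrightarrow> length v \<le> n + Suc i \<Longrightarrow>
      set v \<subseteq> {1..A} \<Longrightarrow> prod_list v * card G \<le> p \<Longrightarrow> energy_ratio G v \<le> C\<^sub>2 * real p powr \<tau>"
  shows "real (card (unrepresented p H G)) \<le> 2 * C\<^sub>2 * (1 + C\<^sub>1\<^sup>2) * real p powr (1 - \<tau>)"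
proof -
  have "real (U ^ (n + Suc (Suc i))) \<le> real H" using volume_le H by (rule order_trans)
  then have U_H: "U ^ (n + Suc (Suc i)) \<le> H" by (simp only: of_nat_le_iff)
  obtain G' where G': "G' \<subseteq> G" "card G' = N" using obtain_subset_with_card_n[OF N_le_card_G] by metis
  interpret small: residue_set p G' using G_subset G'(1) by unfold_locales auto
  have energy': "energy_ratio G' v \<le> C\<^sub>2 * real p powr \<tau>"
    if "length v \<le> n + Suc i" "set v \<subseteq> {1..A}" "prod_list v * N \<le> p" for v
    using that G' small.G_subset N_pos U_pos U_le_A A_less dyadic_N_A_N_le dyadic_N_le_square
    by (intro energy[of G' A]) auto
  have "real (card (unrepresented p H G)) \<le> real (card (unrepresented p (U ^ (n + Suc (Suc i))) G'))"
    using finite_unrepresented unrepresented_antimono[OF G'(1) U_H] by (intro of_nat_mono card_mono)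
  also have "\<dots> \<le> 2 * (C\<^sub>2 * real p powr \<tau>) * real p *
      ((real p powr (- \<tau>))\<^sup>2 + (C\<^sub>1 * real p powr (- \<delta>) / (real p powr (- \<tau>)) ^ n)\<^sup>2)"
  proof (rule small.card_unrepresented_power_le)
    show "U ^ Suc n < p" "0 < U" using A_less U_pos by (simp_all add: A_def)
    show "0 < card G'" "p \<le> 2 * (card G' * U ^ (n + Suc i))" using G' N_pos p_le_N_V by (simp_all add: V_def)
    show "0 < real p powr (- \<tau>)" using p_ge_2 by simp
    show "cmod (interval_sum p k (U ^ Suc n)) \<le> C\<^sub>1 * real p powr (- \<delta>) * real (U ^ Suc n)" if "0 < k" "k < p - 1" for k
      using burgess[OF that A_ge A_le] unfolding A_def by (simp only: mult_ac)
    have "V * N \<le> p" using N_V_le by (simp add: mult.commute)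
    then show "energy_ratio G' (U ^ Suc n # replicate i U) \<le> C\<^sub>2 * real p powr \<tau>"
      using U_pos U_le_A unfolding A_def[symmetric]
      by (intro energy') (auto simp: prod_list_replicate A_mult_power)
    show "energy_ratio G' (replicate (n + Suc i) U) \<le> C\<^sub>2 * real p powr \<tau>"
      using U_pos U_le_A \<open>V * N \<le> p\<close> by (intro energy') (auto simp: prod_list_replicate V_def)
  qed
  also have "\<dots> \<le> 2 * (C\<^sub>2 * real p powr \<tau>) * real p * ((1 + C\<^sub>1\<^sup>2) * real p powr (- 2 * \<tau>))"
    using p_ge_2 C \<tau> by (intro mult_left_mono power_saving_square_le) auto
  also have "\<dots> = 2 * C\<^sub>2 * (1 + C\<^sub>1\<^sup>2) * (real p powr \<tau> * real p powr 1 * real p powr (- 2 * \<tau>))"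
    using p_ge_2 by (simp add: mult_ac)
  also have "real p powr \<tau> * real p powr 1 * real p powr (- 2 * \<tau>) = real p powr (1 - \<tau>)"
    unfolding powr_add[symmetric] by simp
  finally show ?thesis .
qed

end

lemma card_unrepresented_bound_large_prime:
  fixes \<epsilon> :: real
  assumes \<epsilon>: "0 < \<epsilon>" "\<epsilon> \<le> 1 / 16"
  shows "\<exists>\<delta>>0. \<delta> \<le> 1 \<and> (\<exists>C\<ge>0. \<exists>x\<^sub>0. \<forall>p H G. prime p \<longrightarrow> x\<^sub>0 \<le> real p \<longrightarrow> G \<subseteq> {1..<int p} \<longrightarrow>
    real p powr (3 / 8) \<le> real (card G) \<longrightarrow> real p powr (5 / 8 + \<epsilon>) \<le> real H \<longrightarrow>
    real (card (unrepresented p H G)) \<le> C * real p powr (1 - \<delta>))"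
proof -
  obtain u :: real and n i where u: "0 < u" "u * real (Suc n) = 1 / 4 + \<epsilon> / 2" "3 / 8 \<le> u * real i"
    "u * real (n + Suc (Suc i)) \<le> 5 / 8 + 3 * \<epsilon> / 4" and l: "4 \<le> n + Suc i"
    using ex_box_exponents[OF \<epsilon>] by blast
  obtain \<delta> C\<^sub>1 where burgess: "0 < \<delta>" "0 < C\<^sub>1" "\<And>p k A. prime p \<Longrightarrow> 0 < k \<Longrightarrow> k < p - 1 \<Longrightarrow>
      real p powr (1 / 4 + \<epsilon> / 2) \<le> real A \<Longrightarrow> real A \<le> 2 * real p powr (1 / 4 + \<epsilon> / 2) \<Longrightarrow>
      cmod (interval_sum p k A) \<le> C\<^sub>1 * real A * real p powr (- \<delta>)"
    using burgess_bound[of "\<epsilon> / 2"] \<epsilon> by auto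
  define \<tau> where "\<tau> = min \<delta> 1 / real (Suc n)"
  have \<tau>: "0 < \<tau>" "\<tau> \<le> 1" "\<tau> * real (Suc n) \<le> \<delta>" using burgess(1) by (simp_all add: \<tau>_def divide_le_eq)
  obtain C\<^sub>2 where energy: "0 < C\<^sub>2" "\<And>p A v G. prime p \<Longrightarrow> G \<subseteq> {1..<int p} \<Longrightarrow> 0 < card G \<Longrightarrow> 1 \<le> A \<Longrightarrow>
      A < p \<Longrightarrow> 2 ^ (n + Suc i) * card G * A * card G \<le> p \<Longrightarrow> 2 ^ (n + Suc i) * card G \<le> A\<^sup>2 \<Longrightarrow>
      length v \<le> n + Suc i \<Longrightarrow> set v \<subseteq> {1..A} \<Longrightarrow> prod_list v * card G \<le> p \<Longrightarrow>
      prime_mod.energy_ratio p G v \<le> C\<^sub>2 * real p powr \<tau>"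
    using energy_ratio_bound[OF \<tau>(1) l] by blast
  have "\<forall>\<^sub>F x in at_top. (\<exists>U>0. \<forall>k\<le>n + Suc (Suc i). x powr (u * real k) \<le> real (U ^ k) \<and>
      real (U ^ k) \<le> 2 * x powr (u * real k)) \<and> 2 \<le> x powr (\<epsilon> / 4) \<and> 2 ^ (n + Suc i) \<le> x powr (\<epsilon> / 2)"
    using u(1) \<epsilon> by (intro eventually_conj eventually_ex_power_approx eventually_powr_ge) auto
  then obtain x\<^sub>0 where x\<^sub>0: "\<And>x. x\<^sub>0 \<le> x \<Longrightarrow> (\<exists>U>0. \<forall>k\<le>n + Suc (Suc i). x powr (u * real k) \<le> real (U ^ k) \<and>
      real (U ^ k) \<le> 2 * x powr (u * real k)) \<and> 2 \<le> x powr (\<epsilon> / 4) \<and> 2 ^ (n + Suc i) \<le> x powr (\<epsilon> / 2)"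
    unfolding eventually_at_top_linorder by blast
  show ?thesis
  proof (rule exI[of _ \<tau>], intro conjI \<tau>, rule exI[of _ "2 * C\<^sub>2 * (1 + C\<^sub>1\<^sup>2)"], intro conjI exI[of _ x\<^sub>0] allI impI)
    show "0 \<le> 2 * C\<^sub>2 * (1 + C\<^sub>1\<^sup>2)" using energy(1) by simp
    fix p H and G :: "int set"
    assume p: "prime p" and large_p: "x\<^sub>0 \<le> real p" and G: "G \<subseteq> {1..<int p}" "real p powr (3 / 8) \<le> real (card G)"
      and H: "real p powr (5 / 8 + \<epsilon>) \<le> real H"
    obtain U where U: "0 < U" "\<And>k. k \<le> n + Suc (Suc i) \<Longrightarrow>
        real p powr (u * real k) \<le> real (U ^ k) \<and> real (U ^ k) \<le> 2 * real p powr (u * real k)"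
      and large: "2 \<le> real p powr (\<epsilon> / 4)" "2 ^ (n + Suc i) \<le> real p powr (\<epsilon> / 2)"
      using x\<^sub>0[OF large_p] by blast
    interpret box_sizes p G \<epsilon> u n i U by unfold_locales (use p G \<epsilon> u U large in auto)
    show "real (card (unrepresented p H G)) \<le> 2 * C\<^sub>2 * (1 + C\<^sub>1\<^sup>2) * real p powr (1 - \<tau>)"
      using burgess(2) energy(1)
      by (intro card_unrepresented_le_powr[OF H _ _ \<tau>(3) burgess(3)[OF p] energy(2)[OF p]]) auto
  qed
qed

theorem card_unrepresented_bound:
  fixes \<epsilon> :: real
  assumes \<epsilon>: "0 < \<epsilon>" "\<epsilon> \<le> 1 / 16"
  shows "\<exists>\<delta>>0. \<delta> \<le> 1 \<and> (\<exists>C\<ge>0. \<forall>p H G. prime p \<longrightarrow> G \<subseteq> {1..<int p} \<longrightarrow> real p powr (3 / 8) \<le> real (card G) \<longrightarrow>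
    real p powr (5 / 8 + \<epsilon>) \<le> real H \<longrightarrow> real (card (unrepresented p H G)) \<le> C * real p powr (1 - \<delta>))"
proof -
  obtain \<delta> C x\<^sub>0 where \<delta>: "0 < \<delta>" "\<delta> \<le> 1" and C: "0 \<le> C" and bound: "\<And>p H G. prime p \<Longrightarrow> x\<^sub>0 \<le> real p \<Longrightarrow>
      G \<subseteq> {1..<int p} \<Longrightarrow> real p powr (3 / 8) \<le> real (card G) \<Longrightarrow> real p powr (5 / 8 + \<epsilon>) \<le> real H \<Longrightarrow>
      real (card (unrepresented p H G)) \<le> C * real p powr (1 - \<delta>)"
    using card_unrepresented_bound_large_prime[OF \<epsilon>] by blast
  show ?thesis
  proof (rule exI[of _ \<delta>], intro conjI \<delta>, rule exI[of _ "C + max 0 x\<^sub>0"], intro conjI allI impI)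
    show "0 \<le> C + max 0 x\<^sub>0" using C by simp
    fix p H and G :: "int set"
    assume p: "prime p" and G: "G \<subseteq> {1..<int p}" "real p powr (3 / 8) \<le> real (card G)"
      and H: "real p powr (5 / 8 + \<epsilon>) \<le> real H"
    show "real (card (unrepresented p H G)) \<le> (C + max 0 x\<^sub>0) * real p powr (1 - \<delta>)"
    proof (cases "x\<^sub>0 \<le> real p")
      case True
      have "real (card (unrepresented p H G)) \<le> C * real p powr (1 - \<delta>)" by (rule bound[OF p True G H])
      also have "\<dots> \<le> (C + max 0 x\<^sub>0) * real p powr (1 - \<delta>)" by (intro mult_right_mono) auto
      finally show ?thesis .
    next
      case False
      have "real (card (unrepresented p H G)) \<le> real p" using card_unrepresented_le by simp
      also have "\<dots> \<le> (C + max 0 x\<^sub>0) * 1" using False C by simp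
      also have "\<dots> \<le> (C + max 0 x\<^sub>0) * real p powr (1 - \<delta>)"
        using prime_ge_2_nat[OF p] \<delta>(2) C by (intro mult_left_mono ge_one_powr_ge_zero) auto
      finally show ?thesis .
    qed
  qed
qed

lemma subgroup_mult_of_residue_ring_subset:
  assumes "subgroup G (mult_of (residue_ring m))"
  shows "G \<subseteq> {1..<m}"
  using subgroup.subset[OF assms] by (auto simp: residue_ring_def)

lemma power_set_mod_subset:
  assumes p: "prime p" and g: "residue_primroot p g"
  shows "power_set_mod p g N \<subseteq> {1..<int p}"
proof -
  interpret prime_mod p by unfold_locales (rule p)
  have "int g ^ i mod int p \<in> {1..<int p}" for i
  proof -
    have "\<not> p dvd g ^ i"
      using g prime_p p_ge_2 by (auto simp: residue_primroot_def dest!: prime_dvd_power coprime_common_divisor)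
    then have "int g ^ i mod int p \<noteq> 0" by (simp add: dvd_eq_mod_eq_0[symmetric] flip: of_nat_power)
    moreover have "0 \<le> int g ^ i mod int p" "int g ^ i mod int p < int p" using p_ge_2 by simp_all
    ultimately show ?thesis by simp
  qed
  then show ?thesis by (auto simp: power_set_mod_def)
qed

lemma interval_mod_set_mult:
  "interval_mod p H <#>\<^bsub>residue_ring (int p)\<^esub> G = (\<Union>h\<in>{1..H}. \<Union>g\<in>G. {g * int h mod int p})"
  unfolding set_mult_def interval_mod_def residue_ring_def by (simp add: mod_mult_right_eq mult.commute)

lemma residues_subset_interval_mod_set_mult_Un:
  "{1..<int p} \<subseteq> (interval_mod p H <#>\<^bsub>residue_ring (int p)\<^esub> G) \<union> unrepresented p H G"
  by (fastforce simp: interval_mod_set_mult unrepresented_def unique_euclidean_semiring_class.cong_def)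

lemma card_interval_mod_set_mult:
  assumes "0 < p"
  shows "card (interval_mod p H <#>\<^bsub>residue_ring (int p)\<^esub> G) \<le> p"
    and "p \<le> card (interval_mod p H <#>\<^bsub>residue_ring (int p)\<^esub> G) + card (unrepresented p H G) + 1"
proof -
  let ?P = "interval_mod p H <#>\<^bsub>residue_ring (int p)\<^esub> G"
  have P: "?P \<subseteq> {0..<int p}" using assms by (auto simp: interval_mod_set_mult)
  then show "card ?P \<le> p" using card_mono[OF _ P] by simp
  have "finite ?P" using P finite_subset by blast
  then have "card {1..<int p} \<le> card (?P \<union> unrepresented p H G)"
    using residues_subset_interval_mod_set_mult_Un finite_unrepresented by (intro card_mono) auto
  also have "\<dots> \<le> card ?P + card (unrepresented p H G)" by (rule card_Un_le)
  finally show "p \<le> card ?P + card (unrepresented p H G) + 1" by simp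
qed

theorem theorem3:
  fixes \<epsilon> :: real
  assumes "\<epsilon> > 0"
  shows "\<exists>\<delta>::real. \<delta> > 0 \<and> (\<exists>C::real. \<forall>(p::nat) (H::nat) (G::int set).
    prime p \<longrightarrow> H > 0 \<longrightarrow> card (interval_mod p H) = H \<longrightarrow>
    (subgroup G (mult_of (residue_ring (int p))) \<or>
     (\<exists>(g::nat) (N::nat). residue_primroot p g \<and> G = power_set_mod p g N \<and> card G = N)) \<longrightarrow>
    real (card (interval_mod p H)) > real p powr (5 / 8 + \<epsilon>) \<longrightarrow>
    real (card G) > real p powr (3 / 8) \<longrightarrow>
    \<bar>real (card (interval_mod p H <#>\<^bsub>residue_ring (int p)\<^esub> G)) - real p\<bar>
      \<le> C * real p powr (1 - \<delta>))"
proof -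
  define \<epsilon>' where "\<epsilon>' = min \<epsilon> (1 / 16)"
  have \<epsilon>': "0 < \<epsilon>'" "\<epsilon>' \<le> 1 / 16" "\<epsilon>' \<le> \<epsilon>" using assms by (auto simp: \<epsilon>'_def)
  obtain \<delta> C where \<delta>: "0 < \<delta>" "\<delta> \<le> 1" and C: "\<And>p H G. prime p \<Longrightarrow> G \<subseteq> {1..<int p} \<Longrightarrow>
      real p powr (3 / 8) \<le> real (card G) \<Longrightarrow> real p powr (5 / 8 + \<epsilon>') \<le> real H \<Longrightarrow>
      real (card (unrepresented p H G)) \<le> C * real p powr (1 - \<delta>)"
    using card_unrepresented_bound[OF \<epsilon>'(1,2)] by blast
  show ?thesis
  proof (rule exI[of _ \<delta>], intro conjI \<delta>, rule exI[of _ "C + 1"], intro allI impI)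
    fix p H :: nat and G :: "int set"
    assume p: "prime p" and H: "card (interval_mod p H) = H" "real p powr (5 / 8 + \<epsilon>) < real (card (interval_mod p H))"
      and G: "subgroup G (mult_of (residue_ring (int p))) \<or>
        (\<exists>g N. residue_primroot p g \<and> G = power_set_mod p g N \<and> card G = N)" "real p powr (3 / 8) < real (card G)"
    have p_ge_2: "2 \<le> p" using p by (rule prime_ge_2_nat)
    have "G \<subseteq> {1..<int p}" using G(1) subgroup_mult_of_residue_ring_subset power_set_mod_subset[OF p] by blast
    moreover have "real p powr (5 / 8 + \<epsilon>') \<le> real p powr (5 / 8 + \<epsilon>)" using \<epsilon>' p_ge_2 by (intro powr_mono) auto
    ultimately have "real (card (unrepresented p H G)) \<le> C * real p powr (1 - \<delta>)" using p G(2) H by (intro C) auto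
    moreover have "1 \<le> real p powr (1 - \<delta>)" using p_ge_2 \<delta> by (intro ge_one_powr_ge_zero) auto
    ultimately show "\<bar>real (card (interval_mod p H <#>\<^bsub>residue_ring (int p)\<^esub> G)) - real p\<bar> \<le> (C + 1) * real p powr (1 - \<delta>)"
      using card_interval_mod_set_mult[of p H G] p_ge_2 by (simp add: ring_distribs)
  qed
qed

end
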